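(* Let $n\ge 3$ and let $\kappa$ be the unique integer with $\binom{\kappa}{2}<n\le\binom{\kappa+1}{2}$. Let $A(z,\bar z)$ be a Hermitian polynomial on $\mathbb C^n$ such that $A(z,\bar z)\notin \mathrm{SOS}_n$ but $A(z,\bar z)\|z\|^2\in\mathrm{SOS}_n$. Then the rank of $A(z,\bar z)\|z\|^2$ is at least $$\Lambda_n=n\kappa-\binom{\kappa}{2}-1 .$$
   Context: A Hermitian polynomial on $\mathbb C^n$ is a real-valued polynomial $A(z,\bar z)=\sum_{\alpha,\beta}c_{\alpha\beta}z^\alpha\bar z^\beta$ (finite sum over multi-indices, $c_{\beta\alpha}=\overline{c_{\alpha\beta}}$). Its rank is the rank of the Hermitian coefficient matrix $(c_{\alpha\beta})$. Write $A\in\mathrm{SOS}_n$ if $A(z,\bar z)=\sum_{\mu=1}^m|f_\mu(z)|^2$ for finitely many holomorphic polynomials $f_\mu\in\mathbb C[z_1,\dots,z_n]$ (the zero polynomial is in $\mathrm{SOS}_n$). $\|z\|^2=\sum_{j=1}^n|z_j|^2$. *)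

theory Defs
  imports "HOL-Analysis.Analysis" "HOL-Library.Poly_Mapping" "HOL-Library.Function_Algebras"
begin

text \<open>
  Multi-indices, holomorphic polynomials in \<open>z\<close>, and polynomials in \<open>(z, cnj z)\<close>; in the last,
  the key \<open>(\<alpha>, \<beta>)\<close> stands for the monomial \<open>z\<^sup>\<alpha> (cnj z)\<^sup>\<beta>\<close>. The number of variables is \<open>CARD('n)\<close>.
  Keys add componentwise, so the product of \<^type>\<open>poly_mapping\<close> is multiplication of polynomials.
\<close>

type_synonym 'n mindex = "'n \<Rightarrow>\<^sub>0 nat"
type_synonym 'n hol_poly = "'n mindex \<Rightarrow>\<^sub>0 complex"
type_synonym 'n bi_poly = "('n mindex \<times> 'n mindex) \<Rightarrow>\<^sub>0 complex"

definition mindex_power :: "complex ^ 'n::finite \<Rightarrow> 'n mindex \<Rightarrow> complex" where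
  "mindex_power z \<alpha> = (\<Prod>j\<in>UNIV. (z $ j) ^ Poly_Mapping.lookup \<alpha> j)"

definition hol_eval :: "'n::finite hol_poly \<Rightarrow> complex ^ 'n \<Rightarrow> complex" where
  "hol_eval f z = (\<Sum>\<alpha>\<in>Poly_Mapping.keys f. Poly_Mapping.lookup f \<alpha> * mindex_power z \<alpha>)"

definition bi_eval :: "'n::finite bi_poly \<Rightarrow> complex ^ 'n \<Rightarrow> complex" where
  "bi_eval A z = (\<Sum>(\<alpha>, \<beta>)\<in>Poly_Mapping.keys A.
     Poly_Mapping.lookup A (\<alpha>, \<beta>) * mindex_power z \<alpha> * cnj (mindex_power z \<beta>))"

definition hermitian :: "'n::finite bi_poly \<Rightarrow> bool" where
  "hermitian A \<longleftrightarrow>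
     (\<forall>\<alpha> \<beta>. Poly_Mapping.lookup A (\<beta>, \<alpha>) = cnj (Poly_Mapping.lookup A (\<alpha>, \<beta>)))"

definition SOS :: "'n::finite bi_poly set" where
  "SOS = {A. \<exists>(m::nat) (f :: nat \<Rightarrow> 'n hol_poly). \<forall>z.
     bi_eval A z = complex_of_real (\<Sum>\<mu><m. (cmod (hol_eval (f \<mu>) z))\<^sup>2)}"

definition norm_sq :: "'n::finite bi_poly" where
  "norm_sq = (\<Sum>j\<in>UNIV.
     Poly_Mapping.single (Poly_Mapping.single j 1, Poly_Mapping.single j 1) 1)"

interpretation cfun: vector_space "\<lambda>(c::complex) (v :: 'i \<Rightarrow> complex) i. c * v i"
  by standard (auto simp: fun_eq_iff algebra_simps)

text \<open>
  Evaluation is multiplicative, and \<open>norm_sq\<close> is \<open>\<parallel>z\<parallel>\<^sup>2\<close>: the product \<open>A * norm_sq\<close> is the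
  polynomial with values \<open>A(z, cnj z) \<parallel>z\<parallel>\<^sup>2\<close>.
\<close>

lemma mindex_power_add: "mindex_power z (\<alpha> + \<beta>) = mindex_power z \<alpha> * mindex_power z \<beta>"
  by (simp add: mindex_power_def lookup_add power_add prod.distrib)

lemma bi_eval_superset:
  assumes "finite S" "Poly_Mapping.keys A \<subseteq> S"
  shows "bi_eval A z = (\<Sum>(\<alpha>, \<beta>)\<in>S.
     Poly_Mapping.lookup A (\<alpha>, \<beta>) * mindex_power z \<alpha> * cnj (mindex_power z \<beta>))"
  unfolding bi_eval_def using assms
  by (intro sum.mono_neutral_left) (auto simp: in_keys_iff)

lemma bi_eval_0: "bi_eval 0 z = 0"
  by (simp add: bi_eval_def)

lemma bi_eval_add: "bi_eval (A + B) z = bi_eval A z + bi_eval B z"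
proof -
  let ?S = "Poly_Mapping.keys A \<union> Poly_Mapping.keys B"
  have S: "finite ?S" "Poly_Mapping.keys (A + B) \<subseteq> ?S"
    by (simp_all add: Poly_Mapping.keys_add)
  show ?thesis
    using bi_eval_superset[OF S, of z] bi_eval_superset[of ?S A z] bi_eval_superset[of ?S B z]
    by (simp add: lookup_add case_prod_unfold algebra_simps sum.distrib)
qed

lemma bi_eval_single:
  "bi_eval (Poly_Mapping.single (\<alpha>, \<beta>) c) z = c * mindex_power z \<alpha> * cnj (mindex_power z \<beta>)"
  by (simp add: bi_eval_def)

lemma bi_eval_sum: "bi_eval (sum f I) z = (\<Sum>i\<in>I. bi_eval (f i) z)"
  by (induction I rule: infinite_finite_induct) (auto simp: bi_eval_0 bi_eval_add)

lemma bi_eval_mult: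
  fixes A B :: "'n::finite bi_poly"
  shows "bi_eval (A * B) z = bi_eval A z * bi_eval B z"
proof -
  have decomp: "P = (\<Sum>k\<in>Poly_Mapping.keys P. Poly_Mapping.single k (Poly_Mapping.lookup P k))"
    for P :: "'n bi_poly"
    by (rule poly_mapping_eqI)
      (auto simp: lookup_sum lookup_single when_def in_keys_iff sum.delta)
  have single: "bi_eval (Poly_Mapping.single k c * Poly_Mapping.single l d) z =
      bi_eval (Poly_Mapping.single k c) z * bi_eval (Poly_Mapping.single l d) z"
    for k l :: "'n mindex \<times> 'n mindex" and c d
    by (cases k; cases l) (simp add: mult_single bi_eval_single mindex_power_add)
  have "bi_eval (sum (\<lambda>k. Poly_Mapping.single k (a k)) I * sum (\<lambda>l. Poly_Mapping.single l (b l)) J) z =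
      bi_eval (sum (\<lambda>k. Poly_Mapping.single k (a k)) I) z *
      bi_eval (sum (\<lambda>l. Poly_Mapping.single l (b l)) J) z"
    for a b :: "'n mindex \<times> 'n mindex \<Rightarrow> complex" and I J
    by (simp add: sum_product bi_eval_sum single)
  from this[of "Poly_Mapping.lookup A" "Poly_Mapping.keys A"
      "Poly_Mapping.lookup B" "Poly_Mapping.keys B"]
  show ?thesis
    unfolding decomp[symmetric] .
qed

lemma bi_eval_norm_sq: "bi_eval norm_sq z = complex_of_real ((norm z)\<^sup>2)"
proof -
  have "mindex_power z (Poly_Mapping.single j 1) = z $ j" for j
    by (simp add: mindex_power_def lookup_single when_def if_distrib power_0 cong: if_cong)
  moreover have "(norm z)\<^sup>2 = (\<Sum>j\<in>UNIV. (cmod (z $ j))\<^sup>2)"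
    by (simp add: norm_vec_def L2_set_def sum_nonneg)
  ultimately show ?thesis
    by (simp add: norm_sq_def bi_eval_sum bi_eval_single complex_norm_square[symmetric])
qed

text \<open>
  Rank of the coefficient matrix, as the dimension of its column space. The matrix is indexed by
  all multi-indices but has finitely many nonzero entries, so this space is finite-dimensional
  (\<open>dim\<close> would be \<open>0\<close> otherwise).
\<close>

definition herm_rank :: "'n::finite bi_poly \<Rightarrow> nat" where
  "herm_rank A = cfun.dim (range (\<lambda>\<beta> \<alpha>. Poly_Mapping.lookup A (\<alpha>, \<beta>)))"

end

theory Submission
  imports Defs "HOL-Computational_Algebra.Fundamental_Theorem_Algebra"
begin

text \<open>
  Polarization turns \<open>A\<close> into a Hermitian kernel \<open>A(z, w)\<close>, and \<open>A \<parallel>z\<parallel>\<^sup>2\<close> into the positive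
  semidefinite kernel \<open>B(z, w) = A(z, w) \<langle>z, w\<rangle>\<close>; the rank in question is the dimension of the column
  space \<open>U\<close> of \<open>B\<close>. Since \<open>A\<close> is nonnegative on the diagonal without being positive semidefinite,
  there are three points of a plane at which the columns of \<open>A\<close> have independent values.

  Let \<open>t\<close> be the rank of \<open>A\<close>, and let \<open>r\<^sub>j\<close> be the dimension of the restriction of \<open>U\<close> to the
  \<open>j\<close>-dimensional member of a generic flag \<open>E\<^sub>1 \<subset> \<dots> \<subset> E\<^sub>n\<close>, on which the columns of \<open>A\<close> have rank at
  least \<open>min t (j + 1)\<close>. If \<open>U\<close> contains, on \<open>E\<^sub>j\<close>, the products of all linear forms with all columns
  of \<open>A\<close>, then the multiples of the equation of \<open>E\<^sub>j\<^sub>-\<^sub>1\<close> give \<open>r\<^sub>j - r\<^sub>j\<^sub>-\<^sub>1 \<ge> min t (j + 1)\<close>. Otherwise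
  a perturbation of the flag shows \<open>r\<^sub>j - r\<^sub>j\<^sub>-\<^sub>1 \<ge> min (r\<^sub>j\<^sub>+\<^sub>1 - r\<^sub>j) j + 1\<close>.

  The same count of multiples, for the products of all coordinates with the columns of \<open>A\<close>, yields
  \<open>t > \<kappa>\<close>, because these products already arise from a hyperplane of the column space and so span at
  most \<open>n (t - 1)\<close> dimensions. Finally \<open>B\<close> vanishes between orthogonal subspaces, whence
  \<open>r\<^sub>a + r\<^sub>b \<le> r\<^sub>n\<close> for \<open>a + b = n\<close>, and adding up the drops of \<open>r\<close> below \<open>\<kappa>\<close> and below \<open>n - \<kappa>\<close> gives
  the bound.
\<close>

subsection \<open>Polynomial functions of one complex variable\<close>

text \<open>The drop r_j - r_(j-1) is controlled from the top of the flag downwards: it is at least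
  1 at j = n and gains one per step until a cap is met, so it is at least the minimum of n - j + 1,
  j + 1 and \<kappa> + 1. The cap j + 1 reflects the number of points available on E_j, the cap
  \<kappa> + 1 reflects t > \<kappa>. Summing these drops alone is too weak, because the topmost
  ones are only 1, 2, ..., \<kappa>. Orthogonality trades those \<kappa> drops for the rank on
  E_\<kappa>, which is at least 1 + 3 + 4 + ... + (\<kappa> + 1), a gain of \<kappa> - 1. The lower
  bound on n is spent twice: on t > \<kappa> and on the final balance. The obstacle is that a single
  hyperplane has to do several things at once: carry enough points, have maximal rank, and witness a
  failure of saturation. Each demand is therefore phrased so that along a line it fails for finitely
  many parameters only; polynomials in one variable and elimination then do the work of Zariski
  topology and determinants.\<close>

definition poly_fun :: "(complex \<Rightarrow> complex) \<Rightarrow> bool" where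
  "poly_fun f \<longleftrightarrow> (\<exists>p. \<forall>x. f x = poly p x)"

lemma poly_fun_const [simp]: "poly_fun (\<lambda>x. c)"
  unfolding poly_fun_def by (intro exI[of _ "[:c:]"]) simp

lemma poly_fun_id [simp]: "poly_fun (\<lambda>x. x)"
  unfolding poly_fun_def by (intro exI[of _ "[:0, 1:]"]) simp

lemma poly_fun_add: "poly_fun f \<Longrightarrow> poly_fun g \<Longrightarrow> poly_fun (\<lambda>x. f x + g x)"
  unfolding poly_fun_def by (metis poly_add)

lemma poly_fun_mult: "poly_fun f \<Longrightarrow> poly_fun g \<Longrightarrow> poly_fun (\<lambda>x. f x * g x)"
  unfolding poly_fun_def by (metis poly_mult)

lemma poly_fun_diff: "poly_fun f \<Longrightarrow> poly_fun g \<Longrightarrow> poly_fun (\<lambda>x. f x - g x)"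
  unfolding poly_fun_def by (metis poly_diff)

lemma poly_fun_sum: "(\<And>i. i \<in> I \<Longrightarrow> poly_fun (f i)) \<Longrightarrow> poly_fun (\<lambda>x. \<Sum>i\<in>I. f i x)"
  by (induction I rule: infinite_finite_induct) (auto intro: poly_fun_add)

lemmas poly_fun_intros = poly_fun_add poly_fun_mult poly_fun_diff poly_fun_sum

lemma poly_fun_finite_zeros:
  assumes "poly_fun f" "f x \<noteq> 0"
  shows "finite {x. f x = 0}"
proof -
  obtain p where p: "\<And>x. f x = poly p x"
    using assms(1) unfolding poly_fun_def by blast
  then have "p \<noteq> 0"
    using assms(2) by auto
  then show ?thesis
    using poly_roots_finite[of p] p by simp
qed

lemma cofinite_ex:
  assumes "finite {x::complex. \<not> P x}"
  shows "\<exists>x. P x"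
proof (rule ccontr)
  assume "\<nexists>x. P x"
  then have "{x. \<not> P x} = UNIV"
    by auto
  then show False
    using assms infinite_UNIV_char_0 by metis
qed

lemma cofinite_conj:
  assumes "finite {x::complex. \<not> P x}" "finite {x. \<not> Q x}"
  shows "finite {x. \<not> (P x \<and> Q x)}"
proof -
  have "{x. \<not> (P x \<and> Q x)} = {x. \<not> P x} \<union> {x. \<not> Q x}"
    by auto
  then show ?thesis
    using assms by simp
qed

lemma cofinite_mono:
  assumes "finite {x::complex. \<not> P x}" "\<And>x. P x \<Longrightarrow> Q x"
  shows "finite {x. \<not> Q x}"
  by (rule finite_subset[OF _ assms(1)]) (use assms(2) in auto)

subsection \<open>Linear independence and rank of families of functions on a set\<close>

text \<open>Functions are compared only through their values on \<open>S\<close>, so restricting to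
  a subspace means shrinking \<open>S\<close> while the functions stay the same objects. The family
  is indexed, so a repeated member counts as a dependence.\<close>

definition indep :: "('i \<Rightarrow> 's \<Rightarrow> complex) \<Rightarrow> 'i set \<Rightarrow> 's set \<Rightarrow> bool" where
  "indep u I S \<longleftrightarrow> (\<forall>c. (\<forall>s\<in>S. (\<Sum>i\<in>I. c i * u i s) = 0) \<longrightarrow> (\<forall>i\<in>I. c i = 0))"

lemma indepI:
  assumes "\<And>c i. (\<And>s. s \<in> S \<Longrightarrow> (\<Sum>i\<in>I. c i * u i s) = 0) \<Longrightarrow> i \<in> I \<Longrightarrow> c i = 0"
  shows "indep u I S"
  using assms unfolding indep_def by blast

lemma indepD:
  assumes "indep u I S" "\<And>s. s \<in> S \<Longrightarrow> (\<Sum>i\<in>I. c i * u i s) = 0" "i \<in> I"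
  shows "c i = 0"
  using assms unfolding indep_def by blast

lemma indep_empty [simp]: "indep u {} S"
  by (simp add: indep_def)

lemma indep_mono: "indep u I S \<Longrightarrow> S \<subseteq> S' \<Longrightarrow> indep u I S'"
  unfolding indep_def by blast

lemma indep_cong:
  assumes "\<And>i s. i \<in> I \<Longrightarrow> s \<in> S \<Longrightarrow> u i s = v i s"
  shows "indep u I S \<longleftrightarrow> indep v I S"
proof -
  have "(\<Sum>i\<in>I. c i * u i s) = (\<Sum>i\<in>I. c i * v i s)" if "s \<in> S" for c s
    using assms that by (intro sum.cong) auto
  then show ?thesis
    unfolding indep_def by simp
qed

lemma indep_subset:
  assumes "indep u I S" "J \<subseteq> I" "finite I"
  shows "indep u J S"
proof (rule indepI)
  fix c i assume c: "\<And>s. s \<in> S \<Longrightarrow> (\<Sum>i\<in>J. c i * u i s) = 0" and i: "i \<in> J"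
  have "(\<Sum>i\<in>I. (if i \<in> J then c i else 0) * u i s) = (\<Sum>i\<in>J. c i * u i s)" for s
    using assms by (intro sum.mono_neutral_cong_right) auto
  then have "(if i \<in> J then c i else 0) = 0"
    using indepD[OF assms(1), of "\<lambda>i. if i \<in> J then c i else 0" i] c i assms(2) by auto
  then show "c i = 0"
    using i by simp
qed

lemma indep_image:
  assumes "indep u (h ` J) S" "inj_on h J"
  shows "indep (\<lambda>j. u (h j)) J S"
proof (rule indepI)
  fix c j assume c: "\<And>s. s \<in> S \<Longrightarrow> (\<Sum>j\<in>J. c j * u (h j) s) = 0" and j: "j \<in> J"
  have "(\<Sum>i\<in>h ` J. c (inv_into J h i) * u i s) = (\<Sum>j\<in>J. c j * u (h j) s)" for s
    using assms(2) by (subst sum.reindex) (auto intro!: sum.cong)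
  then have "c (inv_into J h (h j)) = 0"
    using indepD[OF assms(1), of "\<lambda>i. c (inv_into J h i)" "h j"] c j by auto
  then show "c j = 0"
    using assms(2) j by simp
qed

lemma indep_dependent_insert:
  assumes "indep u J S" "\<not> indep u (insert k J) S" "finite J" "k \<notin> J"
  obtains c where "\<And>s. s \<in> S \<Longrightarrow> u k s = (\<Sum>j\<in>J. c j * u j s)"
proof -
  obtain c i where c: "\<And>s. s \<in> S \<Longrightarrow> (\<Sum>i\<in>insert k J. c i * u i s) = 0"
    and i: "i \<in> insert k J" "c i \<noteq> 0"
    using assms(2) unfolding indep_def by auto
  have eq: "c k * u k s + (\<Sum>j\<in>J. c j * u j s) = 0" if "s \<in> S" for s
    using c[OF that] assms(3,4) by simp
  have "c k \<noteq> 0"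
  proof
    assume "c k = 0"
    then have "\<And>j. j \<in> J \<Longrightarrow> c j = 0"
      using indepD[OF assms(1), of c] eq by auto
    then show False
      using i \<open>c k = 0\<close> by auto
  qed
  have "u k s = (\<Sum>j\<in>J. (- c j / c k) * u j s)" if "s \<in> S" for s
  proof -
    have "(\<Sum>j\<in>J. (- c j / c k) * u j s) = - (\<Sum>j\<in>J. c j * u j s) / c k"
      by (simp add: sum_negf sum_divide_distrib)
    also have "(\<Sum>j\<in>J. c j * u j s) = - (c k * u k s)"
      using eq[OF that] by (simp add: eq_neg_iff_add_eq_0 add.commute)
    finally show ?thesis
      using \<open>c k \<noteq> 0\<close> by simp
  qed
  then show ?thesis
    by (rule that)
qed

lemma indep_insertI:
  assumes "indep u J S" "finite J" "k \<notin> J"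
    "\<And>c. \<exists>s\<in>S. u k s \<noteq> (\<Sum>j\<in>J. c j * u j s)"
  shows "indep u (insert k J) S"
  using indep_dependent_insert[OF assms(1) _ assms(2,3)] assms(4) by metis

lemma sum_fun_apply: "(\<Sum>x\<in>J. g x) s = (\<Sum>x\<in>J. g x s)"
  for g :: "'a \<Rightarrow> 's \<Rightarrow> complex"
  by (induction J rule: infinite_finite_induct) auto

lemma subspace_lincomb:
  assumes "cfun.subspace U" "\<And>i. i \<in> I \<Longrightarrow> u i \<in> U"
  shows "(\<lambda>s. \<Sum>i\<in>I. c i * u i s) \<in> U"
  using assms(2)
proof (induction I rule: infinite_finite_induct)
  case (insert k I)
  then have "(\<lambda>s. c k * u k s) + (\<lambda>s. \<Sum>i\<in>I. c i * u i s) \<in> U"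
    by (intro cfun.subspace_add[OF assms(1)] cfun.subspace_scale[OF assms(1)]) auto
  then show ?case
    using insert.hyps by (simp add: plus_fun_def)
qed (use cfun.subspace_0[OF assms(1)] in \<open>simp_all add: zero_fun_def\<close>)

lemma subspace_comb2:
  assumes "cfun.subspace U" "u \<in> U" "v \<in> U"
  shows "(\<lambda>s. a * u s + b * v s) \<in> U"
  using cfun.subspace_add[OF assms(1) cfun.subspace_scale[OF assms(1,2), of a]
      cfun.subspace_scale[OF assms(1,3), of b]]
  by (simp add: plus_fun_def)

lemma card_le_of_indep:
  assumes "indep u I UNIV" "finite I" "finite T" "u ` I \<subseteq> cfun.span T"
  shows "card I \<le> card T"
proof -
  have inj: "inj_on u I"
  proof (rule inj_onI, rule ccontr)
    fix i j assume ij: "i \<in> I" "j \<in> I" "u i = u j" "i \<noteq> j"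
    have "indep u {i, j} UNIV"
      by (rule indep_subset[OF assms(1) _ assms(2)]) (use ij in auto)
    from indepD[OF this, of "\<lambda>k. if k = i then 1 else -1" i] ij show False
      by simp
  qed
  have "cfun.independent (u ` I)"
  proof (rule cfun.independent_if_scalars_zero)
    fix f x assume 0: "(\<Sum>x\<in>u ` I. (\<lambda>s. f x * x s)) = 0" and x: "x \<in> u ` I"
    have "(\<Sum>i\<in>I. f (u i) * u i s) = 0" for s
      using fun_cong[OF 0, of s] inj by (simp add: sum_fun_apply sum.reindex)
    then show "f x = 0"
      using indepD[OF assms(1), of "\<lambda>i. f (u i)"] x by auto
  qed (use assms(2) in simp)
  then have "card (u ` I) \<le> card T"
    using cfun.independent_span_bound[OF assms(3) _ assms(4)] by blast
  then show ?thesis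
    using inj by (simp add: card_image)
qed

text \<open>A family is independent on \<open>S\<close> iff some square submatrix of its values is invertible;
  the invertibility is recorded as a biorthogonal system.\<close>

lemma dual_system:
  assumes "finite I" "indep u I S"
  obtains s v where "\<And>i. i \<in> I \<Longrightarrow> s i \<in> S" "v ` I \<subseteq> cfun.span (u ` I)"
    "\<And>i j. i \<in> I \<Longrightarrow> j \<in> I \<Longrightarrow> v i (s j) = (if i = j then 1 else 0)"
  using assms
proof (induction I arbitrary: thesis rule: finite_induct)
  case empty
  then show ?case by simp
next
  case (insert k I)
  have "indep u I S"
    using insert.prems(2) insert.hyps by (elim indep_subset) auto
  then obtain s v where s: "\<And>i. i \<in> I \<Longrightarrow> s i \<in> S" and v: "v ` I \<subseteq> cfun.span (u ` I)"
    and d: "\<And>i j. i \<in> I \<Longrightarrow> j \<in> I \<Longrightarrow> v i (s j) = (if i = j then 1 else 0)"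
    using insert.IH by blast
  let ?sp = "cfun.span (u ` insert k I)"
  have sub: "cfun.subspace ?sp"
    by (rule cfun.subspace_span)
  have v': "v i \<in> ?sp" if "i \<in> I" for i
    using v that cfun.span_mono[of "u ` I" "u ` insert k I"] by blast
  \<comment> \<open>The error of interpolating \<open>u k\<close> at the old nodes. A point of
    \<open>S\<close> where it does not vanish becomes the new node, and the scaled error is the new
    dual function.\<close>
  define f where "f = (\<lambda>x. u k x - (\<Sum>i\<in>I. u k (s i) * v i x))"
  have "(\<lambda>x. 1 * u k x + (-1) * (\<Sum>i\<in>I. u k (s i) * v i x)) \<in> ?sp"
    by (intro subspace_comb2[OF sub] subspace_lincomb[OF sub] v' cfun.span_base) auto
  then have f_sp: "f \<in> ?sp"
    by (simp add: f_def)
  have f0: "f (s j) = 0" if "j \<in> I" for j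
  proof -
    have "(\<Sum>i\<in>I. u k (s i) * v i (s j)) = (\<Sum>i\<in>I. if i = j then u k (s j) else 0)"
      using that by (intro sum.cong) (auto simp: d)
    then show ?thesis
      using that insert.hyps by (simp add: f_def)
  qed
  have "\<exists>x\<in>S. f x \<noteq> 0"
  proof (rule ccontr)
    assume *: "\<not> (\<exists>x\<in>S. f x \<noteq> 0)"
    have "(\<lambda>x. \<Sum>i\<in>I. u k (s i) * v i x) \<in> cfun.span (u ` I)"
      using v by (intro subspace_lincomb cfun.subspace_span) auto
    then obtain a where a: "(\<lambda>x. \<Sum>i\<in>I. u k (s i) * v i x) = (\<Sum>g\<in>u ` I. (\<lambda>x. a g * g x))"
      unfolding cfun.span_finite[OF finite_imageI[OF insert.hyps(1), of u]] by auto
    have inj: "inj_on u I"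
    proof (rule inj_onI, rule ccontr)
      fix i j assume ij: "i \<in> I" "j \<in> I" "u i = u j" "i \<noteq> j"
      have "indep u {i, j} S"
        by (rule indep_subset[OF insert.prems(2)]) (use ij insert.hyps in auto)
      from indepD[OF this, of "\<lambda>k. if k = i then 1 else -1" i] ij show False
        by simp
    qed
    have "u k x = (\<Sum>i\<in>I. a (u i) * u i x)" if "x \<in> S" for x
      using fun_cong[OF a, of x] inj * that by (simp add: sum_fun_apply sum.reindex f_def)
    then have "(\<Sum>i\<in>insert k I. (if i = k then 1 else - a (u i)) * u i x) = 0" if "x \<in> S" for x
    proof -
      have "(\<Sum>i\<in>I. (if i = k then 1 else - a (u i)) * u i x) = (\<Sum>i\<in>I. - (a (u i) * u i x))"
        using insert.hyps by (intro sum.cong) auto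
      then show ?thesis
        using insert.hyps \<open>\<And>x. x \<in> S \<Longrightarrow> u k x = _\<close>[OF that] by (simp add: sum_negf)
    qed
    from indepD[OF insert.prems(2) this, of k] show False
      by simp
  qed
  then obtain x where x: "x \<in> S" "f x \<noteq> 0"
    by blast
  define g where "g = (\<lambda>y. inverse (f x) * f y)"
  define w where "w = (\<lambda>i. if i = k then g else (\<lambda>y. 1 * v i y + (- v i x) * g y))"
  define s' where "s' = s(k := x)"
  have g_sp: "g \<in> ?sp"
    unfolding g_def using f_sp by (rule cfun.subspace_scale[OF sub])
  show ?case
  proof (rule insert.prems(1)[of s' w])
    show "s' i \<in> S" if "i \<in> insert k I" for i
      using that s x by (auto simp: s'_def)
    show "w ` insert k I \<subseteq> ?sp"
    proof (rule image_subsetI)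
      fix i assume "i \<in> insert k I"
      then show "w i \<in> ?sp"
        using subspace_comb2[OF sub v' g_sp, of i 1 "- v i x"] g_sp by (cases "i = k") (simp_all add: w_def)
    qed
    show "w i (s' j) = (if i = j then 1 else 0)" if "i \<in> insert k I" "j \<in> insert k I" for i j
      using that insert.hyps x f0 d by (auto simp: w_def s'_def g_def)
  qed
qed

lemma indep_of_dual:
  assumes "finite I" "\<And>i. i \<in> I \<Longrightarrow> s i \<in> S"
    "\<And>i j. i \<in> I \<Longrightarrow> j \<in> I \<Longrightarrow> v i (s j) = (if i = j then 1 else 0)"
  shows "indep v I S"
proof (rule indepI)
  fix c i assume c: "\<And>s. s \<in> S \<Longrightarrow> (\<Sum>i\<in>I. c i * v i s) = 0" and i: "i \<in> I"
  have "(\<Sum>j\<in>I. c j * v j (s i)) = (\<Sum>j\<in>I. if j = i then c i else 0)"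
    using assms(3) i by (intro sum.cong) auto
  then show "c i = 0"
    using c[OF assms(2)[OF i]] assms(1) i by simp
qed

text \<open>Lower semicontinuity of rank along a polynomial curve, proved by Gaussian elimination
  without division. All genericity statements rest on it.\<close>

lemma indep_poly_curve:
  assumes "finite I" "\<And>i s. i \<in> I \<Longrightarrow> s \<in> S \<Longrightarrow> poly_fun (\<lambda>e. u e i s)" "indep (u e0) I S"
  shows "finite {e. \<not> indep (u e) I S}"
  using assms
proof (induction I arbitrary: u rule: finite_induct)
  case empty
  then show ?case by simp
next
  case (insert k I)
  have "\<exists>s\<in>S. u e0 k s \<noteq> 0"
  proof (rule ccontr)
    assume *: "\<not> (\<exists>s\<in>S. u e0 k s \<noteq> 0)"
    have "(\<Sum>i\<in>insert k I. (if i = k then 1 else 0) * u e0 i s) = 0" if "s \<in> S" for s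
      using * that by (intro sum.neutral) auto
    from indepD[OF insert.prems(2) this, of k] show False
      by simp
  qed
  then obtain t where t: "t \<in> S" "u e0 k t \<noteq> 0"
    by blast
  \<comment> \<open>The 2 x 2 minors with pivot \<open>(k, t)\<close>: they vanish at
    \<open>t\<close>, eliminate \<open>u e k\<close>, and remain polynomial in \<open>e\<close>
    because nothing is divided.\<close>
  define w where "w = (\<lambda>e i s. u e k t * u e i s - u e i t * u e k s)"
  have w_sum: "(\<Sum>i\<in>I. c i * w e i s) = u e k t * (\<Sum>i\<in>I. c i * u e i s) - (\<Sum>i\<in>I. c i * u e i t) * u e k s"
    for c e s
    by (simp add: w_def sum_distrib_left sum_distrib_right sum_subtractf algebra_simps)
  have "finite {e. \<not> indep (w e) I S}"
  proof (rule insert.IH)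
    show "poly_fun (\<lambda>e. w e i s)" if "i \<in> I" "s \<in> S" for i s
      unfolding w_def using that t insert.prems(1) by (intro poly_fun_intros) auto
    show "indep (w e0) I S"
    proof (rule indepI)
      fix c i assume c: "\<And>s. s \<in> S \<Longrightarrow> (\<Sum>i\<in>I. c i * w e0 i s) = 0" and i: "i \<in> I"
      define d where "d = (\<lambda>i. if i = k then - (\<Sum>i\<in>I. c i * u e0 i t) else c i * u e0 k t)"
      have "(\<Sum>i\<in>insert k I. d i * u e0 i s) = 0" if "s \<in> S" for s
      proof -
        have "(\<Sum>i\<in>I. d i * u e0 i s) = (\<Sum>i\<in>I. u e0 k t * (c i * u e0 i s))"
          using insert.hyps by (intro sum.cong) (auto simp: d_def)
        then show ?thesis
          using c[OF that] insert.hyps by (simp add: w_sum d_def sum_distrib_left)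
      qed
      then have "d i = 0"
        using indepD[OF insert.prems(2)] i by blast
      then show "c i = 0"
        using t i insert.hyps by (auto simp: d_def split: if_splits)
    qed
  qed
  moreover have "finite {e. u e k t = 0}"
    using insert.prems(1) t by (intro poly_fun_finite_zeros) auto
  moreover have "indep (u e) (insert k I) S" if "indep (w e) I S" "u e k t \<noteq> 0" for e
  proof (rule indepI)
    fix c i assume c: "\<And>s. s \<in> S \<Longrightarrow> (\<Sum>i\<in>insert k I. c i * u e i s) = 0" and i: "i \<in> insert k I"
    have eq: "(\<Sum>i\<in>I. c i * u e i s) = - c k * u e k s" if "s \<in> S" for s
      using c[OF that] insert.hyps by (simp add: eq_neg_iff_add_eq_0 add.commute)
    have "(\<Sum>i\<in>I. c i * w e i s) = 0" if "s \<in> S" for s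
      unfolding w_sum using eq[OF that] eq[OF t(1)] by simp
    then have c0: "c i = 0" if "i \<in> I" for i
      using indepD[OF \<open>indep (w e) I S\<close>] that by blast
    then have "c k * u e k t = 0"
      using eq[OF t(1)] by simp
    then show "c i = 0"
      using c0 i that(2) by auto
  qed
  then have "{e. \<not> indep (u e) (insert k I) S} \<subseteq> {e. \<not> indep (w e) I S} \<union> {e. u e k t = 0}"
    by blast
  ultimately show ?case
    by (meson finite_UnI finite_subset)
qed

text \<open>Only lower bounds on a rank survive perturbation, hence a predicate instead of a number;
  \<open>bounded_rank\<close> supplies the number once an upper bound is known.\<close>

definition rank_ge :: "('s \<Rightarrow> complex) set \<Rightarrow> 's set \<Rightarrow> nat \<Rightarrow> bool" where
  "rank_ge U S m \<longleftrightarrow> (\<exists>u :: nat \<Rightarrow> 's \<Rightarrow> complex. u ` {..<m} \<subseteq> U \<and> indep u {..<m} S)"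

lemma rank_geI:
  assumes "finite I" "m \<le> card I" "u ` I \<subseteq> U" "indep u I S"
  shows "rank_ge U S m"
proof -
  obtain J where J: "J \<subseteq> I" "card J = m" "finite J"
    using assms(1,2) by (meson obtain_subset_with_card_n)
  obtain h where h: "bij_betw h {..<m} J"
    using ex_bij_betw_nat_finite[OF J(3)] J(2) by (auto simp: lessThan_atLeast0)
  have "indep u (h ` {..<m}) S"
    using indep_subset[OF assms(4) J(1) assms(1)] h by (simp add: bij_betw_def)
  then have "indep (\<lambda>j. u (h j)) {..<m} S"
    using h indep_image[of u h "{..<m}" S] by (simp add: bij_betw_def)
  moreover have "(\<lambda>j. u (h j)) ` {..<m} \<subseteq> U"
  proof -
    have "(\<lambda>j. u (h j)) ` {..<m} = u ` J"
      using h by (simp add: bij_betw_def image_image[symmetric])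
    then show ?thesis
      using J(1) assms(3) by auto
  qed
  ultimately show ?thesis
    unfolding rank_ge_def by (intro exI[of _ "\<lambda>j. u (h j)"]) auto
qed

lemma rank_ge_mono:
  assumes "rank_ge U S m" "U \<subseteq> U'" "S \<subseteq> S'" "m' \<le> m"
  shows "rank_ge U' S' m'"
proof -
  obtain u :: "nat \<Rightarrow> 'a \<Rightarrow> complex" where u: "u ` {..<m} \<subseteq> U" "indep u {..<m} S"
    using assms(1) unfolding rank_ge_def by blast
  show ?thesis
    by (rule rank_geI[of "{..<m}" _ u]) (use u assms(2-4) indep_mono[OF u(2)] in auto)
qed

lemma rank_ge_0 [simp]: "rank_ge U S 0"
  by (simp add: rank_ge_def)

subsection \<open>Linear combinations of evaluations\<close>

text \<open>Functionals of finite support. They play the role of the dual space, are large enough to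
  separate a function from a finite span, and apply to every function, not only to members of a
  fixed space.\<close>

definition evals :: "(('s \<Rightarrow> complex) \<Rightarrow> complex) set" where
  "evals = cfun.span (range (\<lambda>q f. f q))"

lemma evals_subspace: "cfun.subspace evals"
  unfolding evals_def by (rule cfun.subspace_span)

lemma eval_in_evals: "(\<lambda>f. f q) \<in> evals"
  unfolding evals_def by (rule cfun.span_base) simp

lemma evals_induct [consumes 1, case_names zero add]:
  assumes "L \<in> evals" "P (\<lambda>f. 0)" "\<And>c q L. P L \<Longrightarrow> P (\<lambda>f. c * f q + L f)"
  shows "P L"
  using assms(1) unfolding evals_def
proof (induction rule: cfun.span_induct_alt)
  case base
  then show ?case
    using assms(2) by (simp add: zero_fun_def)
next
  case (step c x y)
  then show ?case
    using assms(3) by (auto simp: plus_fun_def)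
qed

lemma evals_sum:
  assumes "L \<in> evals"
  shows "L (\<lambda>s. \<Sum>i\<in>I. c i * u i s) = (\<Sum>i\<in>I. c i * L (u i))"
  using assms
proof (induction rule: evals_induct)
  case (add d q L)
  then show ?case
    by (simp add: sum.distrib sum_distrib_left algebra_simps)
qed simp

lemma evals_comb2:
  assumes "L \<in> evals"
  shows "L (\<lambda>s. a * u s + b * v s) = a * L u + b * L v"
  using assms
  by (induction rule: evals_induct) (simp_all add: algebra_simps)

lemma evals_scale:
  assumes "L \<in> evals"
  shows "L (\<lambda>s. a * u s) = a * L u"
  using evals_comb2[OF assms, of a u 0 u] by simp

lemma evals_zero_on_span:
  assumes "L \<in> evals" "\<And>t. t \<in> T \<Longrightarrow> L t = 0" "f \<in> cfun.span T"
  shows "L f = 0"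
  using assms(3)
proof (induction rule: cfun.span_induct_alt)
  case base
  then show ?case
    using evals_scale[OF assms(1), of 0 0] by (simp add: zero_fun_def)
next
  case (step c x y)
  then show ?case
    using evals_comb2[OF assms(1), of c x 1 y] assms(2) by (simp add: plus_fun_def)
qed

lemma evals_separate:
  assumes "finite T" "f \<notin> cfun.span T"
  shows "\<exists>L\<in>evals. (\<forall>t\<in>T. L t = 0) \<and> L f \<noteq> 0"
  using assms
proof (induction T arbitrary: f rule: finite_induct)
  case empty
  then have "f \<noteq> 0"
    by auto
  then obtain q where "f q \<noteq> 0"
    by (auto simp: fun_eq_iff)
  then show ?case
    using eval_in_evals[of q] by auto
next
  case (insert t T)
  show ?case
  proof (cases "t \<in> cfun.span T")
    case True
    have "f \<notin> cfun.span T"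
      using insert.prems cfun.span_mono[of T "insert t T"] by auto
    then obtain L where L: "L \<in> evals" "\<forall>t\<in>T. L t = 0" "L f \<noteq> 0"
      using insert.IH by blast
    then have "L t = 0"
      using evals_zero_on_span[of L T t] True by blast
    then show ?thesis
      using L by auto
  next
    case False
    then obtain M where M: "M \<in> evals" "\<forall>t\<in>T. M t = 0" "M t \<noteq> 0"
      using insert.IH by blast
    define g where "g = (\<lambda>s. 1 * f s + (- (M f / M t)) * t s)"
    have "g \<notin> cfun.span T"
    proof
      assume "g \<in> cfun.span T"
      then have "g \<in> cfun.span (insert t T)"
        using cfun.span_mono[of T "insert t T"] by auto
      moreover have "t \<in> cfun.span (insert t T)"
        by (simp add: cfun.span_base)
      ultimately have "(\<lambda>s. 1 * g s + (M f / M t) * t s) \<in> cfun.span (insert t T)"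
        by (rule subspace_comb2[OF cfun.subspace_span])
      moreover have "(\<lambda>s. 1 * g s + (M f / M t) * t s) = f"
        by (auto simp: g_def)
      ultimately show False
        using insert.prems by simp
    qed
    then obtain L where L: "L \<in> evals" "\<forall>t\<in>T. L t = 0" "L g \<noteq> 0"
      using insert.IH by blast
    \<comment> \<open>Correcting \<open>L\<close> by \<open>M\<close> makes it vanish at
      \<open>t\<close> as well, and \<open>N f = L g\<close> because \<open>g\<close> is
      \<open>f\<close> corrected in the same way.\<close>
    define N where "N = (\<lambda>h. 1 * L h + (- (L t / M t)) * M h)"
    have "N \<in> evals"
      unfolding N_def using evals_subspace L(1) M(1) by (rule subspace_comb2)
    moreover have "N f \<noteq> 0"
      using L(3) evals_comb2[OF L(1), of 1 f "- (M f / M t)" t] by (simp add: N_def g_def mult.commute)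
    ultimately show ?thesis
      using L M by (intro bexI[of _ N]) (auto simp: N_def)
  qed
qed

subsection \<open>Linear forms and polynomial functions on \<open>\<complex>\<^sup>n\<close>\<close>

text \<open>Bilinear, without conjugation, so that it is polynomial in both arguments; the Hermitian
  product is \<open>dot z (cnjv w)\<close>.\<close>

definition dot :: "complex ^ 'n \<Rightarrow> complex ^ 'n \<Rightarrow> complex" where
  "dot z y = (\<Sum>i\<in>UNIV. z $ i * y $ i)"

lemma dot_add_left: "dot (z + z') y = dot z y + dot z' y"
  and dot_diff_left: "dot (z - z') y = dot z y - dot z' y"
  and dot_scale_left: "dot (c *s z) y = c * dot z y"
  and dot_add_right: "dot z (y + y') = dot z y + dot z y'"
  and dot_scale_right: "dot z (c *s y) = c * dot z y"
  and dot_zero_left [simp]: "dot 0 y = 0"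
  by (simp_all add: dot_def sum.distrib sum_subtractf sum_distrib_left algebra_simps)

lemmas dot_simps = dot_add_left dot_diff_left dot_scale_left dot_add_right dot_scale_right

lemma dot_axis: "dot z (axis i 1) = z $ i"
proof -
  have "dot z (axis i 1) = (\<Sum>j\<in>UNIV. if j = i then z $ i else 0)"
    unfolding dot_def by (intro sum.cong) (auto simp: axis_def)
  then show ?thesis
    by simp
qed

lemma span_separate:
  fixes P :: "(complex ^ 'n) set"
  assumes "finite P" "e \<notin> vec.span P"
  obtains y where "\<And>p. p \<in> P \<Longrightarrow> dot p y = 0" "dot e y \<noteq> 0"
proof -
  have "($) e \<notin> cfun.span (($) ` P)"
  proof
    assume "($) e \<in> cfun.span (($) ` P)"
    then have "\<exists>z\<in>vec.span P. ($) e = ($) z"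
    proof (induction rule: cfun.span_induct_alt)
      case base
      show ?case
        by (rule bexI[of _ 0]) (auto simp: fun_eq_iff vec.span_zero)
    next
      case (step c x y)
      then obtain p z where "p \<in> P" "x = ($) p" "z \<in> vec.span P" "y = ($) z"
        by blast
      then show ?case
        by (intro bexI[of _ "c *s p + z"])
          (auto simp: fun_eq_iff vec.span_add vec.span_scale vec.span_base)
    qed
    then show False
      using assms(2) by (metis vec_eq_iff)
  qed
  then obtain L where L: "L \<in> evals" "\<forall>t\<in>($) ` P. L t = 0" "L (($) e) \<noteq> 0"
    using evals_separate[of "($) ` P"] assms(1) by blast
  have "\<exists>y. \<forall>z. L (($) z) = dot z y"
    using L(1)
  proof (induction rule: evals_induct)
    case zero
    show ?case
      by (rule exI[of _ 0]) (simp add: dot_def)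
  next
    case (add c q L)
    then obtain y where "\<forall>z. L (($) z) = dot z y"
      by blast
    then show ?case
      by (intro exI[of _ "c *s axis q 1 + y"]) (simp add: dot_simps dot_axis)
  qed
  then show ?thesis
    using L that by (metis imageI)
qed

inductive_set mpoly_fun :: "(complex ^ 'n \<Rightarrow> complex) set" where
  const: "(\<lambda>z. c) \<in> mpoly_fun"
| coord: "(\<lambda>z. z $ i) \<in> mpoly_fun"
| add: "f \<in> mpoly_fun \<Longrightarrow> g \<in> mpoly_fun \<Longrightarrow> (\<lambda>z. f z + g z) \<in> mpoly_fun"
| mult: "f \<in> mpoly_fun \<Longrightarrow> g \<in> mpoly_fun \<Longrightarrow> (\<lambda>z. f z * g z) \<in> mpoly_fun"

lemma mpoly_fun_sum: "(\<And>i. i \<in> I \<Longrightarrow> f i \<in> mpoly_fun) \<Longrightarrow> (\<lambda>z. \<Sum>i\<in>I. f i z) \<in> mpoly_fun"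
  by (induction I rule: infinite_finite_induct) (auto intro: mpoly_fun.intros)

lemma mpoly_fun_prod: "(\<And>i. i \<in> I \<Longrightarrow> f i \<in> mpoly_fun) \<Longrightarrow> (\<lambda>z. \<Prod>i\<in>I. f i z) \<in> mpoly_fun"
  by (induction I rule: infinite_finite_induct) (auto intro: mpoly_fun.intros)

lemma mpoly_fun_power: "f \<in> mpoly_fun \<Longrightarrow> (\<lambda>z. f z ^ k) \<in> mpoly_fun"
  by (induction k) (auto intro: mpoly_fun.intros)

lemma mpoly_fun_dot: "(\<lambda>z. dot z y) \<in> mpoly_fun"
  unfolding dot_def by (intro mpoly_fun_sum mpoly_fun.intros)

lemma mpoly_fun_subspace: "cfun.subspace mpoly_fun"
proof (rule cfun.subspaceI)
  show "0 \<in> mpoly_fun"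
    using mpoly_fun.const[of 0] by (simp add: zero_fun_def)
  show "f + g \<in> mpoly_fun" if "f \<in> mpoly_fun" "g \<in> mpoly_fun" for f g :: "complex ^ 'n \<Rightarrow> complex"
    using mpoly_fun.add[OF that] by (simp add: plus_fun_def)
  show "(\<lambda>i. c * f i) \<in> mpoly_fun" if "f \<in> mpoly_fun" for f :: "complex ^ 'n \<Rightarrow> complex" and c
    using that by (intro mpoly_fun.intros)
qed

lemma mpoly_fun_curve:
  assumes "f \<in> mpoly_fun" "\<And>i. poly_fun (\<lambda>e. \<gamma> e $ i)"
  shows "poly_fun (\<lambda>e. f (\<gamma> e))"
  using assms(1) by induction (auto intro: poly_fun_intros assms(2))

lemma mpoly_fun_line:
  assumes "f \<in> mpoly_fun"
  shows "poly_fun (\<lambda>e. f (a + e *s b))"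
  by (intro mpoly_fun_curve[OF assms]) (auto intro!: poly_fun_intros)

text \<open>If \<open>dot e y = 1\<close>, the shifted argument is the projection of
  \<open>z\<close> along \<open>e\<close> onto the hyperplane of \<open>y\<close>; a polynomial
  vanishing on that hyperplane is then divisible by its equation. The quotient is built along the
  inductive definition, with the product rule for differences.\<close>

lemma mpoly_fun_factor_diff:
  assumes "f \<in> mpoly_fun"
  obtains g where "g \<in> mpoly_fun" "\<And>z. f z - f (z - dot z y *s e) = dot z y * g z"
proof -
  have shift: "(\<lambda>z. h (z - dot z y *s e)) \<in> mpoly_fun" if "h \<in> mpoly_fun" for h
    using that
  proof induction
    case (coord i)
    have "(\<lambda>z. z $ i + (- (e $ i)) * dot z y) \<in> mpoly_fun"
      by (intro mpoly_fun.intros mpoly_fun_dot)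
    then show ?case
      by (simp add: algebra_simps)
  qed (auto intro: mpoly_fun.intros)
  have prod_diff: "a * b - a' * b' = l * (g * b + a' * h)"
    if "a - a' = l * g" "b - b' = l * h" for a a' b b' l g h :: complex
  proof -
    have "a * b - a' * b' = (a - a') * b + a' * (b - b')"
      by (simp add: algebra_simps)
    then show ?thesis
      unfolding that by (simp add: algebra_simps)
  qed
  have "\<exists>g\<in>mpoly_fun. \<forall>z. f z - f (z - dot z y *s e) = dot z y * g z"
    using assms
  proof induction
    case (const c)
    show ?case
      by (rule bexI[OF _ mpoly_fun.const[of 0]]) simp
  next
    case (coord i)
    show ?case
      by (rule bexI[OF _ mpoly_fun.const[of "e $ i"]]) simp
  next
    case (add f1 f2)
    then obtain g1 g2 where "g1 \<in> mpoly_fun" "g2 \<in> mpoly_fun"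
      and eq: "\<And>z. f1 z - f1 (z - dot z y *s e) = dot z y * g1 z"
        "\<And>z. f2 z - f2 (z - dot z y *s e) = dot z y * g2 z"
      by blast
    then have g: "(\<lambda>z. g1 z + g2 z) \<in> mpoly_fun"
      by (intro mpoly_fun.add)
    have "(f1 z + f2 z) - (f1 (z - dot z y *s e) + f2 (z - dot z y *s e)) =
        (f1 z - f1 (z - dot z y *s e)) + (f2 z - f2 (z - dot z y *s e))" for z
      by (rule add_diff_add)
    then have "(f1 z + f2 z) - (f1 (z - dot z y *s e) + f2 (z - dot z y *s e)) =
        dot z y * (g1 z + g2 z)" for z
      unfolding eq by (simp add: distrib_left)
    then show ?case
      by (intro bexI[OF _ g]) blast
  next
    case (mult f1 f2)
    then obtain g1 g2 where g: "g1 \<in> mpoly_fun" "g2 \<in> mpoly_fun"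
      and eq: "\<And>z. f1 z - f1 (z - dot z y *s e) = dot z y * g1 z"
        "\<And>z. f2 z - f2 (z - dot z y *s e) = dot z y * g2 z"
      by blast
    show ?case
    proof (intro bexI allI)
      show "(\<lambda>z. g1 z * f2 z + f1 (z - dot z y *s e) * g2 z) \<in> mpoly_fun"
        using g mult.hyps shift by (intro mpoly_fun.intros) auto
      show "f1 z * f2 z - f1 (z - dot z y *s e) * f2 (z - dot z y *s e) =
          dot z y * (g1 z * f2 z + f1 (z - dot z y *s e) * g2 z)" for z
        by (rule prod_diff[OF eq])
    qed
  qed
  then show ?thesis
    using that by blast
qed

lemma mpoly_fun_common_nonzero:
  assumes "vec.subspace E" "f \<in> mpoly_fun" "g \<in> mpoly_fun" "x \<in> E" "y \<in> E" "f x \<noteq> 0" "g y \<noteq> 0"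
  shows "\<exists>z\<in>E. f z \<noteq> 0 \<and> g z \<noteq> 0"
proof -
  have "finite {e. f (x + e *s (y - x)) = 0}"
    by (rule poly_fun_finite_zeros[OF mpoly_fun_line[OF assms(2), of x "y - x"], of 0])
      (use assms in simp)
  moreover have "finite {e. g (x + e *s (y - x)) = 0}"
    by (rule poly_fun_finite_zeros[OF mpoly_fun_line[OF assms(3), of x "y - x"], of 1])
      (use assms in simp)
  ultimately obtain e where "f (x + e *s (y - x)) \<noteq> 0 \<and> g (x + e *s (y - x)) \<noteq> 0"
    using cofinite_ex[OF cofinite_conj, of "\<lambda>e. f (x + e *s (y - x)) \<noteq> 0"
        "\<lambda>e. g (x + e *s (y - x)) \<noteq> 0"] by auto
  moreover have "x + e *s (y - x) \<in> E" for e
    using assms by (intro vec.subspace_add vec.subspace_scale vec.subspace_diff) auto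
  ultimately show ?thesis
    by blast
qed

definition hyp :: "(complex ^ 'n) set \<Rightarrow> complex ^ 'n \<Rightarrow> (complex ^ 'n) set" where
  "hyp E y = {z\<in>E. dot z y = 0}"

lemma hyp_subset: "hyp E y \<subseteq> E"
  by (auto simp: hyp_def)

lemma subspace_hyp: "vec.subspace E \<Longrightarrow> vec.subspace (hyp E y)"
  unfolding vec.subspace_def hyp_def by (auto simp: dot_simps)

lemma dim_hyp:
  fixes E :: "(complex ^ 'n) set"
  assumes "vec.subspace E" "e \<in> E" "dot e y \<noteq> 0"
  shows "vec.dim E = Suc (vec.dim (hyp E y))"
proof -
  have "vec.span (hyp E y) = hyp E y"
    using subspace_hyp[OF assms(1), of y] vec.span_eq_iff by blast
  then have "e \<notin> vec.span (hyp E y)"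
    using assms(3) hyp_def by (metis (mono_tags, lifting) mem_Collect_eq)
  moreover have "vec.span (insert e (hyp E y)) = E"
  proof
    show "vec.span (insert e (hyp E y)) \<subseteq> E"
      using assms hyp_subset[of E y] by (intro vec.span_minimal) auto
    show "E \<subseteq> vec.span (insert e (hyp E y))"
    proof
      fix z assume z: "z \<in> E"
      define c where "c = dot z y / dot e y"
      have "z - c *s e \<in> hyp E y"
        using z assms by (auto simp: hyp_def c_def dot_simps intro: vec.subspace_diff vec.subspace_scale)
      then have "(z - c *s e) + c *s e \<in> vec.span (insert e (hyp E y))"
        by (intro vec.span_add vec.span_scale vec.span_base) auto
      then show "z \<in> vec.span (insert e (hyp E y))"
        by simp
    qed
  qed
  ultimately show ?thesis
    using vec.dim_insert[of e "hyp E y"] vec.dim_span[of "insert e (hyp E y)"] by simp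
qed

text \<open>If every quotient vanished on the hyperplane again, all powers of the linear form would
  divide \<open>f\<close> on \<open>E\<close>. The degree of \<open>f\<close> along a line
  transversal to the hyperplane forbids this.\<close>

lemma mpoly_fun_order:
  fixes E :: "(complex ^ 'n) set"
  assumes E: "vec.subspace E" and e: "e \<in> E" "dot e y \<noteq> 0"
    and f: "f \<in> mpoly_fun" "x \<in> E" "f x \<noteq> 0"
  obtains a g where "g \<in> mpoly_fun" "\<And>z. z \<in> E \<Longrightarrow> f z = dot z y ^ a * g z"
    "\<exists>z\<in>hyp E y. g z \<noteq> 0"
proof (rule ccontr)
  assume no: "\<not> thesis"
  note found = that
  define d where "d = inverse (dot e y) *s e"
  have d: "d \<in> E" "dot d y = 1"
    using E e by (auto simp: d_def dot_simps vec.subspace_scale)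
  have div: "\<exists>g\<in>mpoly_fun. \<forall>z\<in>E. f z = dot z y ^ a * g z" for a
  proof (induction a)
    case 0
    show ?case
      using f(1) by auto
  next
    case (Suc a)
    then obtain g where g: "g \<in> mpoly_fun" "\<And>z. z \<in> E \<Longrightarrow> f z = dot z y ^ a * g z"
      by blast
    obtain h where h: "h \<in> mpoly_fun" "\<And>z. g z - g (z - dot z y *s d) = dot z y * h z"
      using mpoly_fun_factor_diff[OF g(1)] by blast
    have "g z = dot z y * h z" if "z \<in> E" for z
    proof -
      have "z - dot z y *s d \<in> hyp E y"
        using that d E by (auto simp: hyp_def dot_simps intro: vec.subspace_diff vec.subspace_scale)
      then have "g (z - dot z y *s d) = 0"
        using no found[OF g] by blast
      then show ?thesis
        using h(2)[of z] by simp
    qed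
    then show ?case
      using g h(1) by (intro bexI[of _ h]) auto
  qed
  obtain p where p: "\<And>t. f (x + t *s d) = poly p t"
    using mpoly_fun_line[OF f(1)] unfolding poly_fun_def by blast
  have "p \<noteq> 0"
    using p[of 0] f(3) by auto
  obtain g where g: "g \<in> mpoly_fun" "\<And>z. z \<in> E \<Longrightarrow> f z = dot z y ^ Suc (degree p) * g z"
    using div by blast
  obtain q where q: "\<And>t. g (x + t *s d) = poly q t"
    using mpoly_fun_line[OF g(1)] unfolding poly_fun_def by blast
  have "poly p t = poly ([:dot x y, 1:] ^ Suc (degree p) * q) t" for t
  proof -
    have "x + t *s d \<in> E"
      using f(2) d(1) E by (intro vec.subspace_add vec.subspace_scale)
    then show ?thesis
      using p[of t] q[of t] g(2)[of "x + t *s d"] d(2)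
      by (simp add: dot_simps algebra_simps)
  qed
  then have eq: "p = [:dot x y, 1:] ^ Suc (degree p) * q"
    by (intro poly_eq_poly_eq_iff[THEN iffD1] ext)
  then have "degree p = Suc (degree p) + degree q"
    using \<open>p \<noteq> 0\<close> by (metis degree_linear_power degree_mult_eq mult_eq_0_iff)
  then show False
    by simp
qed

subsection \<open>Moving hyperplanes\<close>

text \<open>Genericity is expressed along lines: a condition is generic when, starting from any point
  that satisfies it, only finitely many points of every line through it violate it.\<close>

definition line_cofinite :: "(complex ^ 'n) set \<Rightarrow> bool" where
  "line_cofinite G \<longleftrightarrow> (\<forall>x\<in>G. \<forall>v. finite {e. x + e *s v \<notin> G})"

text \<open>The line joining \<open>x\<close> and \<open>y\<close> meets each of the two sets in all
  but finitely many of its points. Read from \<open>y\<close>, the parameter \<open>e\<close>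
  becomes \<open>1 - e\<close>.\<close>

lemma line_cofinite_ex:
  assumes "line_cofinite G" "line_cofinite H" "x \<in> G" "y \<in> H"
  shows "\<exists>z. z \<in> G \<inter> H"
proof -
  have 1: "finite {e. x + e *s (y - x) \<notin> G}"
    using assms unfolding line_cofinite_def by blast
  have "finite {e. y + e *s (x - y) \<notin> H}"
    using assms unfolding line_cofinite_def by blast
  then have "finite ((\<lambda>e. 1 - e) ` {e. y + e *s (x - y) \<notin> H})"
    by (rule finite_imageI)
  moreover have "{e. x + e *s (y - x) \<notin> H} \<subseteq> (\<lambda>e. 1 - e) ` {e. y + e *s (x - y) \<notin> H}"
  proof
    fix e assume e: "e \<in> {e. x + e *s (y - x) \<notin> H}"
    have "y + (1 - e) *s (x - y) = x + e *s (y - x)"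
      by (simp add: vec_eq_iff algebra_simps)
    then show "e \<in> (\<lambda>e. 1 - e) ` {e. y + e *s (x - y) \<notin> H}"
      using e by (intro image_eqI[of _ _ "1 - e"]) auto
  qed
  ultimately have 2: "finite {e. x + e *s (y - x) \<notin> H}"
    by (rule rev_finite_subset)
  show ?thesis
    using cofinite_ex[OF cofinite_conj[OF 1 2]] by blast
qed

lemma line_cofinite_Int:
  assumes "line_cofinite G" "line_cofinite H"
  shows "line_cofinite (G \<inter> H)"
  unfolding line_cofinite_def
proof (intro ballI allI)
  fix x v assume "x \<in> G \<inter> H"
  then have "finite {e. x + e *s v \<notin> G}" "finite {e. x + e *s v \<notin> H}"
    using assms unfolding line_cofinite_def by blast+
  then show "finite {e. x + e *s v \<notin> G \<inter> H}"
    using cofinite_conj[of "\<lambda>e. x + e *s v \<in> G" "\<lambda>e. x + e *s v \<in> H"] by simp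
qed

text \<open>The projection along \<open>d\<close> onto the hyperplane of \<open>y\<close>,
  multiplied by \<open>dot d y\<close>. Clearing the denominator makes it polynomial in
  \<open>y\<close>.\<close>

definition tilt :: "complex ^ 'n \<Rightarrow> complex ^ 'n \<Rightarrow> complex ^ 'n \<Rightarrow> complex ^ 'n" where
  "tilt d y z = dot d y *s z - dot z y *s d"

lemma tilt_in_hyp: "vec.subspace E \<Longrightarrow> d \<in> E \<Longrightarrow> z \<in> E \<Longrightarrow> tilt d y z \<in> hyp E y"
  by (simp add: tilt_def hyp_def dot_simps vec.subspace_diff vec.subspace_scale)

lemma tilt_linear: "tilt d y (a *s z + b *s w) = a *s tilt d y z + b *s tilt d y w"
  by (simp add: tilt_def dot_simps vec_eq_iff algebra_simps)

lemma poly_fun_tilt: "poly_fun (\<lambda>e. tilt d (y + e *s v) z $ i)"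
proof -
  have "poly_fun (\<lambda>e. (dot d y + e * dot d v) * z $ i - (dot z y + e * dot z v) * d $ i)"
    by (intro poly_fun_intros poly_fun_const poly_fun_id)
  then show ?thesis
    by (simp add: tilt_def dot_simps distrib_right mult.assoc)
qed

lemma dot_line_cofinite: "dot d y \<noteq> 0 \<Longrightarrow> finite {e. dot d (y + e *s v) = 0}"
proof -
  assume "dot d y \<noteq> 0"
  moreover have "poly_fun (\<lambda>e. dot d y + e * dot d v)"
    by (intro poly_fun_intros poly_fun_const poly_fun_id)
  ultimately show ?thesis
    using poly_fun_finite_zeros[of "\<lambda>e. dot d y + e * dot d v" 0] by (simp add: dot_simps)
qed

text \<open>At parameter 0 the tilt merely rescales \<open>F\<close> by \<open>dot d y\<close>, so
  the independence on \<open>F\<close> is the starting point of a polynomial curve.\<close>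

lemma indep_tilt:
  assumes F: "vec.subspace F" "F \<subseteq> hyp E y" and d: "dot d y \<noteq> 0"
    and u: "finite I" "u ` I \<subseteq> mpoly_fun" "indep u I F"
  shows "finite {e. \<not> indep (\<lambda>i z. u i (tilt d (y + e *s v) z)) I F}"
proof (rule indep_poly_curve[OF u(1), where ?e0.0 = 0])
  show "poly_fun (\<lambda>e. u i (tilt d (y + e *s v) s))" if "i \<in> I" for i s
  proof -
    have "u i \<in> mpoly_fun"
      using u(2) that by auto
    then show ?thesis
      by (rule mpoly_fun_curve[OF _ poly_fun_tilt])
  qed
  have tilt0: "tilt d (y + 0 *s v) z = dot d y *s z" if "z \<in> F" for z
    using that F(2) by (auto simp: tilt_def hyp_def)
  show "indep (\<lambda>i z. u i (tilt d (y + 0 *s v) z)) I F"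
  proof (rule indepI)
    fix c i assume c: "\<And>s. s \<in> F \<Longrightarrow> (\<Sum>i\<in>I. c i * u i (tilt d (y + 0 *s v) s)) = 0"
      and i: "i \<in> I"
    have "(\<Sum>i\<in>I. c i * u i s) = 0" if "s \<in> F" for s
    proof -
      have "inverse (dot d y) *s s \<in> F"
        using that F(1) by (intro vec.subspace_scale)
      from c[OF this] tilt0[OF this] d show ?thesis
        by simp
    qed
    then show "c i = 0"
      using indepD[OF u(3)] i by blast
  qed
qed

lemma rank_ge_tilt:
  assumes F: "vec.subspace F" "F \<subseteq> hyp E y" and E: "vec.subspace E" and d: "d \<in> E" "dot d y \<noteq> 0"
    and U: "U \<subseteq> mpoly_fun" "rank_ge U F m"
  shows "finite {e. \<not> rank_ge U (tilt d (y + e *s v) ` F) m}"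
proof -
  obtain u :: "nat \<Rightarrow> _" where u: "u ` {..<m} \<subseteq> U" "indep u {..<m} F"
    using U(2) unfolding rank_ge_def by blast
  have "finite {e. \<not> indep (\<lambda>i z. u i (tilt d (y + e *s v) z)) {..<m} F}"
    by (rule indep_tilt[OF F d(2)]) (use u U in auto)
  then show ?thesis
  proof (rule cofinite_mono)
    fix e assume *: "indep (\<lambda>i z. u i (tilt d (y + e *s v) z)) {..<m} F"
    have "indep u {..<m} (tilt d (y + e *s v) ` F)"
    proof (rule indepI)
      fix c i assume "\<And>s. s \<in> tilt d (y + e *s v) ` F \<Longrightarrow> (\<Sum>i\<in>{..<m}. c i * u i s) = 0" "i \<in> {..<m}"
      then show "c i = 0"
        using indepD[OF *, of c i] by blast
    qed
    then show "rank_ge U (tilt d (y + e *s v) ` F) m"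
      using u(1) unfolding rank_ge_def by blast
  qed
qed

lemma rank_ge_hyp_line_cofinite:
  assumes "vec.subspace E" "U \<subseteq> mpoly_fun"
  shows "line_cofinite {y. (\<exists>d\<in>E. dot d y \<noteq> 0) \<and> rank_ge U (hyp E y) m}"
  unfolding line_cofinite_def
proof (intro ballI allI)
  fix y v assume "y \<in> {y. (\<exists>d\<in>E. dot d y \<noteq> 0) \<and> rank_ge U (hyp E y) m}"
  then obtain d where d: "d \<in> E" "dot d y \<noteq> 0" and r: "rank_ge U (hyp E y) m"
    by blast
  have "finite {e. \<not> (dot d (y + e *s v) \<noteq> 0 \<and> rank_ge U (tilt d (y + e *s v) ` hyp E y) m)}"
    using dot_line_cofinite[OF d(2)] rank_ge_tilt[OF subspace_hyp[OF assms(1)] subset_refl assms(1) d assms(2) r]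
    by (intro cofinite_conj) auto
  then show "finite {e. y + e *s v \<notin> {y. (\<exists>d\<in>E. dot d y \<noteq> 0) \<and> rank_ge U (hyp E y) m}}"
    unfolding mem_Collect_eq
  proof (rule cofinite_mono)
    fix e assume *: "dot d (y + e *s v) \<noteq> 0 \<and> rank_ge U (tilt d (y + e *s v) ` hyp E y) m"
    have "tilt d (y + e *s v) ` hyp E y \<subseteq> hyp E (y + e *s v)"
      using tilt_in_hyp[OF assms(1) d(1)] hyp_subset by blast
    then show "(\<exists>d\<in>E. dot d (y + e *s v) \<noteq> 0) \<and> rank_ge U (hyp E (y + e *s v)) m"
      using * d(1) rank_ge_mono[of U _ m U] by blast
  qed
qed

subsection \<open>Hermitian kernels\<close>

text \<open>If \<open>L\<close> has weights \<open>c q\<close> at the points \<open>q\<close>, this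
  is the sum of \<open>c q * cnj (c p) * K q p\<close>. The two conjugations turn a double
  application of the linear \<open>L\<close> into a sesquilinear form.\<close>

definition kform :: "('s \<Rightarrow> 's \<Rightarrow> complex) \<Rightarrow> (('s \<Rightarrow> complex) \<Rightarrow> complex) \<Rightarrow> complex" where
  "kform K L = L (\<lambda>z. cnj (L (\<lambda>w. cnj (K z w))))"

definition psd :: "('s \<Rightarrow> 's \<Rightarrow> complex) \<Rightarrow> bool" where
  "psd K \<longleftrightarrow> (\<forall>L\<in>evals. 0 \<le> Re (kform K L))"

lemma evals_finite_sum:
  assumes "L \<in> evals"
  shows "\<exists>I c. finite I \<and> L = (\<lambda>f. \<Sum>q\<in>I. c q * f q)"
  using assms
proof (induction rule: evals_induct)
  case zero
  show ?case
    by (intro exI[of _ "{}"]) simp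
next
  case (add a p L)
  then obtain I c where I: "finite I" "L = (\<lambda>f. \<Sum>q\<in>I. c q * f q)"
    by blast
  define d where "d = (\<lambda>q. (if q = p then a else 0) + (if q \<in> I then c q else 0))"
  have "a * f p + L f = (\<Sum>q\<in>insert p I. d q * f q)" for f
  proof -
    have "(\<Sum>q\<in>insert p I. (if q = p then a else 0) * f q) = a * f p"
      using I(1) by (simp add: if_distrib[of "\<lambda>x. x * _"] sum.delta cong: if_cong)
    moreover have "(\<Sum>q\<in>insert p I. (if q \<in> I then c q else 0) * f q) = (\<Sum>q\<in>I. c q * f q)"
      using I(1) by (intro sum.mono_neutral_cong_right) auto
    ultimately show ?thesis
      by (simp add: I(2) d_def distrib_right sum.distrib)
  qed
  then show ?case
    using I(1) by (intro exI[of _ "insert p I"] exI[of _ d]) auto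
qed

lemma sum_in_evals: "(\<lambda>f. \<Sum>q\<in>I. c q * f (p q)) \<in> evals"
  by (rule subspace_lincomb[OF evals_subspace eval_in_evals])

lemma kform_sum:
  "kform K (\<lambda>f. \<Sum>q\<in>I. c q * f q) = (\<Sum>q\<in>I. \<Sum>p\<in>I. c q * cnj (c p) * K q p)"
  by (simp add: kform_def sum_distrib_left mult.assoc)

text \<open>Elimination with pivot \<open>t0\<close>: the kernel of \<open>L\<close> needs one
  generator fewer. This is how the dimension falls both for Schur complements and for the kernel of
  a functional with negative form.\<close>

lemma span_kernel_of_functional:
  assumes "L \<in> evals" "finite T" "t0 \<in> T" "L t0 \<noteq> 0" "x \<in> cfun.span T" "L x = 0"
  shows "x \<in> cfun.span ((\<lambda>t s. t s - L t / L t0 * t0 s) ` (T - {t0}))"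
proof -
  let ?S = "cfun.span ((\<lambda>t s. t s - L t / L t0 * t0 s) ` (T - {t0}))"
  have "(\<lambda>s. x s - L x / L t0 * t0 s) \<in> ?S"
    using assms(5)
  proof (induction rule: cfun.span_induct_alt)
    case base
    have "L 0 = 0"
      using evals_scale[OF assms(1), of 0 0] by (simp add: zero_fun_def)
    then show ?case
      using cfun.span_zero by (simp add: zero_fun_def)
  next
    case (step c t y)
    define t' where "t' = (\<lambda>s. t s - L t / L t0 * t0 s)"
    have "t' \<in> ?S"
    proof (cases "t = t0")
      case True
      then have "t' = 0"
        using assms(4) by (auto simp: t'_def)
      then show ?thesis
        by (simp add: cfun.span_zero)
    next
      case False
      then show ?thesis
        unfolding t'_def using step.hyps by (intro cfun.span_base image_eqI[of _ _ t]) auto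
    qed
    then have "(\<lambda>s. c * t' s + 1 * (y s - L y / L t0 * t0 s)) \<in> ?S"
      using step.IH by (intro subspace_comb2[OF cfun.subspace_span]) auto
    moreover have Ls: "L ((\<lambda>i. c * t i) + y) = c * L t + L y"
      using evals_comb2[OF assms(1), of c t 1 y] by (simp add: plus_fun_def)
    have "(\<lambda>s. ((\<lambda>i. c * t i) + y) s - L ((\<lambda>i. c * t i) + y) / L t0 * t0 s) =
        (\<lambda>s. c * t' s + 1 * (y s - L y / L t0 * t0 s))"
      unfolding Ls by (rule ext) (simp add: t'_def algebra_simps add_divide_distrib)
    ultimately show ?case
      by (simp only:)
  qed
  then show ?thesis
    using assms(6) by simp
qed

locale herm_kernel =
  fixes A :: "complex ^ 'n \<Rightarrow> complex ^ 'n \<Rightarrow> complex"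
  assumes herm: "A w z = cnj (A z w)"
    and poly_left: "(\<lambda>z. A z w) \<in> mpoly_fun"
begin

abbreviation col :: "complex ^ 'n \<Rightarrow> complex ^ 'n \<Rightarrow> complex" where
  "col w \<equiv> (\<lambda>z. A z w)"

lemma kform_alt: "kform A L = L (\<lambda>z. cnj (L (col z)))"
  by (simp add: kform_def herm[symmetric])

lemma cnj_row: "cnj (A q z) = A z q"
  by (simp add: herm[symmetric])

text \<open>Hermitian symmetry allows one argument to be replaced at a time. The form thus depends
  only on the combined row, which makes it legitimate to replace a combination by a shorter
  one.\<close>

lemma kform_eq_of_combination_eq:
  assumes "\<And>w. (\<Sum>q\<in>I. c q * A q w) = (\<Sum>q\<in>K. d q * A q w)"
  shows "(\<Sum>q\<in>I. \<Sum>p\<in>I. c q * cnj (c p) * A q p) = (\<Sum>q\<in>K. \<Sum>p\<in>K. d q * cnj (d p) * A q p)"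
proof -
  have "(\<Sum>q\<in>I. \<Sum>p\<in>I. c q * cnj (c p) * A q p) = (\<Sum>p\<in>I. cnj (c p) * (\<Sum>q\<in>I. c q * A q p))"
    by (subst sum.swap) (simp add: sum_distrib_left mult_ac)
  also have "\<dots> = (\<Sum>p\<in>I. cnj (c p) * (\<Sum>q\<in>K. d q * A q p))"
    by (simp add: assms)
  also have "\<dots> = (\<Sum>q\<in>K. d q * (\<Sum>p\<in>I. cnj (c p) * A q p))"
    by (simp add: sum_distrib_left mult_ac) (rule sum.swap)
  also have "\<dots> = (\<Sum>q\<in>K. d q * cnj (\<Sum>p\<in>I. c p * A p q))"
    by (simp add: cnj_row)
  also have "\<dots> = (\<Sum>q\<in>K. d q * cnj (\<Sum>p\<in>K. d p * A p q))"
    by (simp add: assms)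
  also have "\<dots> = (\<Sum>q\<in>K. \<Sum>p\<in>K. d q * cnj (d p) * A q p)"
    by (simp add: cnj_row sum_distrib_left mult_ac)
  finally show ?thesis .
qed

lemma poly_fun_evals_row:
  assumes "L \<in> evals"
  shows "poly_fun (\<lambda>t. L (A (a + t *s b)))"
  using assms
proof (induction rule: evals_induct)
  case (add c q L)
  have "poly_fun (\<lambda>t. A (a + t *s b) q)"
    by (rule mpoly_fun_line[OF poly_left])
  then show ?case
    using add by (intro poly_fun_intros) auto
qed simp

end

section \<open>Values of rational functions of one variable\<close>

lemma poly_common_factor:
  fixes P Q :: "complex poly"
  assumes "P \<noteq> 0"
  obtains G P' Q' where "P = G * P'" "Q = G * Q'" "\<And>t. \<not> (poly P' t = 0 \<and> poly Q' t = 0)"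
  using assms
proof (induction "degree P" arbitrary: P Q thesis rule: less_induct)
  case less
  show ?case
  proof (cases "\<exists>t. poly P t = 0 \<and> poly Q t = 0")
    case False
    then show ?thesis
      using less.prems(1)[of P 1 Q] less.prems(1)[of 1 P Q] by auto
  next
    case True
    then obtain t P1 Q1 where 1: "P = [:- t, 1:] * P1" "Q = [:- t, 1:] * Q1"
      by (auto simp: poly_eq_0_iff_dvd elim!: dvdE)
    then have "P1 \<noteq> 0"
      using less.prems(2) by auto
    moreover from this have "degree P1 < degree P"
      unfolding 1(1) by (subst degree_mult_eq) auto
    ultimately obtain G P' Q' where G: "P1 = G * P'" "Q1 = G * Q'"
      and nc: "\<And>t. \<not> (poly P' t = 0 \<and> poly Q' t = 0)"
      using less.hyps by metis
    show ?thesis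
      by (rule less.prems(1)[of "[:- t, 1:] * G" P' Q']) (simp_all only: 1 G mult.assoc nc not_False_eq_True)
  qed
qed

text \<open>A nonconstant rational function \<open>Q / P\<close> omits only finitely many values. In
  lowest terms, \<open>Q' - c P'\<close> has a root unless it is constant; the values in
  \<open>C2\<close> are those that could be attained only at a cancelled zero.\<close>

lemma poly_ratio_cofinite:
  fixes P Q :: "complex poly"
  assumes "poly P 0 \<noteq> 0" "poly Q 0 = 0" "poly Q 1 \<noteq> 0"
  shows "finite {c. \<not> (\<exists>t. poly Q t = c * poly P t \<and> poly P t \<noteq> 0)}"
proof -
  have "P \<noteq> 0"
    using assms(1) by auto
  then obtain G P' Q' where P': "P = G * P'" and Q': "Q = G * Q'"
    and nocommon: "\<And>t. \<not> (poly P' t = 0 \<and> poly Q' t = 0)"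
    using poly_common_factor[of P Q] by blast
  have "G \<noteq> 0"
    using \<open>P \<noteq> 0\<close> P' by auto
  have Q'0: "poly Q' 0 = 0" and Q'1: "poly Q' 1 \<noteq> 0"
    using assms by (auto simp: P' Q')
  have deg: "degree Q' \<noteq> 0"
  proof
    assume "degree Q' = 0"
    then obtain a where "Q' = [:a:]"
      by (rule degree_eq_zeroE)
    then show False
      using Q'0 Q'1 by simp
  qed
  define C1 where "C1 = {c. degree (Q' - smult c P') = 0}"
  \<comment> \<open>Two exceptional values would force \<open>P'\<close>, and with it
    \<open>Q'\<close>, to be constant.\<close>
  have "a = b" if "a \<in> C1" "b \<in> C1" for a b
  proof (rule ccontr)
    assume "a \<noteq> b"
    have deg0: "degree (Q' - smult b P') \<le> 0" "degree (Q' - smult a P') \<le> 0"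
      using that by (simp_all add: C1_def)
    then have "degree ((Q' - smult b P') - (Q' - smult a P')) \<le> 0"
      by (rule degree_diff_le)
    also have "(Q' - smult b P') - (Q' - smult a P') = smult (a - b) P'"
      by (simp add: smult_diff_left)
    finally have "degree P' = 0"
      using \<open>a \<noteq> b\<close> by simp
    then have "degree (smult a P') \<le> 0"
      by simp
    with deg0(2) have "degree ((Q' - smult a P') + smult a P') \<le> 0"
      by (rule degree_add_le)
    then show False
      using deg by simp
  qed
  then have "finite C1"
    by (metis finite.emptyI finite_insert finite_subset insertI1 subsetI empty_iff equals0I)
  define C2 where "C2 = (\<lambda>t. poly Q' t / poly P' t) ` {t. poly G t = 0}"
  have "finite C2"
    unfolding C2_def using poly_roots_finite[OF \<open>G \<noteq> 0\<close>] by simp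
  have "\<exists>t. poly Q t = c * poly P t \<and> poly P t \<noteq> 0" if "c \<notin> C1" "c \<notin> C2" for c
  proof -
    have "degree (Q' - smult c P') \<noteq> 0"
      using that by (simp add: C1_def)
    then have "\<not> constant (poly (Q' - smult c P'))"
      by (simp add: constant_degree)
    then obtain t where t: "poly (Q' - smult c P') t = 0"
      using fundamental_theorem_of_algebra by blast
    then have eq: "poly Q' t = c * poly P' t"
      by simp
    then have "poly P' t \<noteq> 0"
      using nocommon[of t] by auto
    moreover have "poly G t \<noteq> 0"
      using that(2) eq \<open>poly P' t \<noteq> 0\<close> by (auto simp: C2_def image_iff)
    ultimately show ?thesis
      using eq by (intro exI[of _ t]) (simp add: P' Q')
  qed
  then have "{c. \<not> (\<exists>t. poly Q t = c * poly P t \<and> poly P t \<noteq> 0)} \<subseteq> C1 \<union> C2"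
    by blast
  then show ?thesis
    using \<open>finite C1\<close> \<open>finite C2\<close> by (meson finite_UnI finite_subset)
qed

context herm_kernel
begin

text \<open>If the rows of a plane span at most two dimensions, almost every combination of two rows is a
  multiple of a third row.\<close>

lemma row_combination_is_row:
  assumes indep: "indep (case_bool (A z) (A w)) UNIV UNIV"
    and dep: "\<And>a b. \<exists>c d. \<forall>x. A (a *s z + b *s w) x = c * A z x + d * A w x"
  shows "finite {c. \<not> (\<exists>v m. \<forall>x. A z x + c * A w x = m * A v x)}"
proof -
  have "A z \<notin> cfun.span {A w}"
  proof
    assume "A z \<in> cfun.span {A w}"
    then obtain k where "A z = (\<lambda>i. k * A w i)"
      by (auto simp: cfun.span_singleton)
    then show False
      using indepD[OF indep, of "\<lambda>b. if b then 1 else - k" True] by (simp add: UNIV_bool)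
  qed
  then obtain L where L: "L \<in> evals" "L (A w) = 0" "L (A z) \<noteq> 0"
    using evals_separate[of "{A w}" "A z"] by auto
  have "A w \<notin> cfun.span {A z}"
  proof
    assume "A w \<in> cfun.span {A z}"
    then obtain k where "A w = (\<lambda>i. k * A z i)"
      by (auto simp: cfun.span_singleton)
    then show False
      using indepD[OF indep, of "\<lambda>b. if b then - k else 1" False] by (simp add: UNIV_bool)
  qed
  then obtain M where M: "M \<in> evals" "M (A z) = 0" "M (A w) \<noteq> 0"
    using evals_separate[of "{A z}" "A w"] by auto
  \<comment> \<open>Along this line the row is a combination of \<open>A z\<close> and
    \<open>A w\<close>. As \<open>L\<close> kills \<open>A w\<close> and \<open>M\<close> kills
    \<open>A z\<close>, they read off the two coefficients, which are therefore polynomials in the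
    parameter.\<close>
  define \<gamma> where "\<gamma> = (\<lambda>t. z + t *s (w - z))"
  obtain P0 where P0: "\<And>t. L (A (\<gamma> t)) = poly P0 t"
    using poly_fun_evals_row[OF L(1), of z "w - z"] unfolding poly_fun_def \<gamma>_def by blast
  obtain Q0 where Q0: "\<And>t. M (A (\<gamma> t)) = poly Q0 t"
    using poly_fun_evals_row[OF M(1), of z "w - z"] unfolding poly_fun_def \<gamma>_def by blast
  define P where "P = smult (1 / L (A z)) P0"
  define Q where "Q = smult (1 / M (A w)) Q0"
  have row: "A (\<gamma> t) x = poly P t * A z x + poly Q t * A w x" for t x
  proof -
    have "\<gamma> t = (1 - t) *s z + t *s w"
      by (simp add: \<gamma>_def vec_eq_iff algebra_simps)
    then obtain c d where cd: "\<And>x. A (\<gamma> t) x = c * A z x + d * A w x"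
      using dep by metis
    then have eq: "A (\<gamma> t) = (\<lambda>x. c * A z x + d * A w x)"
      by blast
    have "L (A (\<gamma> t)) = c * L (A z)" "M (A (\<gamma> t)) = d * M (A w)"
      unfolding eq evals_comb2[OF L(1)] evals_comb2[OF M(1)] using L(2) M(2) by simp_all
    then have "poly P t = c" "poly Q t = d"
      using L(3) M(3) by (simp_all add: P_def Q_def P0[symmetric] Q0[symmetric])
    then show ?thesis
      using cd by simp
  qed
  have "\<gamma> 0 = z" "\<gamma> 1 = w"
    by (simp_all add: \<gamma>_def)
  then have ends: "poly P 0 = 1" "poly Q 0 = 0" "poly Q 1 = 1"
    using L M P0[of 0] Q0[of 0] Q0[of 1] by (simp_all add: P_def Q_def)
  have "finite {c. \<not> (\<exists>t. poly Q t = c * poly P t \<and> poly P t \<noteq> 0)}"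
    by (rule poly_ratio_cofinite) (use ends in simp_all)
  then show ?thesis
  proof (rule cofinite_mono)
    fix c assume "\<exists>t. poly Q t = c * poly P t \<and> poly P t \<noteq> 0"
    then obtain t where t: "poly Q t = c * poly P t" "poly P t \<noteq> 0"
      by blast
    then have "A z x + c * A w x = inverse (poly P t) * A (\<gamma> t) x" for x
      by (simp add: row field_simps)
    then show "\<exists>v m. \<forall>x. A z x + c * A w x = m * A v x"
      by blast
  qed
qed

text \<open>The cone over the rows is then dense in their span, on which the form is therefore
  nonnegative. A combination of rows with negative form and the least number of points could be
  shortened by merging two of its rows.\<close>

lemma psd_if_rank_two_on_planes:
  assumes pos: "\<And>z. 0 \<le> Re (A z z)"
    and dep: "\<And>z w a b. indep (case_bool (A z) (A w)) UNIV UNIV \<Longrightarrow>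
      \<exists>c d. \<forall>x. A (a *s z + b *s w) x = c * A z x + d * A w x"
  shows "psd A"
proof -
  define h where "h = (\<lambda>(I, c). \<Sum>q\<in>I. \<Sum>p\<in>I. c q * cnj (c p) * A q p)"
  have "0 \<le> Re (h (I, c))" if "finite I" for I c
    using that
  proof (induction "card I" arbitrary: I c rule: less_induct)
    case less
    have shorter: "0 \<le> Re (h (I, c))"
      if "\<And>x. (\<Sum>q\<in>I. c q * A q x) = (\<Sum>q\<in>K. d q * A q x)" "finite K" "card K < card I" for c K d
      using less.hyps[OF that(3,2), of d] kform_eq_of_combination_eq[OF that(1)] by (simp add: h_def)
    have merge: "0 \<le> Re (h (I, c))"
      if zw: "z \<in> I" "w \<in> I" "z \<noteq> w" and m: "\<And>x. c z * A z x + c w * A w x = m * A v x" for c z w v m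
    proof (rule shorter)
      define K where "K = insert v (I - {z, w})"
      define d where "d = (\<lambda>q. (if q = v then m else 0) + (if q \<in> I - {z, w} then c q else 0))"
      show "finite K"
        using less.prems by (simp add: K_def)
      have "card (I - {z, w}) = card I - 2"
        using zw less.prems by (simp add: card_Diff_subset)
      moreover have "card {z, w} \<le> card I"
        using zw less.prems by (intro card_mono) auto
      moreover have "card K \<le> Suc (card (I - {z, w}))"
        unfolding K_def by (rule card_insert_le_m1) simp_all
      ultimately show "card K < card I"
        using zw(3) by simp
      fix x
      have "(\<Sum>q\<in>K. (if q = v then m else 0) * A q x) = m * A v x"
        using less.prems by (simp add: K_def if_distrib[of "\<lambda>x. x * _"] sum.delta cong: if_cong)
      moreover have "(\<Sum>q\<in>K. (if q \<in> I - {z, w} then c q else 0) * A q x) = (\<Sum>q\<in>I - {z, w}. c q * A q x)"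
        using less.prems by (intro sum.mono_neutral_cong_right) (auto simp: K_def)
      ultimately have "(\<Sum>q\<in>K. d q * A q x) = m * A v x + (\<Sum>q\<in>I - {z, w}. c q * A q x)"
        by (simp add: d_def distrib_right sum.distrib)
      also have "\<dots> = (\<Sum>q\<in>I. c q * A q x)"
        using zw less.prems by (simp add: m[symmetric] sum.remove[of I z] sum.remove[of "I - {z}" w]
            Diff_insert2[symmetric] insert_commute)
      finally show "(\<Sum>q\<in>I. c q * A q x) = (\<Sum>q\<in>K. d q * A q x)"
        by simp
    qed
    show ?case
    proof (rule ccontr)
      assume neg: "\<not> 0 \<le> Re (h (I, c))"
      have nz: "c q \<noteq> 0" if "q \<in> I" for q
      proof
        assume "c q = 0"
        then have "(\<Sum>p\<in>I. c p * A p x) = (\<Sum>p\<in>I - {q}. c p * A p x)" for x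
          using that less.prems by (simp add: sum.remove[of I q])
        then show False
          using shorter[of c c "I - {q}", OF _ _ card_Diff1_less[OF less.prems that]] neg less.prems
          by simp
      qed
      have "card I \<noteq> 0"
        using neg less.prems by (auto simp: h_def)
      then obtain z where z: "z \<in> I"
        by fastforce
      have "I \<noteq> {z}"
      proof
        assume "I = {z}"
        then have "h (I, c) = of_real ((cmod (c z))\<^sup>2) * A z z"
          by (simp add: h_def complex_norm_square del: of_real_power)
        then have "Re (h (I, c)) = (cmod (c z))\<^sup>2 * Re (A z z)"
          by simp
        then show False
          using neg pos[of z] by simp
      qed
      then obtain w where w: "w \<in> I" "w \<noteq> z"
        using z by blast
      show False
      proof (cases "indep (case_bool (A z) (A w)) UNIV UNIV")
        case False
        then obtain k i where k': "\<And>x. (\<Sum>b\<in>UNIV. k b * case_bool (A z) (A w) b x) = 0"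
          and i: "k i \<noteq> 0"
          unfolding indep_def by blast
        have k: "k True * A z x + k False * A w x = 0" for x
          using k'[of x] by (simp add: UNIV_bool add.commute)
        show False
        proof (cases "k True = 0")
          case True
          then have "k False \<noteq> 0"
            using i by (cases i) auto
          then have "A w x = 0" for x
            using k[of x] True by simp
          then show False
            using merge[OF z w(1) w(2)[symmetric], of c "c z" z] neg by simp
        next
          case False
          then have "A z x = - (k False / k True) * A w x" for x
            using k[of x] by (simp add: field_simps eq_neg_iff_add_eq_0)
          then show False
            using merge[OF z w(1) w(2)[symmetric], of c "c w - c z * (k False / k True)" w] neg
            by (simp add: algebra_simps)
        qed
      next
        case True
        let ?good = "\<lambda>x. \<exists>v m. \<forall>y. A z y + x * A w y = m * A v y"
        have fin: "finite {x. \<not> ?good x}"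
          using row_combination_is_row[OF True dep[OF True]] .
        \<comment> \<open>With weight \<open>c z * x\<close> at \<open>w\<close>, the two terms add
          up to \<open>c z\<close> times \<open>A z + x * A w\<close>. The form is negative at
          \<open>x = c w / c z\<close>, hence on an open set of \<open>x\<close>, which must contain
          a value where the sum is a multiple of a single row.\<close>
        define \<phi> where "\<phi> = (\<lambda>x. Re (h (I, c(w := c z * x))))"
        have cont: "continuous_on UNIV \<phi>"
        proof -
          have "continuous_on UNIV (\<lambda>x. (c(w := c z * x)) q)" for q
            by (cases "q = w") (auto intro!: continuous_intros)
          then show ?thesis
            unfolding \<phi>_def h_def split_conv by (intro continuous_intros)
        qed
        have "open {x. \<phi> x < 0}"
          using open_Collect_less[OF cont continuous_on_const[of UNIV 0]] .
        moreover have "c w / c z \<in> {x. \<phi> x < 0}"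
        proof -
          have "c(w := c z * (c w / c z)) = c"
            using nz[OF z] by auto
          then show ?thesis
            using neg by (simp add: \<phi>_def)
        qed
        ultimately have "infinite {x. \<phi> x < 0}"
          using finite_imp_not_open by blast
        then obtain x where x: "\<phi> x < 0" "?good x"
          using fin finite_subset[of "{x. \<phi> x < 0}" "{x. \<not> ?good x}"] by blast
        then obtain v m where vm: "\<And>y. A z y + x * A w y = m * A v y"
          by blast
        have "0 \<le> Re (h (I, c(w := c z * x)))"
        proof (rule merge[OF z w(1) w(2)[symmetric]])
          show "(c(w := c z * x)) z * A z y + (c(w := c z * x)) w * A w y = (c z * m) * A v y" for y
            using w(2) vm[of y] by (simp add: algebra_simps) (metis distrib_left mult.assoc mult.left_commute)
        qed
        then show False
          using x(1) by (simp add: \<phi>_def)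
      qed
    qed
  qed
  then have "0 \<le> Re (kform A L)" if "L \<in> evals" for L
    using evals_finite_sum[OF that] by (auto simp: kform_sum h_def)
  then show ?thesis
    by (simp add: psd_def)
qed

end

section \<open>Gram decompositions of positive semidefinite kernels\<close>

lemma kform_gram:
  assumes "L \<in> evals"
  shows "kform (\<lambda>z w. \<Sum>\<mu>\<in>I. F \<mu> z * cnj (F \<mu> w)) L = of_real (\<Sum>\<mu>\<in>I. (cmod (L (F \<mu>)))\<^sup>2)"
proof -
  have "cnj (L (\<lambda>w. cnj (\<Sum>\<mu>\<in>I. F \<mu> z * cnj (F \<mu> w)))) = (\<Sum>\<mu>\<in>I. cnj (L (F \<mu>)) * F \<mu> z)" for z
  proof -
    have "L (\<lambda>w. cnj (\<Sum>\<mu>\<in>I. F \<mu> z * cnj (F \<mu> w))) = L (\<lambda>w. \<Sum>\<mu>\<in>I. cnj (F \<mu> z) * F \<mu> w)"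
      by simp
    then show ?thesis
      unfolding evals_sum[OF assms] by (simp add: mult.commute)
  qed
  then have "kform (\<lambda>z w. \<Sum>\<mu>\<in>I. F \<mu> z * cnj (F \<mu> w)) L = L (\<lambda>z. \<Sum>\<mu>\<in>I. cnj (L (F \<mu>)) * F \<mu> z)"
    unfolding kform_def by simp
  also have "\<dots> = (\<Sum>\<mu>\<in>I. cnj (L (F \<mu>)) * L (F \<mu>))"
    by (rule evals_sum[OF assms])
  also have "\<dots> = of_real (\<Sum>\<mu>\<in>I. (cmod (L (F \<mu>)))\<^sup>2)"
    by (simp add: complex_norm_square mult.commute del: of_real_power)
  finally show ?thesis .
qed

lemma evals_mult:
  assumes "L \<in> evals"
  shows "(\<lambda>f. L (\<lambda>z. g z * f z)) \<in> evals"
  using assms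
proof (induction rule: evals_induct)
  case zero
  show ?case
    using cfun.subspace_0[OF evals_subspace] by (simp add: zero_fun_def)
next
  case (add c q L)
  then have "(\<lambda>f. (c * g q) * f q + 1 * L (\<lambda>z. g z * f z)) \<in> evals"
    by (intro subspace_comb2[OF evals_subspace] eval_in_evals)
  then show ?case
    by (simp add: mult.assoc)
qed

lemma psd_diagonal:
  assumes herm: "\<And>z w. A w z = cnj (A z w)" and "psd A"
  shows "0 \<le> Re (A z z)" "Im (A z z) = 0"
proof -
  have "kform A (\<lambda>f. f z) = A z z"
    by (simp add: kform_def)
  then show "0 \<le> Re (A z z)"
    using \<open>psd A\<close> eval_in_evals[of z] unfolding psd_def by metis
  show "Im (A z z) = 0"
    using herm[of z z] by (metis Reals_cnj_iff complex_is_Real_iff)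
qed

lemma psd_zero_diagonal:
  assumes herm: "\<And>z w. A w z = cnj (A z w)" and "psd A" and diag: "\<And>z. A z z = 0"
  shows "A z w = 0"
proof -
  \<comment> \<open>With zero diagonal only the cross terms remain, and this weight makes them equal
    to minus twice the squared modulus of \<open>A z w\<close>.\<close>
  define c where "c = - A z w"
  have "(\<lambda>f. 1 * f z + c * f w) \<in> evals"
    by (intro subspace_comb2[OF evals_subspace] eval_in_evals)
  then have "0 \<le> Re (kform A (\<lambda>f. 1 * f z + c * f w))"
    using \<open>psd A\<close> unfolding psd_def by blast
  also have "kform A (\<lambda>f. 1 * f z + c * f w) = cnj c * A z w + c * cnj (A z w)"
    by (simp add: kform_def diag herm[of z w])
  also have "\<dots> = - of_real (2 * (cmod (A z w))\<^sup>2)"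
    by (simp add: c_def complex_norm_square mult.commute del: of_real_power)
  finally show ?thesis
    by simp
qed

lemma psd_schur_complement:
  assumes herm: "\<And>z w. A w z = cnj (A z w)" and psd: "psd A" and a: "A p p \<noteq> 0"
  shows "psd (\<lambda>z w. A z w - A z p * A p w / A p p)"
  unfolding psd_def
proof
  fix L :: "('a \<Rightarrow> complex) \<Rightarrow> complex"
  assume L: "L \<in> evals"
  define a where "a = A p p"
  define l where "l = L (\<lambda>z. A z p)"
  have cnj_a: "cnj a = a"
    using herm[of p p] by (simp add: a_def)
  have row: "cnj (A z w) = A w z" for z w
    by (simp add: herm[of z w])
  \<comment> \<open>Completes the square: for this weight the form of \<open>A\<close> at
    \<open>L\<close> plus \<open>c\<close> times evaluation at \<open>p\<close> is the form of the
    Schur complement at \<open>L\<close>.\<close>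
  define c where "c = - l / a"
  have "(\<lambda>f. 1 * L f + c * f p) \<in> evals"
    by (intro subspace_comb2[OF evals_subspace] eval_in_evals L)
  then have "0 \<le> Re (kform A (\<lambda>f. 1 * L f + c * f p))"
    using psd unfolding psd_def by blast
  also have "kform A (\<lambda>f. 1 * L f + c * f p) = kform A L + cnj c * l + c * (cnj l + cnj c * a)"
  proof -
    have "L (\<lambda>z. cnj (L (\<lambda>w. A w z)) + cnj c * A z p) = kform A L + cnj c * l"
      using evals_comb2[OF L, of 1 "\<lambda>z. cnj (L (\<lambda>w. A w z))" "cnj c" "\<lambda>z. A z p"]
      by (simp add: kform_def row l_def)
    then show ?thesis
      by (simp add: kform_def row l_def a_def algebra_simps)
  qed
  also have "\<dots> = kform A L - l * cnj l / a"
    using a cnj_a by (simp add: c_def a_def[symmetric] field_simps)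
  also have "\<dots> = kform (\<lambda>z w. A z w - A z p * A p w / A p p) L"
  proof -
    have "cnj (L (\<lambda>w. cnj (A z w - A z p * A p w / A p p))) = cnj (L (\<lambda>w. A w z)) - cnj l / a * A z p" for z
    proof -
      have "L (\<lambda>w. cnj (A z w - A z p * A p w / A p p)) = L (\<lambda>w. 1 * A w z + (- A p z / a) * A w p)"
        using cnj_a by (simp add: row a_def)
      then show ?thesis
        unfolding evals_comb2[OF L] using cnj_a by (simp add: row l_def)
    qed
    then have "kform (\<lambda>z w. A z w - A z p * A p w / A p p) L =
        L (\<lambda>z. 1 * cnj (L (\<lambda>w. A w z)) + (- cnj l / a) * A z p)"
      by (simp add: kform_def)
    then show ?thesis
      unfolding evals_comb2[OF L] by (simp add: kform_def row l_def mult.commute)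
  qed
  finally show "0 \<le> Re (kform (\<lambda>z w. A z w - A z p * A p w / A p p) L)" .
qed

text \<open>Cholesky decomposition. The columns of the Schur complement at \<open>p\<close> vanish
  at \<open>p\<close> and so lie in the span of fewer functions; the part split off is the square of
  the column at \<open>p\<close> divided by the root of \<open>A p p\<close>.\<close>

lemma psd_imp_gram:
  assumes "\<And>z w. A w z = cnj (A z w)" "psd A" "finite T" "\<And>w. (\<lambda>z. A z w) \<in> cfun.span T"
  shows "\<exists>(m::nat) f. (\<forall>\<mu><m. f \<mu> \<in> cfun.span T) \<and> (\<forall>z w. A z w = (\<Sum>\<mu><m. f \<mu> z * cnj (f \<mu> w)))"
  using assms
proof (induction "card T" arbitrary: A T rule: less_induct)
  case less
  note herm = less.prems(1)
  show ?case
  proof (cases "\<forall>z. A z z = 0")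
    case True
    then have "A z w = 0" for z w
      using psd_zero_diagonal[of A, OF herm less.prems(2)] by blast
    then show ?thesis
      by (intro exI[of _ 0]) auto
  next
    case False
    then obtain p where p: "A p p \<noteq> 0"
      by blast
    define r where "r = Re (A p p)"
    have r: "A p p = of_real r" "r > 0"
    proof -
      have "0 \<le> r" "Im (A p p) = 0"
        using psd_diagonal[of A, OF herm less.prems(2)] by (auto simp: r_def)
      then show "A p p = of_real r" "r > 0"
        using p by (auto simp: r_def complex_eq_iff)
    qed
    define A' where "A' = (\<lambda>z w. A z w - A z p * A p w / A p p)"
    have psd': "psd A'"
      unfolding A'_def by (rule psd_schur_complement[of A, OF herm less.prems(2) p])
    have herm': "A' w z = cnj (A' z w)" for z w
      using herm[of z w] herm[of p z] herm[of w p] herm[of p p] by (simp add: A'_def mult.commute)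
    have "\<exists>t0\<in>T. t0 p \<noteq> 0"
    proof (rule ccontr)
      assume "\<not> (\<exists>t0\<in>T. t0 p \<noteq> 0)"
      then have "(\<lambda>z. A z p) p = 0"
        using evals_zero_on_span[OF eval_in_evals[of p], of T "\<lambda>z. A z p"] less.prems(4) by blast
      then show False
        using p by simp
    qed
    then obtain t0 where t0: "t0 \<in> T" "t0 p \<noteq> 0"
      by blast
    define T' where "T' = (\<lambda>t s. t s - t p / t0 p * t0 s) ` (T - {t0})"
    have card: "card T' < card T"
      unfolding T'_def using t0 less.prems(3)
      by (meson card_Diff1_less card_image_le finite_Diff le_less_trans)
    have col': "(\<lambda>z. A' z w) \<in> cfun.span T'" for w
      unfolding T'_def
    proof (rule span_kernel_of_functional[OF eval_in_evals[of p] less.prems(3) t0])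
      have "(\<lambda>z. 1 * A z w + (- A p w / A p p) * A z p) \<in> cfun.span T"
        using less.prems(4) by (intro subspace_comb2[OF cfun.subspace_span])
      then show "(\<lambda>z. A' z w) \<in> cfun.span T"
        by (simp add: A'_def mult.commute)
      show "A' p w = 0"
        using p by (simp add: A'_def)
    qed
    have "finite T'"
      using less.prems(3) by (simp add: T'_def)
    then obtain m :: nat and f where f: "\<And>\<mu>. \<mu> < m \<Longrightarrow> f \<mu> \<in> cfun.span T'"
      and A': "\<And>z w. A' z w = (\<Sum>\<mu><m. f \<mu> z * cnj (f \<mu> w))"
      using less.hyps[OF card herm' psd' _ col'] by blast
    have "T' \<subseteq> cfun.span T"
    proof -
      have "(\<lambda>s. 1 * t s + (- t p / t0 p) * t0 s) \<in> cfun.span T" if "t \<in> T" for t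
        using that t0(1) by (intro subspace_comb2[OF cfun.subspace_span] cfun.span_base)
      then show ?thesis
        by (auto simp: T'_def)
    qed
    then have sub: "cfun.span T' \<subseteq> cfun.span T"
      by (rule cfun.span_minimal) (rule cfun.subspace_span)
    define g where "g = (\<lambda>\<mu>. if \<mu> < m then f \<mu> else (\<lambda>z. (1 / of_real (sqrt r)) * A z p))"
    have "g \<mu> \<in> cfun.span T" for \<mu>
      using f[of \<mu>] sub cfun.subspace_scale[OF cfun.subspace_span less.prems(4)[of p], of "1 / of_real (sqrt r)"]
      by (cases "\<mu> < m") (auto simp: g_def simp del: mult_1 times_divide_eq_left)
    moreover have "A z w = (\<Sum>\<mu><Suc m. g \<mu> z * cnj (g \<mu> w))" for z w
    proof -
      have "complex_of_real (sqrt r) * complex_of_real (sqrt r) = of_real r"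
        using r(2) by (simp flip: of_real_mult)
      then have "g m z * cnj (g m w) = A z p * A p w / A p p"
        using herm[of w p] r by (simp add: g_def)
      moreover have "(\<Sum>\<mu><m. g \<mu> z * cnj (g \<mu> w)) = A' z w"
        unfolding A' by (intro sum.cong) (auto simp: g_def)
      ultimately show ?thesis
        by (simp add: A'_def)
    qed
    ultimately show ?thesis
      by blast
  qed
qed

definition cnjv :: "complex ^ 'n \<Rightarrow> complex ^ 'n" where
  "cnjv w = (\<chi> i. cnj (w $ i))"

lemma cnjv_nth [simp]: "cnjv w $ i = cnj (w $ i)"
  by (simp add: cnjv_def)

lemma cnjv_cnjv [simp]: "cnjv (cnjv w) = w"
  by (simp add: vec_eq_iff)

text \<open>A functional \<open>\<gamma>\<close> with negative form splits off a hyperplane \<open>ker \<gamma>\<close> of the column space whose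
  products with the coordinates give all products: a functional separating the two would restrict
  to a multiple of \<open>\<gamma>\<close> on each \<open>z\<^sub>i\<close> times the column space, and then be negative for
  the product kernel.\<close>

lemma (in herm_kernel) shift_span:
  assumes npsd: "\<not> psd A"
    and B: "\<And>z w. A z w * dot z (cnjv w) = (\<Sum>\<mu>\<in>I. F \<mu> z * cnj (F \<mu> w))"
    and T: "finite T" "\<And>w. col w \<in> cfun.span T"
  shows "\<exists>T'. finite T' \<and> card T' \<le> CARD('n) * (card T - 1) \<and>
    (\<forall>t\<in>T. \<forall>i. (\<lambda>z. z $ i * t z) \<in> cfun.span T')"
proof -
  obtain \<gamma> where \<gamma>: "\<gamma> \<in> evals" "Re (kform A \<gamma>) < 0"
    using npsd unfolding psd_def by fastforce
  have "\<exists>t0\<in>T. \<gamma> t0 \<noteq> 0"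
  proof (rule ccontr)
    assume "\<not> (\<exists>t0\<in>T. \<gamma> t0 \<noteq> 0)"
    then have "\<gamma> (col z) = 0" for z
      using evals_zero_on_span[OF \<gamma>(1) _ T(2)] by blast
    then have "kform A \<gamma> = \<gamma> (\<lambda>z. 0 * A z z)"
      by (simp add: kform_alt)
    then show False
      using \<gamma>(2) unfolding evals_scale[OF \<gamma>(1)] by simp
  qed
  then obtain t0 where t0: "t0 \<in> T" "\<gamma> t0 \<noteq> 0"
    by blast
  define T1 where "T1 = (\<lambda>t s. t s - \<gamma> t / \<gamma> t0 * t0 s) ` (T - {t0})"
  define T' where "T' = (\<lambda>(i, t) z. z $ i * t z) ` ((UNIV :: 'n set) \<times> T1)"
  have T1: "finite T1" "card T1 \<le> card T - 1"
    using T(1) t0(1) card_image_le[of "T - {t0}"] by (simp_all add: T1_def)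
  have "card T' \<le> card ((UNIV :: 'n set) \<times> T1)"
    unfolding T'_def using T1(1) by (intro card_image_le) simp
  then have card: "card T' \<le> CARD('n) * (card T - 1)"
    using T1(2) by (simp add: card_cartesian_product) (meson le_trans mult_le_mono2)
  have fin: "finite T'"
    using T1(1) by (simp add: T'_def)
  have "(\<lambda>z. z $ i * t z) \<in> cfun.span T'" if t: "t \<in> T" for t i
  proof (rule ccontr)
    assume "(\<lambda>z. z $ i * t z) \<notin> cfun.span T'"
    then obtain L where L: "L \<in> evals" "\<And>t. t \<in> T' \<Longrightarrow> L t = 0" "L (\<lambda>z. z $ i * t z) \<noteq> 0"
      using evals_separate[OF fin] by blast
    define M where "M = (\<lambda>l f. L (\<lambda>z. z $ l * f z))"
    have M: "M l \<in> evals" for l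
      unfolding M_def by (rule evals_mult[OF L(1)])
    have M0: "M l x = 0" if "x \<in> cfun.span T" "\<gamma> x = 0" for l x
    proof (rule evals_zero_on_span[OF M])
      show "x \<in> cfun.span T1"
        unfolding T1_def by (rule span_kernel_of_functional[OF \<gamma>(1) T(1) t0 that])
      show "M l s = 0" if "s \<in> T1" for s
        unfolding M_def using that by (intro L(2)) (auto simp: T'_def)
    qed
    define b where "b = (\<lambda>l. M l t0 / \<gamma> t0)"
    have Mb: "M l x = b l * \<gamma> x" if x: "x \<in> cfun.span T" for l x
    proof -
      have "(\<lambda>s. 1 * x s + (- \<gamma> x / \<gamma> t0) * t0 s) \<in> cfun.span T"
        by (rule subspace_comb2[OF cfun.subspace_span x cfun.span_base[OF t0(1)]])
      moreover have "\<gamma> (\<lambda>s. 1 * x s + (- \<gamma> x / \<gamma> t0) * t0 s) = 0"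
        unfolding evals_comb2[OF \<gamma>(1)] using t0(2) by simp
      ultimately have "M l (\<lambda>s. 1 * x s + (- \<gamma> x / \<gamma> t0) * t0 s) = 0"
        by (rule M0)
      then show ?thesis
        unfolding evals_comb2[OF M] by (simp add: b_def algebra_simps)
    qed
    have "b i \<noteq> 0"
      using L(3) Mb[OF cfun.span_base[OF t], of i] by (auto simp: M_def)
    define x\<gamma> where "x\<gamma> = (\<lambda>z. cnj (\<gamma> (col z)))"
    have x\<gamma>: "x\<gamma> \<in> cfun.span T"
    proof -
      obtain J c where c: "\<gamma> = (\<lambda>f. \<Sum>q\<in>J. c q * f q)"
        using evals_finite_sum[OF \<gamma>(1)] by blast
      have "x\<gamma> = (\<lambda>z. \<Sum>q\<in>J. cnj (c q) * col q z)"
        by (simp add: x\<gamma>_def c cnj_row)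
      then show ?thesis
        using subspace_lincomb[OF cfun.subspace_span T(2)] by simp
    qed
    let ?B = "\<lambda>z w. A z w * dot z (cnjv w)"
    have "cnj (L (\<lambda>w. cnj (?B z w))) = (\<Sum>l\<in>UNIV. cnj (b l) * (z $ l * x\<gamma> z))" for z
    proof -
      have "L (\<lambda>w. cnj (?B z w)) = L (\<lambda>w. \<Sum>l\<in>UNIV. cnj (z $ l) * (w $ l * A w z))"
        by (simp add: dot_def cnj_row sum_distrib_left mult_ac)
      also have "\<dots> = (\<Sum>l\<in>UNIV. cnj (z $ l) * M l (col z))"
        unfolding evals_sum[OF L(1)] M_def ..
      also have "\<dots> = (\<Sum>l\<in>UNIV. cnj (z $ l) * (b l * \<gamma> (col z)))"
        by (simp add: Mb[OF T(2)])
      finally show ?thesis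
        by (simp add: x\<gamma>_def mult_ac)
    qed
    then have "kform ?B L = (\<Sum>l\<in>UNIV. cnj (b l) * M l x\<gamma>)"
      unfolding kform_def M_def by (simp add: evals_sum[OF L(1)])
    also have "\<dots> = (\<Sum>l\<in>UNIV. of_real ((cmod (b l))\<^sup>2)) * kform A \<gamma>"
      unfolding Mb[OF x\<gamma>] complex_norm_square
      by (simp add: kform_alt x\<gamma>_def sum_distrib_left mult_ac)
    finally have "Re (kform ?B L) = (\<Sum>l\<in>UNIV. (cmod (b l))\<^sup>2) * Re (kform A \<gamma>)"
      by (simp del: of_real_power flip: of_real_sum)
    moreover have "0 < (\<Sum>l\<in>UNIV. (cmod (b l))\<^sup>2)"
      using \<open>b i \<noteq> 0\<close> by (intro sum_pos2[of _ i]) auto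
    ultimately have "Re (kform ?B L) < 0"
      using \<gamma>(2) by (simp add: mult_pos_neg)
    moreover have "?B = (\<lambda>z w. \<Sum>\<mu>\<in>I. F \<mu> z * cnj (F \<mu> w))"
      by (intro ext B)
    then have "kform ?B L = of_real (\<Sum>\<mu>\<in>I. (cmod (L (F \<mu>)))\<^sup>2)"
      using kform_gram[OF L(1), of F I] by simp
    then have "0 \<le> Re (kform ?B L)"
      by (simp only: Re_complex_of_real sum_nonneg zero_le_power2)
    ultimately show False
      by simp
  qed
  then show ?thesis
    using fin card by blast
qed

subsection \<open>Ranks of subspaces of functions\<close>

text \<open>Row rank equals column rank: the evaluations, seen as functions on \<open>X\<close>,
  have a dual system whose nodes are members of \<open>X\<close>, and these nodes are the required
  functions.\<close>

lemma indep_points_imp_functions: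
  assumes "cfun.subspace X" "finite I" "indep (\<lambda>i x. x (p i)) I X"
  obtains x where "x ` I \<subseteq> X" "indep x I (p ` I)"
proof -
  obtain x v where x: "\<And>i. i \<in> I \<Longrightarrow> x i \<in> X" and v: "v ` I \<subseteq> cfun.span ((\<lambda>i x. x (p i)) ` I)"
    and d: "\<And>i j. i \<in> I \<Longrightarrow> j \<in> I \<Longrightarrow> v i (x j) = (if i = j then 1 else 0)"
    using dual_system[OF assms(2,3)] by metis
  have "indep x I (p ` I)"
  proof (rule indepI)
    fix c i assume c: "\<And>s. s \<in> p ` I \<Longrightarrow> (\<Sum>j\<in>I. c j * x j s) = 0" and i: "i \<in> I"
    have "v i \<in> cfun.span ((\<lambda>i x. x (p i)) ` I)"
      using v i by blast
    then have "(\<Sum>j\<in>I. c j * v i (x j)) = 0"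
    proof (induction rule: cfun.span_induct_alt)
      case base
      show ?case
        by simp
    next
      case (step a y z)
      then obtain k where k: "k \<in> I" "y = (\<lambda>x. x (p k))"
        by blast
      have "(\<Sum>j\<in>I. c j * ((\<lambda>i. a * y i) + z) (x j)) = a * (\<Sum>j\<in>I. c j * x j (p k)) + (\<Sum>j\<in>I. c j * z (x j))"
        by (simp add: k(2) distrib_left sum.distrib sum_distrib_left mult_ac)
      then show ?case
        using c[of "p k"] k(1) step.IH by simp
    qed
    moreover have "(\<Sum>j\<in>I. c j * v i (x j)) = (\<Sum>j\<in>I. if j = i then c i else 0)"
      using i by (intro sum.cong) (auto simp: d)
    ultimately show "c i = 0"
      using i assms(2) by simp
  qed
  then show ?thesis
    using that x by blast
qed

lemma rank_ge_imp_indep_points: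
  assumes "cfun.subspace U" "rank_ge U S m"
  obtains p :: "nat \<Rightarrow> 's" where "p ` {..<m} \<subseteq> S" "indep (\<lambda>i u. u (p i)) {..<m} U"
proof -
  obtain u :: "nat \<Rightarrow> 's \<Rightarrow> complex" where u: "u ` {..<m} \<subseteq> U" "indep u {..<m} S"
    using assms(2) unfolding rank_ge_def by blast
  obtain p v where p: "\<And>i. i \<in> {..<m} \<Longrightarrow> p i \<in> S" and v: "v ` {..<m} \<subseteq> cfun.span (u ` {..<m})"
    and d: "\<And>i j. i \<in> {..<m} \<Longrightarrow> j \<in> {..<m} \<Longrightarrow> v i (p j) = (if i = j then 1 else 0)"
    using dual_system[OF finite_lessThan u(2)] by metis
  have "cfun.span (u ` {..<m}) \<subseteq> U"
    using cfun.span_minimal[OF u(1) assms(1)] .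
  then have "indep (\<lambda>i u. u (p i)) {..<m} U"
    using v d by (intro indep_of_dual[of _ v]) auto
  then show ?thesis
    using that[of p] p by blast
qed

lemma rank_ge_of_indep_points:
  assumes "cfun.subspace X" "finite I" "p ` I \<subseteq> S" "indep (\<lambda>i x. x (p i)) I X"
  shows "rank_ge X S (card I)"
proof -
  obtain x where "x ` I \<subseteq> X" "indep x I (p ` I)"
    using indep_points_imp_functions[OF assms(1,2,4)] by blast
  then show ?thesis
    using assms(2,3) by (intro rank_geI[of I _ x]) (auto intro: indep_mono)
qed

definition on_set :: "('s \<Rightarrow> complex) set \<Rightarrow> 's set \<Rightarrow> ('s \<Rightarrow> complex) \<Rightarrow> bool" where
  "on_set U S f \<longleftrightarrow> (\<exists>u\<in>U. \<forall>s\<in>S. u s = f s)"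

lemma on_set_lincomb:
  assumes "cfun.subspace U" "\<And>i. i \<in> I \<Longrightarrow> on_set U S (f i)"
  shows "on_set U S (\<lambda>s. \<Sum>i\<in>I. c i * f i s)"
proof -
  obtain u where u: "\<And>i. i \<in> I \<Longrightarrow> u i \<in> U \<and> (\<forall>s\<in>S. u i s = f i s)"
    using assms(2) unfolding on_set_def by metis
  have "(\<lambda>s. \<Sum>i\<in>I. c i * u i s) \<in> U"
    using u by (intro subspace_lincomb[OF assms(1)]) blast
  moreover have "(\<Sum>i\<in>I. c i * u i s) = (\<Sum>i\<in>I. c i * f i s)" if "s \<in> S" for s
    using u that by (intro sum.cong) auto
  ultimately show ?thesis
    unfolding on_set_def by (intro bexI[of _ "\<lambda>s. \<Sum>i\<in>I. c i * u i s"]) simp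
qed

lemma on_set_scale: "cfun.subspace U \<Longrightarrow> on_set U S f \<Longrightarrow> on_set U S (\<lambda>s. c * f s)"
  using on_set_lincomb[of U "{()}" S "\<lambda>_. f" "\<lambda>_. c"] by simp

lemma on_set_eq: "on_set U S f \<Longrightarrow> (\<And>s. s \<in> S \<Longrightarrow> f s = g s) \<Longrightarrow> on_set U S g"
  unfolding on_set_def by auto

lemma on_set_comb2:
  assumes "cfun.subspace U" "on_set U S f" "on_set U S g"
  shows "on_set U S (\<lambda>s. a * f s + b * g s)"
proof -
  obtain u v where "u \<in> U" "v \<in> U" "\<And>s. s \<in> S \<Longrightarrow> u s = f s \<and> v s = g s"
    using assms(2,3) unfolding on_set_def by blast
  then show ?thesis
    unfolding on_set_def using subspace_comb2[OF assms(1), of u v a b]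
    by (intro bexI[of _ "\<lambda>s. a * u s + b * v s"]) auto
qed

lemma on_set_mono: "on_set U S f \<Longrightarrow> S' \<subseteq> S \<Longrightarrow> on_set U S' f"
  unfolding on_set_def by blast

lemma rank_geI_on_set:
  assumes "finite I" "m \<le> card I" "\<And>i. i \<in> I \<Longrightarrow> on_set U S (f i)" "indep f I S"
  shows "rank_ge U S m"
proof -
  obtain u where u: "\<And>i. i \<in> I \<Longrightarrow> u i \<in> U \<and> (\<forall>s\<in>S. u i s = f i s)"
    using assms(3) unfolding on_set_def by metis
  then have "indep u I S"
    using assms(4) indep_cong[of I S u f] by blast
  then show ?thesis
    using u assms(1,2) by (intro rank_geI[of I _ u]) auto
qed

locale bounded_rank =
  fixes U :: "('s \<Rightarrow> complex) set" and R :: nat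
  assumes subspace: "cfun.subspace U"
    and bound: "rank_ge U UNIV m \<Longrightarrow> m \<le> R"
begin

definition rk :: "'s set \<Rightarrow> nat" where
  "rk S = Max {m. rank_ge U S m}"

lemma rank_ge_iff: "rank_ge U S m \<longleftrightarrow> m \<le> rk S"
proof -
  have "{m. rank_ge U S m} \<subseteq> {..R}"
    using bound rank_ge_mono[of U S _ U UNIV] by blast
  then have fin: "finite {m. rank_ge U S m}"
    by (rule finite_subset) simp
  have "0 \<in> {m. rank_ge U S m}"
    by simp
  then have "rk S \<in> {m. rank_ge U S m}"
    unfolding rk_def using fin Max_in[of "{m. rank_ge U S m}"] by blast
  then have "rank_ge U S m" if "m \<le> rk S"
    using that rank_ge_mono[of U S "rk S" U S m] by simp
  moreover have "m \<le> rk S" if "rank_ge U S m"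
    unfolding rk_def using fin that by (intro Max_ge) auto
  ultimately show ?thesis
    by blast
qed

lemma rk_le: "rk S \<le> R"
  using bound rank_ge_mono[of U S "rk S" U UNIV "rk S"] by (simp add: rank_ge_iff)

lemma max_family:
  obtains u :: "nat \<Rightarrow> 's \<Rightarrow> complex" where "u ` {..<rk S} \<subseteq> U" "indep u {..<rk S} S"
  using rank_ge_iff[of S "rk S"] unfolding rank_ge_def by blast

lemma indep_insert_not_on_set:
  assumes "u ` {..<m} \<subseteq> U" "indep u {..<m} S" "\<not> on_set U S f"
  shows "indep (\<lambda>i. if i < m then u i else f) {..<Suc m} S"
proof -
  let ?u = "\<lambda>i. if i < m then u i else f"
  have "indep ?u {..<m} S"
    using assms(2) indep_cong[of "{..<m}" S ?u u] by simp
  moreover have "\<exists>s\<in>S. ?u m s \<noteq> (\<Sum>j\<in>{..<m}. c j * ?u j s)" for c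
  proof (rule ccontr)
    assume "\<not> (\<exists>s\<in>S. ?u m s \<noteq> (\<Sum>j\<in>{..<m}. c j * ?u j s))"
    then have "\<forall>s\<in>S. (\<Sum>j\<in>{..<m}. c j * u j s) = f s"
      by simp
    moreover have "(\<lambda>s. \<Sum>j\<in>{..<m}. c j * u j s) \<in> U"
      using assms(1) by (intro subspace_lincomb[OF subspace]) auto
    ultimately have "on_set U S f"
      unfolding on_set_def by (intro bexI[of _ "\<lambda>s. \<Sum>j\<in>{..<m}. c j * u j s"])
    then show False
      using assms(3) by simp
  qed
  ultimately show ?thesis
    unfolding lessThan_Suc by (intro indep_insertI) auto
qed

text \<open>Membership in the restriction of \<open>U\<close> to \<open>S\<close> is a closed
  condition: a maximal independent family extended by \<open>f e0\<close> stays independent for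
  almost all \<open>e\<close>, and independence excludes \<open>f e\<close> from \<open>U\<close> by
  maximality.\<close>

lemma not_on_set_curve:
  assumes "\<And>s. s \<in> S \<Longrightarrow> poly_fun (\<lambda>e. f e s)" "\<not> on_set U S (f e0)"
  shows "finite {e. on_set U S (f e)}"
proof -
  obtain u :: "nat \<Rightarrow> 's \<Rightarrow> complex" where u: "u ` {..<rk S} \<subseteq> U" "indep u {..<rk S} S"
    by (rule max_family)
  let ?v = "\<lambda>e i. if i < rk S then u i else f e"
  have "finite {e. \<not> indep (?v e) {..<Suc (rk S)} S}"
  proof (rule indep_poly_curve[where u = ?v and ?e0.0 = e0])
    show "indep (?v e0) {..<Suc (rk S)} S"
      by (rule indep_insert_not_on_set[OF u assms(2)])
    show "poly_fun (\<lambda>e. ?v e i s)" if "s \<in> S" for i s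
      using assms(1)[OF that] by (cases "i < rk S") simp_all
  qed simp
  moreover have "\<not> indep (?v e) {..<Suc (rk S)} S" if e: "on_set U S (f e)" for e
  proof
    assume "indep (?v e) {..<Suc (rk S)} S"
    moreover have "on_set U S (?v e i)" for i
      using e u(1) by (auto simp: on_set_def)
    ultimately have "rank_ge U S (Suc (rk S))"
      by (intro rank_geI_on_set[of "{..<Suc (rk S)}" _ U S "?v e"]) auto
    then show False
      by (simp add: rank_ge_iff)
  qed
  then have "{e. on_set U S (f e)} \<subseteq> {e. \<not> indep (?v e) {..<Suc (rk S)} S}"
    by blast
  ultimately show ?thesis
    by (rule rev_finite_subset)
qed

text \<open>Rank-nullity for restricting from \<open>S\<close> to \<open>S'\<close>. From a basis on
  \<open>S\<close>, a largest part that stays independent on \<open>S'\<close> is kept; each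
  remaining member, corrected by that part, vanishes on \<open>S'\<close>.\<close>

lemma restriction_kernel:
  assumes "S' \<subseteq> S"
  obtains I :: "nat set" and v where "finite I" "card I + rk S' = rk S" "v ` I \<subseteq> U" "indep v I S"
    "\<And>i s. i \<in> I \<Longrightarrow> s \<in> S' \<Longrightarrow> v i s = 0"
proof -
  obtain u :: "nat \<Rightarrow> 's \<Rightarrow> complex" where u: "u ` {..<rk S} \<subseteq> U" "indep u {..<rk S} S"
    by (rule max_family)
  define P where "P = (\<lambda>J. J \<subseteq> {..<rk S} \<and> indep u J S')"
  have "P {}"
    by (simp add: P_def)
  moreover have "\<forall>J. P J \<longrightarrow> card J \<le> rk S"
    by (metis P_def card_lessThan card_mono finite_lessThan)
  ultimately obtain J where J: "P J" and max: "\<And>J'. P J' \<Longrightarrow> card J' \<le> card J"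
    using ex_has_greatest_nat[of P "{}" card "Suc (rk S)"] by (metis le_imp_less_Suc)
  have finJ: "finite J"
    using J finite_subset unfolding P_def by blast
  have "rank_ge U S' (card J)"
    using J u(1) finJ unfolding P_def by (intro rank_geI[of J _ u]) auto
  then have cardJ: "card J \<le> rk S'"
    by (simp add: rank_ge_iff)
  have "\<exists>c. \<forall>s\<in>S'. u i s = (\<Sum>j\<in>J. c j * u j s)" if i: "i \<in> {..<rk S} - J" for i
  proof -
    have "\<not> indep u (insert i J) S'"
    proof
      assume "indep u (insert i J) S'"
      then have "P (insert i J)"
        using i J by (auto simp: P_def)
      from max[OF this] show False
        using i finJ by simp
    qed
    moreover have "indep u J S'" "i \<notin> J"
      using J i by (simp_all add: P_def)
    ultimately obtain c where "\<And>s. s \<in> S' \<Longrightarrow> u i s = (\<Sum>j\<in>J. c j * u j s)"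
      using indep_dependent_insert[of u J S' i] finJ by metis
    then show ?thesis
      by blast
  qed
  then obtain c where c: "\<And>i s. i \<in> {..<rk S} - J \<Longrightarrow> s \<in> S' \<Longrightarrow> u i s = (\<Sum>j\<in>J. c i j * u j s)"
    by metis
  define v where "v = (\<lambda>i s. u i s - (\<Sum>j\<in>J. c i j * u j s))"
  have vU: "v i \<in> U" if "i \<in> {..<rk S} - J" for i
  proof -
    have "(\<lambda>s. 1 * u i s + (-1) * (\<Sum>j\<in>J. c i j * u j s)) \<in> U"
      using u(1) J that unfolding P_def
      by (intro subspace_comb2[OF subspace] subspace_lincomb[OF subspace]) auto
    then show ?thesis
      by (simp add: v_def)
  qed
  have ind: "indep v ({..<rk S} - J) S"
  proof (rule indepI)
    fix d i assume d: "\<And>s. s \<in> S \<Longrightarrow> (\<Sum>i\<in>{..<rk S} - J. d i * v i s) = 0" and i: "i \<in> {..<rk S} - J"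
    define d' where "d' = (\<lambda>k. if k \<in> J then - (\<Sum>i\<in>{..<rk S} - J. d i * c i k) else d k)"
    have "(\<Sum>k\<in>{..<rk S}. d' k * u k s) = 0" if s: "s \<in> S" for s
    proof -
      have "(\<Sum>k\<in>{..<rk S}. d' k * u k s) =
          (\<Sum>k\<in>{..<rk S} - J. d' k * u k s) + (\<Sum>k\<in>J. d' k * u k s)"
        using J unfolding P_def by (intro sum.subset_diff) auto
      also have "(\<Sum>k\<in>J. d' k * u k s) = - (\<Sum>k\<in>J. \<Sum>i\<in>{..<rk S} - J. d i * c i k * u k s)"
        by (simp add: d'_def sum_distrib_right sum_negf)
      also have "\<dots> = - (\<Sum>i\<in>{..<rk S} - J. d i * (\<Sum>k\<in>J. c i k * u k s))"
        by (subst sum.swap) (simp add: sum_distrib_left mult_ac)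
      also have "(\<Sum>k\<in>{..<rk S} - J. d' k * u k s) = (\<Sum>k\<in>{..<rk S} - J. d k * u k s)"
        by (intro sum.cong) (auto simp: d'_def)
      finally have "(\<Sum>k\<in>{..<rk S}. d' k * u k s) = (\<Sum>i\<in>{..<rk S} - J. d i * v i s)"
        by (simp add: v_def right_diff_distrib sum_subtractf)
      then show ?thesis
        using d[OF s] by simp
    qed
    then have "d' i = 0"
      using indepD[OF u(2)] i by blast
    then show "d i = 0"
      using i by (auto simp: d'_def)
  qed
  have v0: "v i s = 0" if "i \<in> {..<rk S} - J" "s \<in> S'" for i s
    using c[OF that] by (simp add: v_def)
  have "rk S' \<le> rk S"
    using rank_ge_mono[of U S' "rk S'" U S "rk S'"] assms by (simp add: rank_ge_iff)
  moreover have "card ({..<rk S} - J) = rk S - card J"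
    using J finJ unfolding P_def by (simp add: card_Diff_subset)
  ultimately have "rk S - rk S' \<le> card ({..<rk S} - J)"
    using cardJ by simp
  then obtain I where I: "I \<subseteq> {..<rk S} - J" "card I = rk S - rk S'" "finite I"
    by (meson obtain_subset_with_card_n)
  show ?thesis
  proof (rule that[of I v])
    show "card I + rk S' = rk S"
      using I(2) \<open>rk S' \<le> rk S\<close> by simp
    show "indep v I S"
      by (rule indep_subset[OF ind I(1)]) simp
  qed (use I vU v0 in auto)
qed

end

lemma bounded_rank_span:
  assumes "finite T"
  shows "bounded_rank (cfun.span T) (card T)"
proof
  show "cfun.subspace (cfun.span T)"
    by (rule cfun.subspace_span)
  show "m \<le> card T" if "rank_ge (cfun.span T) UNIV m" for m
    using that card_le_of_indep[OF _ _ assms, of _ "{..<m}"] unfolding rank_ge_def by auto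
qed

lemma mult_dot_cancel:
  assumes "vec.subspace E" "d \<in> E" "dot d y \<noteq> 0" "f \<in> mpoly_fun"
    "\<And>z. z \<in> E \<Longrightarrow> dot z y * f z = 0" "z \<in> E"
  shows "f z = 0"
  using mpoly_fun_common_nonzero[OF assms(1) mpoly_fun_dot assms(4) assms(2,6,3)] assms(5) by fastforce

lemma indep_mult_dot:
  assumes "vec.subspace E" "d \<in> E" "dot d y \<noteq> 0" "h ` I \<subseteq> mpoly_fun" "indep h I E"
  shows "indep (\<lambda>i z. dot z y * h i z) I E"
proof (rule indepI)
  fix c i assume c: "\<And>z. z \<in> E \<Longrightarrow> (\<Sum>i\<in>I. c i * (dot z y * h i z)) = 0" and i: "i \<in> I"
  have "(\<Sum>i\<in>I. c i * h i z) = 0" if "z \<in> E" for z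
  proof (rule mult_dot_cancel[OF assms(1-3) _ _ that])
    show "(\<lambda>z. \<Sum>i\<in>I. c i * h i z) \<in> mpoly_fun"
      using assms(4) by (intro subspace_lincomb[OF mpoly_fun_subspace]) auto
    show "dot z y * (\<Sum>i\<in>I. c i * h i z) = 0" if "z \<in> E" for z
      using c[OF that] by (simp add: sum_distrib_left mult_ac)
  qed
  then show "c i = 0"
    using indepD[OF assms(5)] i by blast
qed

text \<open>Multiples of \<open>dot z y\<close> vanish on the hyperplane, so they add to the rank there.\<close>

lemma rank_ge_add_multiples:
  assumes E: "vec.subspace E" and d: "d \<in> E" "dot d y \<noteq> 0"
    and r: "rank_ge V (hyp E y) r"
    and h: "finite I" "h ` I \<subseteq> mpoly_fun" "indep h I E"
      "\<And>i. i \<in> I \<Longrightarrow> on_set V E (\<lambda>z. dot z y * h i z)"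
  shows "rank_ge V E (r + card I)"
proof -
  obtain u :: "nat \<Rightarrow> _" where u: "u ` {..<r} \<subseteq> V" "indep u {..<r} (hyp E y)"
    using r unfolding rank_ge_def by blast
  let ?f = "case_sum u (\<lambda>i z. dot z y * h i z)"
  have split: "(\<Sum>k\<in>{..<r} <+> I. c k * ?f k z) =
      (\<Sum>i\<in>{..<r}. c (Inl i) * u i z) + (\<Sum>i\<in>I. c (Inr i) * (dot z y * h i z))" for c z
    using h(1) by (simp add: sum.Plus)
  have "indep ?f ({..<r} <+> I) E"
  proof (rule indepI)
    fix c k assume c: "\<And>z. z \<in> E \<Longrightarrow> (\<Sum>k\<in>{..<r} <+> I. c k * ?f k z) = 0" and k: "k \<in> {..<r} <+> I"
    have "(\<Sum>i\<in>{..<r}. c (Inl i) * u i z) = 0" if "z \<in> hyp E y" for z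
      using c[of z] that unfolding split by (simp add: hyp_def)
    then have c1: "c (Inl i) = 0" if "i \<in> {..<r}" for i
      using indepD[OF u(2), of "\<lambda>i. c (Inl i)"] that by blast
    have "(\<Sum>i\<in>I. c (Inr i) * (dot z y * h i z)) = 0" if "z \<in> E" for z
      using c[OF that] c1 unfolding split by simp
    then have "c (Inr i) = 0" if "i \<in> I" for i
      using indepD[OF indep_mult_dot[OF E d h(2,3)], of "\<lambda>i. c (Inr i)"] that by blast
    then show "c k = 0"
      using k c1 by auto
  qed
  moreover have "on_set V E (?f k)" if "k \<in> {..<r} <+> I" for k
  proof (cases k)
    case (Inl i)
    then have "u i \<in> V"
      using that u(1) by auto
    then show ?thesis
      using Inl unfolding on_set_def by (intro bexI[of _ "u i"]) auto
  qed (use that h(4) in auto)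
  ultimately show ?thesis
    using h(1) by (intro rank_geI_on_set[of "{..<r} <+> I" _ V E ?f]) (auto simp: card_Plus)
qed

lemma indep_card_le_card:
  assumes "finite I" "finite S" "indep u I S"
  shows "card I \<le> card S"
proof -
  obtain s v where s: "\<And>i. i \<in> I \<Longrightarrow> s i \<in> S" and "v ` I \<subseteq> cfun.span (u ` I)"
    and d: "\<And>i j. i \<in> I \<Longrightarrow> j \<in> I \<Longrightarrow> v i (s j) = (if i = j then 1 else 0)"
    using dual_system[OF assms(1,3)] by metis
  have "inj_on s I"
    by (rule inj_onI) (metis d zero_neq_one)
  then show ?thesis
    using s assms(2) by (intro card_inj_on_le[of s]) auto
qed

lemma mpoly_fun_cnj: "f \<in> mpoly_fun \<Longrightarrow> (\<lambda>y. cnj (f (cnjv y))) \<in> mpoly_fun"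
proof (induction rule: mpoly_fun.induct)
  case (coord i)
  show ?case
    using mpoly_fun.coord[of i] by simp
qed (auto intro: mpoly_fun.intros)

subsection \<open>Kernels that become sums of squares after multiplication by \<open>\<parallel>z\<parallel>\<^sup>2\<close>\<close>

text \<open>Conjugating the second argument makes \<open>a y z\<close> polynomial in \<open>y\<close> and \<open>z\<close>. The spaces \<open>X\<close> and
  \<open>U\<close> are the column spaces of the kernel and of its product with \<open>\<parallel>z\<parallel>\<^sup>2\<close>.\<close>

locale sos_kernel = herm_kernel A
  for A :: "complex ^ 'n \<Rightarrow> complex ^ 'n \<Rightarrow> complex" +
  fixes T0 :: "(complex ^ 'n \<Rightarrow> complex) set" and N :: nat
    and F :: "nat \<Rightarrow> complex ^ 'n \<Rightarrow> complex"
  assumes finite_T0: "finite T0" and col_T0: "col w \<in> cfun.span T0"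
    and npsd: "\<not> psd A" and diag: "0 \<le> Re (A z z)"
    and gram: "A z w * dot z (cnjv w) = (\<Sum>\<mu><N. F \<mu> z * cnj (F \<mu> w))"
begin

definition a :: "complex ^ 'n \<Rightarrow> complex ^ 'n \<Rightarrow> complex" where
  "a y z = A z (cnjv y)"

definition k :: "complex ^ 'n \<Rightarrow> complex ^ 'n \<Rightarrow> complex" where
  "k y z = dot z y * a y z"

definition X :: "(complex ^ 'n \<Rightarrow> complex) set" where
  "X = cfun.span (range a)"

definition U :: "(complex ^ 'n \<Rightarrow> complex) set" where
  "U = cfun.span (range k)"

lemma subspace_X: "cfun.subspace X"
  unfolding X_def by (rule cfun.subspace_span)

lemma a_in_X: "a y \<in> X"
  unfolding X_def by (rule cfun.span_base) simp

lemma k_in_U: "k y \<in> U"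
  unfolding U_def by (rule cfun.span_base) simp

lemma a_poly: "a y \<in> mpoly_fun"
  unfolding a_def by (rule poly_left)

lemma a_poly_param: "(\<lambda>y. a y z) \<in> mpoly_fun"
proof -
  have "(\<lambda>y. a y z) = (\<lambda>y. cnj (A (cnjv y) z))"
    by (simp add: a_def cnj_row)
  then show ?thesis
    using mpoly_fun_cnj[OF poly_left, of z] by simp
qed

lemma X_poly: "X \<subseteq> mpoly_fun"
  unfolding X_def using a_poly by (intro cfun.span_minimal mpoly_fun_subspace) auto

lemma U_poly: "U \<subseteq> mpoly_fun"
  unfolding U_def k_def
  by (intro cfun.span_minimal mpoly_fun_subspace image_subsetI mpoly_fun.mult mpoly_fun_dot a_poly)

lemma X_T0: "X \<subseteq> cfun.span T0"
  unfolding X_def a_def using col_T0 by (intro cfun.span_minimal cfun.subspace_span) auto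

sublocale X: bounded_rank X "card T0"
proof
  show "cfun.subspace X"
    by (rule subspace_X)
  show "m \<le> card T0" if "rank_ge X UNIV m" for m
    using bounded_rank.bound[OF bounded_rank_span[OF finite_T0]] rank_ge_mono[OF that X_T0] by blast
qed

definition T1 :: "(complex ^ 'n \<Rightarrow> complex) set" where
  "T1 = (\<lambda>(i, t) z. z $ i * t z) ` (UNIV \<times> T0)"

lemma coord_mult_T1:
  assumes "x \<in> cfun.span T0"
  shows "(\<lambda>z. z $ i * x z) \<in> cfun.span T1"
  using assms
proof (induction rule: cfun.span_induct_alt)
  case base
  show ?case
    using cfun.span_zero by (simp add: zero_fun_def)
next
  case (step c t y)
  have "(\<lambda>z. z $ i * t z) \<in> cfun.span T1"
    using step.hyps by (intro cfun.span_base) (auto simp: T1_def)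
  from subspace_comb2[OF cfun.subspace_span this step.IH, of c 1] show ?case
    by (simp add: algebra_simps)
qed

sublocale U: bounded_rank U "card T1"
proof
  show "cfun.subspace U"
    unfolding U_def by (rule cfun.subspace_span)
  have "finite T1"
    using finite_T0 by (simp add: T1_def)
  moreover have "U \<subseteq> cfun.span T1"
    unfolding U_def
  proof (intro cfun.span_minimal cfun.subspace_span image_subsetI)
    fix y
    have "(\<lambda>z. \<Sum>i\<in>UNIV. y $ i * (z $ i * a y z)) \<in> cfun.span T1"
      using X_T0 a_in_X by (intro subspace_lincomb[OF cfun.subspace_span] coord_mult_T1) auto
    moreover have "k y = (\<lambda>z. \<Sum>i\<in>UNIV. y $ i * (z $ i * a y z))"
      by (rule ext) (simp add: k_def dot_def sum_distrib_left mult_ac)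
    ultimately show "k y \<in> cfun.span T1"
      by simp
  qed
  ultimately show "m \<le> card T1" if "rank_ge U UNIV m" for m
    using bounded_rank.bound[OF bounded_rank_span] rank_ge_mono[OF that] by blast
qed

definition t :: nat where
  "t = X.rk UNIV"

lemma shift_span_X:
  obtains T' where "finite T'" "card T' \<le> CARD('n) * (t - 1)"
    "\<And>x i. x \<in> X \<Longrightarrow> (\<lambda>z. z $ i * x z) \<in> cfun.span T'"
proof -
  obtain x :: "nat \<Rightarrow> _" where x: "x ` {..<t} \<subseteq> X" "indep x {..<t} UNIV"
    unfolding t_def by (rule X.max_family)
  define T where "T = x ` {..<t}"
  have XT: "X \<subseteq> cfun.span T"
  proof
    fix f assume f: "f \<in> X"
    have "\<exists>c. \<forall>s. (\<Sum>j<t. c j * x j s) = f s"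
    proof (rule ccontr)
      assume no: "\<not> ?thesis"
      let ?u = "\<lambda>i. if i < t then x i else f"
      have "indep ?u {..<t} UNIV"
        using x(2) indep_cong[of "{..<t}" UNIV ?u x] by simp
      then have "indep ?u (insert t {..<t}) UNIV"
        using no by (intro indep_insertI) (auto, metis)
      moreover have "?u ` insert t {..<t} \<subseteq> X"
        using x(1) f by auto
      ultimately have "rank_ge X UNIV (Suc t)"
        by (intro rank_geI[of "insert t {..<t}" _ ?u]) auto
      then show False
        by (simp add: X.rank_ge_iff t_def)
    qed
    then obtain c where "\<And>s. (\<Sum>j<t. c j * x j s) = f s"
      by blast
    then have "f = (\<lambda>s. \<Sum>j<t. c j * x j s)"
      by simp
    moreover have "(\<lambda>s. \<Sum>j<t. c j * x j s) \<in> cfun.span T"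
      by (intro subspace_lincomb[OF cfun.subspace_span] cfun.span_base) (auto simp: T_def)
    ultimately show "f \<in> cfun.span T"
      by simp
  qed
  have T: "finite T" "card T \<le> t"
    using card_image_le[of "{..<t}" x] by (auto simp: T_def)
  have "col w \<in> cfun.span T" for w
  proof -
    have "a (cnjv w) = col w"
      by (rule ext) (simp add: a_def)
    then show ?thesis
      using XT a_in_X[of "cnjv w"] by auto
  qed
  then obtain T' where T': "finite T'" "card T' \<le> CARD('n) * (card T - 1)"
    and mult: "\<And>f i. f \<in> T \<Longrightarrow> (\<lambda>z. z $ i * f z) \<in> cfun.span T'"
    using shift_span[OF npsd gram T(1)] by blast
  show ?thesis
  proof (rule that[OF T'(1)])
    show "card T' \<le> CARD('n) * (t - 1)"
      using T'(2) T(2) by (meson diff_le_mono le_trans mult_le_mono2)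
    show "(\<lambda>z. z $ i * f z) \<in> cfun.span T'" if "f \<in> X" for f i
    proof -
      have "f \<in> cfun.span T"
        using that XT by blast
      then show ?thesis
      proof (induction rule: cfun.span_induct_alt)
        case base
        show ?case
          using cfun.span_zero by (simp add: zero_fun_def)
      next
        case (step c s y)
        from subspace_comb2[OF cfun.subspace_span mult[OF step.hyps, of i] step.IH, of c 1] show ?case
          by (simp add: algebra_simps)
      qed
    qed
  qed
qed

text \<open>The three coplanar points are what leaves room for \<open>m \<le> dim E\<close> such points on a hyperplane
  of \<open>E\<close>. Without them only \<open>dim E - 1\<close> points would fit.\<close>

definition good :: "(complex ^ 'n) set \<Rightarrow> nat \<Rightarrow> bool" where
  "good E m \<longleftrightarrow> 3 \<le> m \<and> (\<exists>p :: nat \<Rightarrow> complex ^ 'n. p ` {..<m} \<subseteq> E \<and>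
     indep (\<lambda>i x. x (p i)) {..<m} X \<and> (\<exists>\<alpha> \<beta>. p 2 = \<alpha> *s p 0 + \<beta> *s p 1))"

text \<open>The contrapositive of \<open>psd_if_rank_two_on_planes\<close>: as the kernel is
  nonnegative on the diagonal but not positive semidefinite, some plane carries three independent
  rows.\<close>

lemma good_three: "good UNIV 3"
proof -
  obtain z w \<alpha> \<beta> where ind: "indep (case_bool (A z) (A w)) UNIV UNIV"
    and no: "\<not> (\<exists>c d. \<forall>x. A (\<alpha> *s z + \<beta> *s w) x = c * A z x + d * A w x)"
    using psd_if_rank_two_on_planes[OF diag] npsd by blast
  define p :: "nat \<Rightarrow> complex ^ 'n"
    where "p = (\<lambda>i. if i = 0 then z else if i = 1 then w else \<alpha> *s z + \<beta> *s w)"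
  have "indep (\<lambda>i x. x (p i)) {..<3} X"
  proof (rule indepI)
    fix c i assume c: "\<And>x. x \<in> X \<Longrightarrow> (\<Sum>i\<in>{..<3::nat}. c i * x (p i)) = 0" and i: "i \<in> {..<3::nat}"
    have eq: "c 0 * A z s + c 1 * A w s + c 2 * A (\<alpha> *s z + \<beta> *s w) s = 0" for s
      using c[OF a_in_X[of "cnjv s"]] by (simp add: p_def a_def numeral_3_eq_3 numeral_2_eq_2)
    have "c 2 = 0"
    proof (rule ccontr)
      assume "c 2 \<noteq> 0"
      then have "A (\<alpha> *s z + \<beta> *s w) s = (- c 0 / c 2) * A z s + (- c 1 / c 2) * A w s" for s
        using eq[of s] by (simp add: field_simps) (metis add.commute add_eq_0_iff)
      then show False
        using no by blast
    qed
    then have "(\<Sum>b\<in>UNIV. (if b then c 0 else c 1) * case_bool (A z) (A w) b s) = 0" for s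
      using eq[of s] by (simp add: UNIV_bool add.commute)
    from indepD[OF ind this, of True] indepD[OF ind this, of False] have "c 0 = 0" "c 1 = 0"
      by simp_all
    moreover have "i = 0 \<or> i = 1 \<or> i = 2"
      using i by auto
    ultimately show "c i = 0"
      using \<open>c 2 = 0\<close> by auto
  qed
  moreover have "p 2 = \<alpha> *s p 0 + \<beta> *s p 1"
    by (simp add: p_def)
  ultimately show ?thesis
    unfolding good_def by blast
qed

text \<open>If no further point helped, every evaluation on \<open>X\<close> would be a combination
  of the \<open>m\<close> given ones. A member of \<open>X\<close> would then be determined by
  \<open>m\<close> values, against \<open>m < t\<close>.\<close>

lemma good_Suc:
  assumes "good UNIV m" "m < t"
  shows "good UNIV (Suc m)"
proof -
  obtain p \<alpha> \<beta> where m: "3 \<le> m" and p: "indep (\<lambda>i x. x (p i)) {..<m} X"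
    and p2: "p 2 = \<alpha> *s p 0 + \<beta> *s p 1"
    using assms(1) unfolding good_def by blast
  obtain x :: "nat \<Rightarrow> _" where x: "x ` {..<t} \<subseteq> X" "indep x {..<t} UNIV"
    unfolding t_def by (rule X.max_family)
  have "\<exists>q. indep (\<lambda>i x. x ((p(m := q)) i)) {..<Suc m} X"
  proof (rule ccontr)
    assume no: "\<not> ?thesis"
    have combo: "\<exists>c. \<forall>x\<in>X. x q = (\<Sum>j<m. c j * x (p j))" for q
    proof (rule ccontr)
      assume *: "\<not> ?thesis"
      let ?e = "\<lambda>i x. x ((p(m := q)) i)"
      have "indep ?e {..<m} X"
        using p indep_cong[of "{..<m}" X ?e "\<lambda>i x. x (p i)"] by simp
      then have "indep ?e (insert m {..<m}) X"
        using * by (intro indep_insertI) auto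
      then show False
        using no by (simp add: lessThan_Suc)
    qed
    have "indep x {..<t} (p ` {..<m})"
    proof (rule indepI)
      fix c i assume c: "\<And>s. s \<in> p ` {..<m} \<Longrightarrow> (\<Sum>j\<in>{..<t}. c j * x j s) = 0" and i: "i \<in> {..<t}"
      define f where "f = (\<lambda>s. \<Sum>j\<in>{..<t}. c j * x j s)"
      have "f \<in> X"
        unfolding f_def using x(1) by (intro subspace_lincomb[OF subspace_X]) auto
      have "f q = 0" for q
      proof -
        obtain d where "\<forall>x\<in>X. x q = (\<Sum>j<m. d j * x (p j))"
          using combo by blast
        then have "f q = (\<Sum>j<m. d j * f (p j))"
          using \<open>f \<in> X\<close> by blast
        also have "\<dots> = 0"
          using c by (intro sum.neutral) (auto simp: f_def)
        finally show ?thesis .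
      qed
      then show "c i = 0"
        using indepD[OF x(2), of c i] i by (simp add: f_def)
    qed
    then have "card {..<t} \<le> card (p ` {..<m})"
      by (intro indep_card_le_card) auto
    also have "\<dots> \<le> m"
      using card_image_le[of "{..<m}" p] by simp
    finally show False
      using assms(2) by simp
  qed
  then obtain q where "indep (\<lambda>i x. x ((p(m := q)) i)) {..<Suc m} X"
    by blast
  moreover have "(p(m := q)) 2 = \<alpha> *s (p(m := q)) 0 + \<beta> *s (p(m := q)) 1"
    using m p2 by simp
  ultimately show ?thesis
    unfolding good_def using m by (metis le_SucI subset_UNIV)
qed

lemma good_UNIV:
  assumes "3 \<le> m" "m \<le> t"
  shows "good UNIV m"
  using assms by (induction m rule: dec_induct) (use good_three good_Suc in auto)

lemma good_le:
  assumes "good E m" "3 \<le> m'" "m' \<le> m"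
  shows "good E m'"
proof -
  obtain p \<alpha> \<beta> where p: "p ` {..<m} \<subseteq> E" "indep (\<lambda>i x. x (p i)) {..<m} X"
    "p 2 = \<alpha> *s p 0 + \<beta> *s p 1"
    using assms(1) unfolding good_def by blast
  have "indep (\<lambda>i x. x (p i)) {..<m'} X"
    by (rule indep_subset[OF p(2)]) (use assms in auto)
  moreover have "p ` {..<m'} \<subseteq> E"
    using p(1) assms(3) by auto
  ultimately show ?thesis
    unfolding good_def using assms(2) p(3) by blast
qed

lemma good_rank: "good E m \<Longrightarrow> rank_ge X E m"
  unfolding good_def using rank_ge_of_indep_points[OF subspace_X, of "{..<m}" _ E] by auto

lemma three_le_t: "3 \<le> t"
  using good_rank[OF good_three] by (simp add: X.rank_ge_iff t_def)

lemma good_hyp_ex: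
  assumes E: "vec.subspace E" and good: "good E m" and m: "m \<le> vec.dim E"
  shows "\<exists>y. (\<exists>d\<in>E. dot d y \<noteq> 0) \<and> good (hyp E y) m"
proof -
  obtain p \<alpha> \<beta> where m3: "3 \<le> m" and p: "p ` {..<m} \<subseteq> E" "indep (\<lambda>i x. x (p i)) {..<m} X"
    and p2: "p 2 = \<alpha> *s p 0 + \<beta> *s p 1"
    using good unfolding good_def by blast
  let ?P = "p ` ({..<m} - {2})"
  have "card ?P \<le> card ({..<m} - {2})"
    by (rule card_image_le) simp
  also have "\<dots> < m"
    using m3 by (simp add: card_Diff_singleton)
  finally have "\<not> E \<subseteq> vec.span ?P"
    using vec.dim_le_card[of E ?P] m by auto
  then obtain d where d: "d \<in> E" "d \<notin> vec.span ?P"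
    by blast
  obtain y where y: "\<And>q. q \<in> ?P \<Longrightarrow> dot q y = 0" "dot d y \<noteq> 0"
    using span_separate[OF _ d(2)] by blast
  have "dot (p i) y = 0" if "i < m" for i
  proof (cases "i = 2")
    case True
    have "dot (p 0) y = 0" "dot (p 1) y = 0"
      using m3 by (auto intro!: y(1))
    then show ?thesis
      using True p2 by (simp add: dot_simps)
  next
    case False
    then show ?thesis
      using that by (intro y(1)) auto
  qed
  then have "p ` {..<m} \<subseteq> hyp E y"
    using p(1) by (auto simp: hyp_def)
  then have "good (hyp E y) m"
    unfolding good_def using m3 p(2) p2 by blast
  then show ?thesis
    using d(1) y(2) by blast
qed

lemma good_hyp_line_cofinite:
  assumes E: "vec.subspace E"
  shows "line_cofinite {y. (\<exists>d\<in>E. dot d y \<noteq> 0) \<and> good (hyp E y) m}"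
  unfolding line_cofinite_def
proof (intro ballI allI)
  fix y v assume "y \<in> {y. (\<exists>d\<in>E. dot d y \<noteq> 0) \<and> good (hyp E y) m}"
  then obtain d0 p \<alpha> \<beta> where d0: "d0 \<in> E" "dot d0 y \<noteq> 0" and m3: "3 \<le> m"
    and p: "p ` {..<m} \<subseteq> hyp E y" "indep (\<lambda>i x. x (p i)) {..<m} X"
    and p2: "p 2 = \<alpha> *s p 0 + \<beta> *s p 1"
    unfolding good_def by blast
  define d where "d = inverse (dot d0 y) *s d0"
  have d: "d \<in> E" "dot d y = 1"
    using d0 E by (auto simp: d_def dot_simps vec.subspace_scale)
  let ?q = "\<lambda>e i. tilt d (y + e *s v) (p i)"
  have "finite {e. \<not> indep (\<lambda>i x. x (?q e i)) {..<m} X}"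
  proof (rule indep_poly_curve[where u = "\<lambda>e i x. x (?q e i)" and ?e0.0 = 0])
    show "poly_fun (\<lambda>e. x (?q e i))" if "x \<in> X" for x i
      using that X_poly mpoly_fun_curve[OF _ poly_fun_tilt] by blast
    have "?q 0 i = p i" if "i < m" for i
      using that p(1) d(2) by (auto simp: tilt_def hyp_def)
    then show "indep (\<lambda>i x. x (?q 0 i)) {..<m} X"
      using p(2) indep_cong[of "{..<m}" X "\<lambda>i x. x (?q 0 i)" "\<lambda>i x. x (p i)"] by simp
  qed simp
  moreover have "finite {e. \<not> dot d (y + e *s v) \<noteq> 0}"
    using dot_line_cofinite[of d y v] d(2) by simp
  ultimately have "finite {e. \<not> (indep (\<lambda>i x. x (?q e i)) {..<m} X \<and> dot d (y + e *s v) \<noteq> 0)}"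
    by (rule cofinite_conj)
  then show "finite {e. y + e *s v \<notin> {y. (\<exists>d\<in>E. dot d y \<noteq> 0) \<and> good (hyp E y) m}}"
    unfolding mem_Collect_eq
  proof (rule cofinite_mono)
    fix e assume *: "indep (\<lambda>i x. x (?q e i)) {..<m} X \<and> dot d (y + e *s v) \<noteq> 0"
    have "?q e ` {..<m} \<subseteq> hyp E (y + e *s v)"
      using p(1) hyp_subset[of E y] tilt_in_hyp[OF E d(1)] by blast
    moreover have "?q e 2 = \<alpha> *s ?q e 0 + \<beta> *s ?q e 1"
      by (simp add: p2 tilt_linear)
    ultimately show "(\<exists>d\<in>E. dot d (y + e *s v) \<noteq> 0) \<and> good (hyp E (y + e *s v)) m"
      unfolding good_def using * d(1) m3 by blast
  qed
qed

text \<open>By construction \<open>U\<close> contains the products \<open>k y\<close>, where the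
  same \<open>y\<close> occurs in both factors; saturation asks for independent \<open>v\<close> and
  \<open>y\<close>.\<close>

definition saturated :: "(complex ^ 'n) set \<Rightarrow> bool" where
  "saturated E \<longleftrightarrow> (\<forall>y v. on_set U E (\<lambda>z. dot z v * a y z))"

text \<open>The demands on a hyperplane of the flag. The points continue the flag; they are
  requested from dimension 3 on, since \<open>good\<close> needs at least three of them. Maximal
  rank is what \<open>stability\<close> uses. The last clause makes the normal \<open>y\<close>
  itself a witness against saturation, so that \<open>k y\<close> can serve as an extra multiple of
  the equation of the hyperplane.\<close>

definition step :: "(complex ^ 'n) set \<Rightarrow> complex ^ 'n \<Rightarrow> bool" where
  "step E y \<longleftrightarrow> (\<exists>d\<in>E. dot d y \<noteq> 0) \<and>
     (3 \<le> vec.dim E \<longrightarrow> good (hyp E y) (min t (vec.dim E))) \<and>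
     (\<forall>y'. (\<exists>d\<in>E. dot d y' \<noteq> 0) \<longrightarrow> U.rk (hyp E y') \<le> U.rk (hyp E y)) \<and>
     (saturated E \<or> (\<exists>v. \<not> on_set U E (\<lambda>z. dot z v * a y z)))"

text \<open>Each demand holds for some normal and is generic along lines, so all can be met
  together. Maximal rank is first attained by some normal and then recast as the generic condition
  of reaching that rank.\<close>

lemma step_ex:
  assumes E: "vec.subspace E" and dim: "2 \<le> vec.dim E" and good: "good E (min t (Suc (vec.dim E)))"
  shows "\<exists>y. step E y"
proof -
  let ?nz = "\<lambda>y. \<exists>d\<in>E. dot d y \<noteq> 0"
  have "\<exists>d\<in>E. d \<noteq> 0"
  proof (rule ccontr)
    assume "\<not> (\<exists>d\<in>E. d \<noteq> 0)"
    then have "vec.dim E \<le> vec.dim ({0} :: (complex ^ 'n) set)"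
      by (intro vec.dim_subset) auto
    moreover have "vec.dim ({0} :: (complex ^ 'n) set) = 0"
      by simp
    ultimately show False
      using dim by linarith
  qed
  then obtain d i where "d \<in> E" "d $ i \<noteq> 0"
    by (auto simp: vec_eq_iff)
  then have nz_ex: "\<exists>y. ?nz y"
    by (metis dot_axis)
  define G1 where "G1 = {y. ?nz y \<and> (3 \<le> vec.dim E \<longrightarrow> good (hyp E y) (min t (vec.dim E)))}"
  have lc1: "line_cofinite G1"
  proof (cases "3 \<le> vec.dim E")
    case True
    then show ?thesis
      using good_hyp_line_cofinite[OF E] by (simp add: G1_def)
  next
    case False
    then show ?thesis
      using rank_ge_hyp_line_cofinite[OF E U_poly, of 0] by (simp add: G1_def)
  qed
  have ex1: "\<exists>y. y \<in> G1"
  proof (cases "3 \<le> vec.dim E")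
    case True
    have "good E (min t (vec.dim E))"
      by (rule good_le[OF good]) (use True three_le_t in auto)
    from good_hyp_ex[OF E this] True show ?thesis
      by (auto simp: G1_def)
  next
    case False
    then show ?thesis
      using nz_ex by (simp add: G1_def)
  qed
  have "\<exists>y. ?nz y \<and> (\<forall>y'. ?nz y' \<longrightarrow> U.rk (hyp E y') \<le> U.rk (hyp E y))"
  proof -
    have "\<forall>y. ?nz y \<longrightarrow> U.rk (hyp E y) < Suc (card T1)"
      using U.rk_le by (simp add: less_Suc_eq_le)
    then show ?thesis
      using nz_ex ex_has_greatest_nat[of ?nz _ "\<lambda>y. U.rk (hyp E y)" "Suc (card T1)"] by blast
  qed
  then obtain y2 where y2: "?nz y2" and max: "\<And>y'. ?nz y' \<Longrightarrow> U.rk (hyp E y') \<le> U.rk (hyp E y2)"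
    by blast
  define G2 where "G2 = {y. ?nz y \<and> rank_ge U (hyp E y) (U.rk (hyp E y2))}"
  have lc2: "line_cofinite G2"
    unfolding G2_def by (rule rank_ge_hyp_line_cofinite[OF E U_poly])
  have "y2 \<in> G2"
    using y2 by (auto simp: G2_def U.rank_ge_iff)
  then obtain y12 where y12: "y12 \<in> G1 \<inter> G2"
    using line_cofinite_ex[OF lc1 lc2] ex1 by blast
  have lc12: "line_cofinite (G1 \<inter> G2)"
    by (rule line_cofinite_Int[OF lc1 lc2])
  have finish: "step E y" if "y \<in> G1 \<inter> G2" "saturated E \<or> (\<exists>v. \<not> on_set U E (\<lambda>z. dot z v * a y z))" for y
    using that max unfolding step_def G1_def G2_def by (auto simp: U.rank_ge_iff intro: le_trans)
  show ?thesis
  proof (cases "saturated E")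
    case True
    then show ?thesis
      using finish y12 by blast
  next
    case False
    define G3 where "G3 = {y. \<exists>v. \<not> on_set U E (\<lambda>z. dot z v * a y z)}"
    have "line_cofinite G3"
      unfolding line_cofinite_def
    proof (intro ballI allI)
      fix y u assume "y \<in> G3"
      then obtain v where v: "\<not> on_set U E (\<lambda>z. dot z v * a y z)"
        by (auto simp: G3_def)
      have "finite {e. on_set U E (\<lambda>z. dot z v * a (y + e *s u) z)}"
      proof (rule U.not_on_set_curve[where ?e0.0 = 0])
        show "poly_fun (\<lambda>e. dot s v * a (y + e *s u) s)" for s
          by (intro poly_fun_mult poly_fun_const mpoly_fun_line[OF a_poly_param])
        show "\<not> on_set U E (\<lambda>z. dot z v * a (y + 0 *s u) z)"
          using v by simp
      qed
      then show "finite {e. y + e *s u \<notin> G3}"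
        by (rule rev_finite_subset) (auto simp: G3_def)
    qed
    moreover obtain y3 where "y3 \<in> G3"
      using False by (auto simp: G3_def saturated_def)
    ultimately obtain y where "y \<in> (G1 \<inter> G2) \<inter> G3"
      using line_cofinite_ex[OF lc12 _ y12] by blast
    then show ?thesis
      using finish[of y] by (auto simp: G3_def)
  qed
qed

lemma flag_ex:
  obtains E :: "nat \<Rightarrow> (complex ^ 'n) set" and Y where
    "E CARD('n) = UNIV"
    "\<And>j. 1 \<le> j \<Longrightarrow> j \<le> CARD('n) \<Longrightarrow> vec.subspace (E j) \<and> vec.dim (E j) = j"
    "\<And>j. 2 \<le> j \<Longrightarrow> j \<le> CARD('n) \<Longrightarrow>
       good (E j) (min t (Suc j)) \<and> step (E j) (Y j) \<and> E (j - 1) = hyp (E j) (Y j)"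
proof -
  let ?n = "CARD('n)"
  define S where "S = rec_nat UNIV (\<lambda>_ E. hyp E (SOME y. step E y))"
  have S0: "S 0 = UNIV" and S_Suc: "S (Suc i) = hyp (S i) (SOME y. step (S i) y)" for i
    by (simp_all add: S_def)
  have inv: "vec.subspace (S i) \<and> vec.dim (S i) = ?n - i \<and>
      (2 \<le> ?n - i \<longrightarrow> good (S i) (min t (Suc (?n - i))) \<and> step (S i) (SOME y. step (S i) y))"
    if "i < ?n" for i
    using that
  proof (induction i)
    case 0
    have dimU: "vec.dim (UNIV :: (complex ^ 'n) set) = ?n"
      by (rule vec_dim_card)
    have "good UNIV (min t (Suc ?n))" if "2 \<le> ?n"
      using that three_le_t by (intro good_UNIV) auto
    moreover have "\<exists>y. step UNIV y" if "2 \<le> ?n"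
      using step_ex[of UNIV, unfolded dimU] calculation[OF that] that by (simp add: vec.subspace_UNIV)
    ultimately show ?case
      unfolding S0 dimU by (auto simp: vec.subspace_UNIV intro: someI_ex)
  next
    case (Suc i)
    define y where "y = (SOME y. step (S i) y)"
    have sub: "vec.subspace (S i)" and dim: "vec.dim (S i) = ?n - i" and st: "step (S i) y"
      using Suc by (auto simp: y_def)
    obtain d where d: "d \<in> S i" "dot d y \<noteq> 0"
      using st unfolding step_def by blast
    have sub': "vec.subspace (S (Suc i))"
      unfolding S_Suc by (rule subspace_hyp[OF sub])
    have dim': "vec.dim (S (Suc i)) = ?n - Suc i"
      using dim_hyp[OF sub d] dim by (simp add: S_Suc y_def[symmetric])
    have "good (S (Suc i)) (min t (Suc (?n - Suc i)))" if "2 \<le> ?n - Suc i"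
      using st that Suc.prems dim unfolding step_def S_Suc y_def[symmetric] by (auto simp: Suc_diff_Suc)
    moreover from this have "\<exists>y. step (S (Suc i)) y" if "2 \<le> ?n - Suc i"
      using step_ex[OF sub'] that by (simp add: dim')
    ultimately show ?case
      using sub' dim' by (auto intro: someI_ex)
  qed
  show ?thesis
  proof (rule that[of "\<lambda>j. S (?n - j)" "\<lambda>j. SOME y. step (S (?n - j)) y"])
    show "S (?n - ?n) = UNIV"
      by (simp add: S0)
    show "vec.subspace (S (?n - j)) \<and> vec.dim (S (?n - j)) = j" if "1 \<le> j" "j \<le> ?n" for j
      using inv[of "?n - j"] that by simp
    show "good (S (?n - j)) (min t (Suc j)) \<and> step (S (?n - j)) (SOME y. step (S (?n - j)) y) \<and>
        S (?n - (j - 1)) = hyp (S (?n - j)) (SOME y. step (S (?n - j)) y)" if "2 \<le> j" "j \<le> ?n" for j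
    proof -
      have "?n - (j - 1) = Suc (?n - j)"
        using that by simp
      then show ?thesis
        using inv[of "?n - j"] that by (simp add: S_Suc)
    qed
  qed
qed

end

lemma linear_forms_indep:
  fixes E :: "(complex ^ 'n) set"
  assumes "vec.subspace E"
  shows "rank_ge (range (\<lambda>v z. dot z v)) E (vec.dim E)"
proof -
  obtain B where B: "B \<subseteq> E" "vec.independent B" "card B = vec.dim E"
    using vec.basis_exists[of E] by metis
  have fin: "finite B"
    using B(2) by (rule vec.finiteI_independent)
  have sub: "cfun.subspace (range (\<lambda>v z :: complex ^ 'n. dot z v))"
  proof (rule cfun.subspaceI)
    show "0 \<in> range (\<lambda>v z :: complex ^ 'n. dot z v)"
      by (rule image_eqI[of _ _ 0]) (auto simp: dot_def)
  next
    fix f g :: "complex ^ 'n \<Rightarrow> complex"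
    assume "f \<in> range (\<lambda>v z. dot z v)" "g \<in> range (\<lambda>v z. dot z v)"
    then obtain v w where "f = (\<lambda>z. dot z v)" "g = (\<lambda>z. dot z w)"
      by blast
    then show "f + g \<in> range (\<lambda>v z. dot z v)"
      by (intro image_eqI[of _ _ "v + w"]) (auto simp: dot_simps)
  next
    fix f :: "complex ^ 'n \<Rightarrow> complex" and c
    assume "f \<in> range (\<lambda>v z. dot z v)"
    then obtain v where "f = (\<lambda>z. dot z v)"
      by blast
    then show "(\<lambda>i. c * f i) \<in> range (\<lambda>v z. dot z v)"
      by (intro image_eqI[of _ _ "c *s v"]) (auto simp: dot_simps)
  qed
  have "indep (\<lambda>b f. f b) B (range (\<lambda>v z. dot z v))"
  proof (rule indepI)
    fix c b assume c: "\<And>f. f \<in> range (\<lambda>v z. dot z v) \<Longrightarrow> (\<Sum>b\<in>B. c b * f b) = 0" and b: "b \<in> B"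
    have "(\<Sum>b\<in>B. c b * b $ i) = 0" for i
    proof -
      have "(\<lambda>z. dot z (axis i 1)) \<in> range (\<lambda>v z. dot z v)"
        by blast
      from c[OF this] show ?thesis
        by (simp add: dot_axis)
    qed
    then have "(\<Sum>b\<in>B. c b *s b) = 0"
      by (simp add: vec_eq_iff)
    then show "c b = 0"
      using vec.independentD[OF B(2) fin subset_refl] b by blast
  qed
  then have "rank_ge (range (\<lambda>v z. dot z v)) E (card B)"
    using B(1) by (intro rank_ge_of_indep_points[OF sub fin, of "\<lambda>b. b"]) auto
  then show ?thesis
    by (simp add: B(3))
qed

lemma tilt_span:
  assumes "z \<in> vec.span P"
  shows "tilt d y z \<in> vec.span (tilt d y ` P)"
  using assms
proof (induction rule: vec.span_induct_alt)
  case base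
  show ?case
    by (simp add: tilt_def vec.span_zero)
next
  case (step c x z)
  then have "c *s tilt d y x + 1 *s tilt d y z \<in> vec.span (tilt d y ` P)"
    by (simp add: vec.span_add vec.span_scale vec.span_base)
  then show ?case
    using tilt_linear[of d y c x 1 z] by simp
qed

context sos_kernel
begin

subsection \<open>Rank drops along a generic flag\<close>

lemma saturated_X:
  assumes "saturated E" "x \<in> X"
  shows "on_set U E (\<lambda>z. dot z v * x z)"
  using assms(2) unfolding X_def
proof (induction rule: cfun.span_induct_alt)
  case base
  show ?case
    using on_set_lincomb[OF U.subspace, of "{}"] by simp
next
  case (step c x f)
  have "on_set U E (\<lambda>z. dot z v * x z)"
    using step.hyps assms(1) unfolding saturated_def by blast
  from on_set_comb2[OF U.subspace this step.IH, of c 1] show ?case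
    by (simp add: algebra_simps)
qed

lemma drop_saturated:
  assumes E: "vec.subspace E" "step E y" "saturated E" "good E m"
  shows "U.rk (hyp E y) + m \<le> U.rk E"
proof -
  obtain p where p: "p ` {..<m} \<subseteq> E" "indep (\<lambda>i x. x (p i)) {..<m} X"
    using E(4) unfolding good_def by blast
  obtain x where x: "x ` {..<m} \<subseteq> X" "indep x {..<m} (p ` {..<m})"
    using indep_points_imp_functions[OF subspace_X _ p(2)] by blast
  obtain d where d: "d \<in> E" "dot d y \<noteq> 0"
    using E(2) unfolding step_def by blast
  have "rank_ge U E (U.rk (hyp E y) + card {..<m})"
  proof (rule rank_ge_add_multiples[OF E(1) d, where h = x])
    show "rank_ge U (hyp E y) (U.rk (hyp E y))"
      by (simp add: U.rank_ge_iff)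
    show "indep x {..<m} E"
      using x(2) p(1) by (rule indep_mono)
    show "on_set U E (\<lambda>z. dot z y * x i z)" if "i \<in> {..<m}" for i
      using x(1) that by (intro saturated_X[OF E(3)]) auto
  qed (use x(1) X_poly in auto)
  then show ?thesis
    by (simp add: U.rank_ge_iff)
qed

text \<open>Since the rank on \<open>hyp E y\<close> is maximal among hyperplanes, it does not drop in the limit of the
  hyperplanes orthogonal to \<open>y + e *s v\<close>, on which \<open>dot z y\<close> equals \<open>- e * dot z v\<close>.\<close>

lemma stability:
  assumes E: "vec.subspace E" "step E y" and h: "h \<in> mpoly_fun"
    and on: "on_set U E (\<lambda>z. dot z y ^ b * h z)"
  shows "on_set U (hyp E y) (\<lambda>z. dot z v ^ b * h z)"
proof (rule ccontr)
  define g where "g = (\<lambda>z. dot z v ^ b * h z)"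
  define r where "r = U.rk (hyp E y)"
  assume "\<not> on_set U (hyp E y) (\<lambda>z. dot z v ^ b * h z)"
  then have not_on: "\<not> on_set U (hyp E y) g"
    by (simp add: g_def)
  obtain u :: "nat \<Rightarrow> _" where u: "u ` {..<r} \<subseteq> U" "indep u {..<r} (hyp E y)"
    unfolding r_def by (rule U.max_family)
  \<comment> \<open>Adjoining \<open>g\<close> raises the rank to \<open>r + 1\<close> here, hence
    also on almost every hyperplane of the pencil. There \<open>g\<close> belongs to
    \<open>U\<close> already, so \<open>U\<close> alone would have rank \<open>r + 1\<close>,
    exceeding the maximum.\<close>
  have "rank_ge (insert g U) (hyp E y) (Suc r)"
    using U.indep_insert_not_on_set[OF u not_on] u(1)
    by (intro rank_geI[of "{..<Suc r}" _ "\<lambda>i. if i < r then u i else g"]) auto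
  moreover have "g \<in> mpoly_fun"
    unfolding g_def by (intro mpoly_fun.mult mpoly_fun_power mpoly_fun_dot h)
  then have "insert g U \<subseteq> mpoly_fun"
    using U_poly by simp
  moreover have "\<exists>d\<in>E. dot d y \<noteq> 0"
    using E(2) unfolding step_def by blast
  ultimately have fin: "finite {e. \<not> y + e *s v \<in> {y. (\<exists>d\<in>E. dot d y \<noteq> 0) \<and> rank_ge (insert g U) (hyp E y) (Suc r)}}"
    using rank_ge_hyp_line_cofinite[OF E(1), of "insert g U" "Suc r"] unfolding line_cofinite_def
    by blast
  have "finite {e::complex. \<not> e \<noteq> 0}"
    by simp
  from cofinite_ex[OF cofinite_conj[OF fin this]] obtain e where e: "y + e *s v \<in> {y. (\<exists>d\<in>E. dot d y \<noteq> 0) \<and> rank_ge (insert g U) (hyp E y) (Suc r)}"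
    "e \<noteq> 0"
    by blast
  let ?H = "hyp E (y + e *s v)"
  have "on_set U ?H (\<lambda>z. (1 / (- e) ^ b) * (dot z y ^ b * h z))"
    by (rule on_set_scale[OF U.subspace on_set_mono[OF on hyp_subset]])
  moreover have "(1 / (- e) ^ b) * (dot z y ^ b * h z) = g z" if "z \<in> ?H" for z
  proof -
    have "dot z y = (- e) * dot z v"
      using that by (simp add: hyp_def dot_simps eq_neg_iff_add_eq_0)
    then have "dot z y ^ b = (- e) ^ b * dot z v ^ b"
      by (simp only: power_mult_distrib)
    then show ?thesis
      using e(2) by (simp add: g_def)
  qed
  ultimately have g_on: "on_set U ?H g"
    by (rule on_set_eq)
  obtain w :: "nat \<Rightarrow> _" where w: "w ` {..<Suc r} \<subseteq> insert g U" "indep w {..<Suc r} ?H"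
    using e(1) unfolding rank_ge_def by blast
  have "on_set U ?H (w i)" if "i \<in> {..<Suc r}" for i
  proof -
    have "w i \<in> insert g U"
      using w(1) that by blast
    then show ?thesis
      using g_on by (auto simp: on_set_def)
  qed
  then have "rank_ge U ?H (Suc r)"
    using w(2) by (intro rank_geI_on_set[of "{..<Suc r}" _ U ?H w]) auto
  then have "Suc r \<le> U.rk ?H"
    by (simp add: U.rank_ge_iff)
  moreover have "U.rk ?H \<le> r"
    using E(2) e(1) unfolding step_def r_def by blast
  ultimately show False
    by simp
qed

text \<open>The derivative at \<open>e = 0\<close>. The difference quotients \<open>f e\<close> lie
  in \<open>U\<close> on \<open>S\<close> for \<open>e \<noteq> 0\<close>, and closedness along the
  curve gives \<open>f 0\<close>, which is \<open>Suc b\<close> times the desired function.\<close>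

lemma on_set_power_derivative:
  assumes "\<And>e. on_set U S (\<lambda>z. (\<alpha> z + e * \<beta> z) ^ Suc b * \<gamma> z)"
  shows "on_set U S (\<lambda>z. \<alpha> z ^ b * \<beta> z * \<gamma> z)"
proof -
  define f where "f = (\<lambda>e z. (\<Sum>i<Suc b. (\<alpha> z + e * \<beta> z) ^ i * \<alpha> z ^ (b - i)) * \<beta> z * \<gamma> z)"
  have poly: "poly_fun (\<lambda>e. f e z)" for z
  proof -
    have "poly_fun (\<lambda>e. (\<alpha> z + e * \<beta> z) ^ i)" for i
      by (induction i) (auto intro!: poly_fun_intros)
    then show ?thesis
      unfolding f_def by (intro poly_fun_intros) auto
  qed
  have "on_set U S (f e)" if "e \<noteq> 0" for e
  proof -
    have "on_set U S (\<lambda>z. (1 / e) * ((\<alpha> z + e * \<beta> z) ^ Suc b * \<gamma> z) +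
        (- 1 / e) * ((\<alpha> z + 0 * \<beta> z) ^ Suc b * \<gamma> z))"
      by (rule on_set_comb2[OF U.subspace assms assms])
    moreover have "(1 / e) * ((\<alpha> z + e * \<beta> z) ^ Suc b * \<gamma> z) +
        (- 1 / e) * ((\<alpha> z + 0 * \<beta> z) ^ Suc b * \<gamma> z) = f e z" for z
    proof -
      have "(\<alpha> z + e * \<beta> z) ^ Suc b - \<alpha> z ^ Suc b =
          (e * \<beta> z) * (\<Sum>i<Suc b. (\<alpha> z + e * \<beta> z) ^ i * \<alpha> z ^ (b - i))"
        using diff_power_eq_sum[of "\<alpha> z + e * \<beta> z" b "\<alpha> z"] by simp
      then have "((\<alpha> z + e * \<beta> z) ^ Suc b - \<alpha> z ^ Suc b) * \<gamma> z / e = f e z"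
        using that by (simp only: f_def) (simp add: mult_ac)
      then show ?thesis
        by (simp add: diff_divide_distrib left_diff_distrib)
    qed
    ultimately show ?thesis
      by simp
  qed
  then have "UNIV - {0} \<subseteq> {e. on_set U S (f e)}"
    by auto
  then have "infinite {e. on_set U S (f e)}"
    using infinite_UNIV_char_0[where 'a = complex] by (metis finite_Diff2 finite.emptyI finite_insert finite_subset)
  then have "on_set U S (f 0)"
    using U.not_on_set_curve[of S f 0] poly by blast
  then have "on_set U S (\<lambda>z. 1 / of_nat (Suc b) * f 0 z)"
    by (rule on_set_scale[OF U.subspace])
  moreover have "1 / of_nat (Suc b) * f 0 z = \<alpha> z ^ b * \<beta> z * \<gamma> z" for z
  proof -
    have "(\<Sum>i<Suc b. (\<alpha> z + 0 * \<beta> z) ^ i * \<alpha> z ^ (b - i)) = (\<Sum>i<Suc b. \<alpha> z ^ b)"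
      by (intro sum.cong) (auto simp flip: power_add)
    then show ?thesis
      by (simp add: f_def del: of_nat_Suc sum.lessThan_Suc)
  qed
  ultimately show ?thesis
    by simp
qed

text \<open>A colon space: what all linear forms multiply into \<open>U\<close> on \<open>E\<close>.
  Saturation of \<open>E\<close> says that it contains every \<open>a y\<close>.\<close>

definition mult_part :: "(complex ^ 'n) set \<Rightarrow> (complex ^ 'n \<Rightarrow> complex) set" where
  "mult_part E = {h \<in> mpoly_fun. \<forall>v. on_set U E (\<lambda>z. dot z v * h z)}"

text \<open>A member of \<open>U\<close> vanishing on the hyperplane is \<open>dot z y * h\<close>
  on \<open>E\<close>, and \<open>stability\<close> puts the quotient \<open>h\<close> into the
  multiplier space there. If the quotients become dependent on the hyperplane, some member of
  \<open>U\<close> vanishes to order at least 2, and this one function already yields as many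
  multipliers as the hyperplane has dimensions. Hence the minimum.\<close>

lemma rank_mult_part:
  assumes E: "vec.subspace E" "step E y"
  shows "rank_ge (mult_part (hyp E y)) (hyp E y) (min (U.rk E - U.rk (hyp E y)) (vec.dim (hyp E y)))"
proof -
  let ?H = "hyp E y"
  obtain d0 where d0: "d0 \<in> E" "dot d0 y \<noteq> 0"
    using E(2) unfolding step_def by blast
  define d where "d = inverse (dot d0 y) *s d0"
  have d: "d \<in> E" "dot d y = 1"
    using d0 E(1) by (auto simp: d_def dot_simps vec.subspace_scale)
  then have d1: "dot d y \<noteq> 0"
    by simp
  have subH: "vec.subspace ?H"
    by (rule subspace_hyp[OF E(1)])
  obtain I :: "nat set" and v where I: "finite I" "card I + U.rk ?H = U.rk E"
    and v: "v ` I \<subseteq> U" "indep v I E" and v0: "\<And>i s. i \<in> I \<Longrightarrow> s \<in> ?H \<Longrightarrow> v i s = 0"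
    using U.restriction_kernel[OF hyp_subset] by metis
  have "\<exists>h\<in>mpoly_fun. \<forall>z\<in>E. v i z = dot z y * h z" if i: "i \<in> I" for i
  proof -
    have "v i \<in> mpoly_fun"
      using v(1) U_poly i by blast
    then obtain h where h: "h \<in> mpoly_fun" "\<And>z. v i z - v i (z - dot z y *s d) = dot z y * h z"
      using mpoly_fun_factor_diff by blast
    have "v i z = dot z y * h z" if "z \<in> E" for z
    proof -
      have "z - dot z y *s d \<in> ?H"
        using that d E(1) by (simp add: hyp_def dot_simps vec.subspace_diff vec.subspace_scale)
      then show ?thesis
        using h(2)[of z] v0[OF i] by simp
    qed
    then show ?thesis
      using h(1) by blast
  qed
  then obtain h where h: "\<And>i. i \<in> I \<Longrightarrow> h i \<in> mpoly_fun"
    and vh: "\<And>i z. i \<in> I \<Longrightarrow> z \<in> E \<Longrightarrow> v i z = dot z y * h i z"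
    by metis
  show ?thesis
  proof (cases "indep h I ?H")
    case True
    have "h i \<in> mult_part ?H" if i: "i \<in> I" for i
    proof -
      have "v i \<in> U"
        using v(1) i by blast
      then have "on_set U E (\<lambda>z. dot z y ^ 1 * h i z)"
        unfolding on_set_def using vh[OF i] by (intro bexI[of _ "v i"]) auto
      then show ?thesis
        using stability[OF E h[OF i], of 1] h[OF i] by (simp add: mult_part_def)
    qed
    then show ?thesis
      using True I by (intro rank_geI[of I _ h]) auto
  next
    case False
    then obtain c i where c: "\<And>z. z \<in> ?H \<Longrightarrow> (\<Sum>i\<in>I. c i * h i z) = 0" and i: "i \<in> I" "c i \<noteq> 0"
      unfolding indep_def by blast
    \<comment> \<open>This combination is not zero on \<open>E\<close>, but its quotient
      \<open>q\<close> vanishes on the hyperplane once more, which forces \<open>b \<ge> 2\<close>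
      below.\<close>
    define f where "f = (\<lambda>z. \<Sum>i\<in>I. c i * v i z)"
    define q where "q = (\<lambda>z. \<Sum>i\<in>I. c i * h i z)"
    have q: "q \<in> mpoly_fun"
      unfolding q_def using h by (intro subspace_lincomb[OF mpoly_fun_subspace])
    have fU: "f \<in> U"
      unfolding f_def using v(1) by (intro subspace_lincomb[OF U.subspace]) auto
    have fq: "f z = dot z y * q z" if "z \<in> E" for z
      using vh[OF _ that] by (simp add: f_def q_def sum_distrib_left mult_ac)
    have "\<exists>x\<in>E. f x \<noteq> 0"
    proof (rule ccontr)
      assume "\<not> (\<exists>x\<in>E. f x \<noteq> 0)"
      then have "c i = 0"
        using indepD[OF v(2), of c i] i(1) by (auto simp: f_def)
      then show False
        using i(2) by simp
    qed
    then obtain x where x: "x \<in> E" "f x \<noteq> 0"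
      by blast
    have "f \<in> mpoly_fun"
      using fU U_poly by blast
    then obtain b g where g: "g \<in> mpoly_fun" and fg: "\<And>z. z \<in> E \<Longrightarrow> f z = dot z y ^ b * g z"
      and g0: "\<exists>z\<in>?H. g z \<noteq> 0"
      by (rule mpoly_fun_order[where f = f and x = x, OF E(1) d(1) d1 _ x]) blast
    have "b \<noteq> 0"
    proof
      assume "b = 0"
      then have "g z = 0" if "z \<in> ?H" for z
        using fg[of z] fq[of z] that by (simp add: hyp_def)
      then show False
        using g0 by blast
    qed
    moreover have "b \<noteq> 1"
    proof
      assume b: "b = 1"
      have "g z - q z = 0" if "z \<in> E" for z
      proof (rule mult_dot_cancel[OF E(1) d(1) d1 _ _ that])
        show "(\<lambda>z. g z - q z) \<in> mpoly_fun"
          using subspace_comb2[OF mpoly_fun_subspace g q, of 1 "-1"] by simp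
        show "dot z y * (g z - q z) = 0" if "z \<in> E" for z
          using fg[OF that] fq[OF that] b by (auto simp: right_diff_distrib)
      qed
      then have "g z = 0" if "z \<in> ?H" for z
        using c[OF that] that by (simp add: q_def hyp_def)
      then show False
        using g0 by blast
    qed
    ultimately obtain b' where b': "b = Suc (Suc b')"
      by (metis One_nat_def not0_implies_Suc)
    have "on_set U E (\<lambda>z. dot z y ^ b * g z)"
      unfolding on_set_def using fU fg by blast
    then have pow: "on_set U ?H (\<lambda>z. dot z v ^ Suc (Suc b') * g z)" for v
      unfolding b' by (rule stability[OF E g])
    \<comment> \<open>Polarization frees two of the \<open>b\<close> equal factors: one becomes the
      arbitrary multiplier \<open>v\<close>, the other, \<open>v'\<close>, will run through
      independent linear forms. The remaining \<open>b' = b - 2\<close> stay at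
      \<open>w\<close>.\<close>
    have pol1: "on_set U ?H (\<lambda>z. dot z w ^ Suc b' * (dot z v * g z))" for v w
    proof -
      have "on_set U ?H (\<lambda>z. (dot z w + e * dot z v) ^ Suc (Suc b') * g z)" for e
        using pow[of "w + e *s v"] by (simp only: dot_simps)
      from on_set_power_derivative[OF this] show ?thesis
        by (simp only: mult.assoc)
    qed
    have pol2: "on_set U ?H (\<lambda>z. dot z w ^ b' * dot z v' * (dot z v * g z))" for v v' w
    proof -
      have "on_set U ?H (\<lambda>z. (dot z w + e * dot z v') ^ Suc b' * (dot z v * g z))" for e
        using pol1[of "w + e *s v'" v] by (simp only: dot_simps)
      from on_set_power_derivative[OF this] show ?thesis .
    qed
    obtain l :: "nat \<Rightarrow> _" where l: "l ` {..<vec.dim ?H} \<subseteq> range (\<lambda>v z. dot z v)"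
      and l_ind: "indep l {..<vec.dim ?H} ?H"
      using linear_forms_indep[OF subH] unfolding rank_ge_def by blast
    obtain z1 where z1: "z1 \<in> ?H" "g z1 \<noteq> 0"
      using g0 by blast
    \<comment> \<open>The common factor must not vanish identically on \<open>?H\<close>. The second
      alternative covers dimension 0, where no multipliers have to be produced.\<close>
    have "\<exists>w. \<exists>z\<in>?H. dot z w ^ b' * g z \<noteq> 0 \<or> vec.dim ?H = 0"
    proof (cases "vec.dim ?H = 0")
      case True
      then show ?thesis
        using z1(1) by blast
    next
      case False
      have "\<exists>z2\<in>?H. l 0 z2 \<noteq> 0"
      proof (rule ccontr)
        assume "\<not> (\<exists>z2\<in>?H. l 0 z2 \<noteq> 0)"
        then have "(\<Sum>i<vec.dim ?H. (if i = 0 then 1 else 0) * l i s) = 0" if "s \<in> ?H" for s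
          using that by (intro sum.neutral) auto
        from indepD[OF l_ind this, of 0] False show False
          by simp
      qed
      moreover obtain w where w: "l 0 = (\<lambda>z. dot z w)"
        using l False by blast
      ultimately obtain z2 where "z2 \<in> ?H" "dot z2 w \<noteq> 0"
        by auto
      then obtain z where "z \<in> ?H" "dot z w \<noteq> 0" "g z \<noteq> 0"
        using mpoly_fun_common_nonzero[OF subH mpoly_fun_dot g _ z1(1) _ z1(2)] by blast
      then show ?thesis
        by (intro exI[of _ w] bexI[of _ z]) simp_all
    qed
    then obtain w where w: "vec.dim ?H \<noteq> 0 \<Longrightarrow> \<exists>z\<in>?H. dot z w ^ b' * g z \<noteq> 0"
      by blast
    define \<gamma> where "\<gamma> = (\<lambda>z. dot z w ^ b' * g z)"
    have \<gamma>: "\<gamma> \<in> mpoly_fun"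
      unfolding \<gamma>_def by (intro mpoly_fun.mult mpoly_fun_power mpoly_fun_dot g)
    define m where "m = (\<lambda>i z. l i z * \<gamma> z)"
    have l_poly: "l i \<in> mpoly_fun" if "i < vec.dim ?H" for i
      using l that mpoly_fun_dot by fastforce
    have "m i \<in> mult_part ?H" if i: "i < vec.dim ?H" for i
    proof -
      obtain v' where "l i = (\<lambda>z. dot z v')"
        using l i by blast
      then have "on_set U ?H (\<lambda>z. dot z v * m i z)" for v
        using pol2[of w v' v] by (simp add: m_def \<gamma>_def mult_ac)
      moreover have "m i \<in> mpoly_fun"
        unfolding m_def by (intro mpoly_fun.mult \<gamma> l_poly i)
      ultimately show ?thesis
        by (simp add: mult_part_def)
    qed
    moreover have "indep m {..<vec.dim ?H} ?H"
    proof (rule indepI)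
      fix c i assume c: "\<And>s. s \<in> ?H \<Longrightarrow> (\<Sum>i<vec.dim ?H. c i * m i s) = 0" and i: "i \<in> {..<vec.dim ?H}"
      have "vec.dim ?H \<noteq> 0"
        using i by (metis lessThan_iff not_less_zero)
      then have "\<exists>z\<in>?H. \<gamma> z \<noteq> 0"
        unfolding \<gamma>_def by (rule w)
      then obtain z0 where z0: "z0 \<in> ?H" "\<gamma> z0 \<noteq> 0"
        by blast
      have "(\<Sum>i<vec.dim ?H. c i * l i s) = 0" if s: "s \<in> ?H" for s
      proof (rule ccontr)
        assume ne: "(\<Sum>i<vec.dim ?H. c i * l i s) \<noteq> 0"
        have "(\<lambda>z. \<Sum>i<vec.dim ?H. c i * l i z) \<in> mpoly_fun"
          using l_poly by (intro subspace_lincomb[OF mpoly_fun_subspace]) auto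
        from mpoly_fun_common_nonzero[OF subH this \<gamma> s z0(1) ne z0(2)]
        obtain z where z: "z \<in> ?H" "(\<Sum>i<vec.dim ?H. c i * l i z) \<noteq> 0" "\<gamma> z \<noteq> 0"
          by blast
        have "(\<Sum>i<vec.dim ?H. c i * m i z) = (\<Sum>i<vec.dim ?H. c i * l i z) * \<gamma> z"
          by (simp add: m_def sum_distrib_left mult_ac)
        then show False
          using c[OF z(1)] z by simp
      qed
      then show "c i = 0"
        using indepD[OF l_ind] i by blast
    qed
    ultimately show ?thesis
      by (intro rank_geI[of "{..<vec.dim ?H}" _ m]) auto
  qed
qed

text \<open>The additional 1 comes from \<open>a y\<close>: on \<open>E\<close> it is no combination
  of multipliers, because some \<open>dot z v * a y z\<close> is outside \<open>U\<close>, yet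
  \<open>dot z y * a y z\<close> is \<open>k y\<close> and lies in \<open>U\<close>.\<close>

lemma drop_unsaturated:
  assumes E: "vec.subspace E" "step E y" "\<not> saturated E" and m: "rank_ge (mult_part E) E m"
  shows "U.rk (hyp E y) + Suc m \<le> U.rk E"
proof -
  obtain h :: "nat \<Rightarrow> _" where h: "h ` {..<m} \<subseteq> mult_part E" "indep h {..<m} E"
    using m unfolding rank_ge_def by blast
  obtain d where d: "d \<in> E" "dot d y \<noteq> 0"
    using E(2) unfolding step_def by blast
  obtain v where v: "\<not> on_set U E (\<lambda>z. dot z v * a y z)"
    using E(2,3) unfolding step_def by blast
  define h' where "h' = (\<lambda>i. if i < m then h i else a y)"
  have hm: "h i \<in> mult_part E" if "i < m" for i
    using h(1) that by blast
  have "indep h' {..<m} E"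
    using h(2) indep_cong[of "{..<m}" E h' h] by (simp add: h'_def)
  moreover have "\<exists>s\<in>E. h' m s \<noteq> (\<Sum>j\<in>{..<m}. c j * h' j s)" for c
  proof (rule ccontr)
    assume "\<not> ?thesis"
    then have eq: "a y s = (\<Sum>j\<in>{..<m}. c j * h j s)" if "s \<in> E" for s
      using that by (simp add: h'_def)
    have "on_set U E (\<lambda>z. \<Sum>j\<in>{..<m}. c j * (dot z v * h j z))"
      using hm by (intro on_set_lincomb[OF U.subspace]) (auto simp: mult_part_def)
    moreover have "(\<Sum>j\<in>{..<m}. c j * (dot z v * h j z)) = dot z v * a y z" if "z \<in> E" for z
      using eq[OF that] by (simp add: sum_distrib_left mult_ac)
    ultimately have "on_set U E (\<lambda>z. dot z v * a y z)"
      by (rule on_set_eq)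
    then show False
      using v by blast
  qed
  ultimately have ind: "indep h' {..<Suc m} E"
    unfolding lessThan_Suc by (intro indep_insertI) auto
  have "rank_ge U E (U.rk (hyp E y) + card {..<Suc m})"
  proof (rule rank_ge_add_multiples[OF E(1) d _ _ _ ind])
    show "rank_ge U (hyp E y) (U.rk (hyp E y))"
      by (simp add: U.rank_ge_iff)
    show "h' ` {..<Suc m} \<subseteq> mpoly_fun"
      using hm a_poly by (auto simp: h'_def mult_part_def)
    show "on_set U E (\<lambda>z. dot z y * h' i z)" for i
    proof (cases "i < m")
      case True
      then show ?thesis
        using hm by (simp add: h'_def mult_part_def)
    next
      case False
      have "on_set U E (k y)"
        unfolding on_set_def using k_in_U by blast
      then show ?thesis
        using False by (simp add: h'_def k_def[abs_def])
    qed
  qed simp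
  then show ?thesis
    by (simp add: U.rank_ge_iff)
qed

subsection \<open>Ranks on orthogonal subspaces add up\<close>

text \<open>A rank expressed by points instead of functions, so that it can be followed when one of
  the spanning vectors moves and the points move with it.\<close>

definition points_rank :: "(complex ^ 'n) set \<Rightarrow> nat \<Rightarrow> bool" where
  "points_rank G m \<longleftrightarrow> (\<exists>q :: nat \<Rightarrow> complex ^ 'n. q ` {..<m} \<subseteq> G \<and> indep (\<lambda>i u. u (q i)) {..<m} U)"

lemma points_rank_mono: "points_rank G m \<Longrightarrow> G \<subseteq> H \<Longrightarrow> points_rank H m"
  unfolding points_rank_def by blast

lemma points_rank_line_cofinite:
  "line_cofinite {y. \<exists>Q. finite Q \<and> card Q \<le> c \<and> points_rank (vec.span (insert (cnjv y) (W \<union> Q))) m}"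
  unfolding line_cofinite_def
proof (intro ballI allI)
  fix y v
  assume "y \<in> {y. \<exists>Q. finite Q \<and> card Q \<le> c \<and> points_rank (vec.span (insert (cnjv y) (W \<union> Q))) m}"
  then obtain Q q where Q: "finite Q" "card Q \<le> c"
    and q: "q ` {..<m} \<subseteq> vec.span (insert (cnjv y) (W \<union> Q))" "indep (\<lambda>i u. u (q i)) {..<m} U"
    unfolding points_rank_def by blast
  have "\<exists>b. q i - b *s cnjv y \<in> vec.span (W \<union> Q)" if "i < m" for i
    using q(1) that vec.span_breakdown_eq by blast
  then obtain b where b: "\<And>i. i < m \<Longrightarrow> q i - b i *s cnjv y \<in> vec.span (W \<union> Q)"
    by metis
  \<comment> \<open>Only the component of \<open>q i\<close> along \<open>cnjv y\<close> follows the
    motion. As \<open>cnjv\<close> is antilinear, the exceptional parameters are the conjugates of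
    those of this curve.\<close>
  define p where "p = (\<lambda>e i. q i + e *s (b i *s cnjv v))"
  have "finite {e. \<not> indep (\<lambda>i u. u (p e i)) {..<m} U}"
  proof (rule indep_poly_curve[where u = "\<lambda>e i u. u (p e i)" and ?e0.0 = 0])
    show "poly_fun (\<lambda>e. u (p e i))" if "u \<in> U" for u i
      unfolding p_def using that U_poly by (intro mpoly_fun_line) blast
    show "indep (\<lambda>i u. u (p 0 i)) {..<m} U"
      using q(2) by (simp add: p_def)
  qed simp
  then have "finite (cnj ` {e. \<not> indep (\<lambda>i u. u (p e i)) {..<m} U})"
    by (rule finite_imageI)
  then show "finite {e. y + e *s v \<notin> {y. \<exists>Q. finite Q \<and> card Q \<le> c \<and>
      points_rank (vec.span (insert (cnjv y) (W \<union> Q))) m}}"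
  proof (rule rev_finite_subset, intro subsetI)
    fix e assume e: "e \<in> {e. y + e *s v \<notin> {y. \<exists>Q. finite Q \<and> card Q \<le> c \<and>
      points_rank (vec.span (insert (cnjv y) (W \<union> Q))) m}}"
    have "p (cnj e) i \<in> vec.span (insert (cnjv (y + e *s v)) (W \<union> Q))" if "i < m" for i
    proof -
      have "p (cnj e) i - b i *s cnjv (y + e *s v) = q i - b i *s cnjv y"
        by (simp add: p_def vec_eq_iff algebra_simps)
      then show ?thesis
        using b[OF that] vec.span_breakdown_eq by metis
    qed
    then have "\<not> indep (\<lambda>i u. u (p (cnj e) i)) {..<m} U"
      using e Q unfolding points_rank_def by blast
    then show "e \<in> cnj ` {e. \<not> indep (\<lambda>i u. u (p e i)) {..<m} U}"
      by (intro image_eqI[of _ _ "cnj e"]) auto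
  qed
qed

lemma sub_rank_line_cofinite:
  assumes E: "vec.subspace E"
  shows "line_cofinite {y. (\<exists>d\<in>E. dot d y \<noteq> 0) \<and>
    (\<exists>P. finite P \<and> P \<subseteq> hyp E y \<and> card P \<le> c \<and> rank_ge U (vec.span P) m)}"
  unfolding line_cofinite_def
proof (intro ballI allI)
  fix y v
  assume "y \<in> {y. (\<exists>d\<in>E. dot d y \<noteq> 0) \<and>
    (\<exists>P. finite P \<and> P \<subseteq> hyp E y \<and> card P \<le> c \<and> rank_ge U (vec.span P) m)}"
  then obtain d P where d: "d \<in> E" "dot d y \<noteq> 0" and P: "finite P" "P \<subseteq> hyp E y" "card P \<le> c"
    and r: "rank_ge U (vec.span P) m"
    by blast
  have "vec.span P \<subseteq> hyp E y"
    using P(2) subspace_hyp[OF E] by (rule vec.span_minimal)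
  from rank_ge_tilt[OF vec.subspace_span this E d U_poly r]
  have "finite {e. \<not> rank_ge U (tilt d (y + e *s v) ` vec.span P) m}" .
  moreover have "finite {e. \<not> dot d (y + e *s v) \<noteq> 0}"
    using dot_line_cofinite[OF d(2)] by simp
  ultimately have "finite {e. \<not> (rank_ge U (tilt d (y + e *s v) ` vec.span P) m \<and> dot d (y + e *s v) \<noteq> 0)}"
    by (rule cofinite_conj)
  then show "finite {e. y + e *s v \<notin> {y. (\<exists>d\<in>E. dot d y \<noteq> 0) \<and>
    (\<exists>P. finite P \<and> P \<subseteq> hyp E y \<and> card P \<le> c \<and> rank_ge U (vec.span P) m)}}"
    unfolding mem_Collect_eq
  proof (rule cofinite_mono)
    fix e assume *: "rank_ge U (tilt d (y + e *s v) ` vec.span P) m \<and> dot d (y + e *s v) \<noteq> 0"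
    let ?P = "tilt d (y + e *s v) ` P"
    have "tilt d (y + e *s v) ` vec.span P \<subseteq> vec.span ?P"
      using tilt_span by blast
    then have "rank_ge U (vec.span ?P) m"
      using * rank_ge_mono[of U _ m U _ m] by blast
    moreover have "?P \<subseteq> hyp E (y + e *s v)"
      using tilt_in_hyp[OF E d(1)] P(2) hyp_subset[of E y] by blast
    moreover have "card ?P \<le> c"
      using card_image_le[OF P(1), of "tilt d (y + e *s v)"] P(3) by simp
    ultimately show "(\<exists>d\<in>E. dot d (y + e *s v) \<noteq> 0) \<and>
      (\<exists>P. finite P \<and> P \<subseteq> hyp E (y + e *s v) \<and> card P \<le> c \<and> rank_ge U (vec.span P) m)"
      using * d(1) P(1) by blast
  qed
qed

text \<open>Each round trades a vector of \<open>Q\<close> for the conjugate of the normal of a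
  hyperplane into which \<open>P\<close> can be moved; one generic \<open>y\<close> permits both.
  The dimension count guarantees that \<open>P\<close> does not span \<open>E\<close>, so a
  hyperplane containing it exists. When \<open>Q\<close> is used up, what spans the second space is
  orthogonal to the first.\<close>

lemma orthogonal_pair:
  assumes "vec.subspace E" "finite P" "P \<subseteq> E" "card P + c \<le> vec.dim E" "rank_ge U (vec.span P) m1"
    and "finite Q" "card Q \<le> c" "points_rank (vec.span (W \<union> Q)) m2"
    and "\<And>w z. w \<in> W \<Longrightarrow> z \<in> E \<Longrightarrow> dot z (cnjv w) = 0"
  shows "\<exists>E' W'. rank_ge U E' m1 \<and> points_rank (vec.span W') m2 \<and>
    (\<forall>w\<in>W'. \<forall>z\<in>E'. dot z (cnjv w) = 0)"
  using assms
proof (induction c arbitrary: E P Q W)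
  case 0
  then have "Q = {}"
    by simp
  moreover have "vec.span P \<subseteq> E"
    using "0.prems" by (intro vec.span_minimal)
  ultimately have "rank_ge U E m1" "points_rank (vec.span W) m2"
    using "0.prems" rank_ge_mono[of U "vec.span P" m1 U E m1] by auto
  then show ?case
    using "0.prems"(9) by blast
next
  case (Suc c)
  note E = Suc.prems(1)
  define G1 where "G1 = {y. (\<exists>d\<in>E. dot d y \<noteq> 0) \<and>
    (\<exists>P'. finite P' \<and> P' \<subseteq> hyp E y \<and> card P' \<le> card P \<and> rank_ge U (vec.span P') m1)}"
  define G2 where "G2 = {y. \<exists>Q. finite Q \<and> card Q \<le> c \<and>
    points_rank (vec.span (insert (cnjv y) (W \<union> Q))) m2}"
  have lc1: "line_cofinite G1"
    unfolding G1_def by (rule sub_rank_line_cofinite[OF E])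
  have lc2: "line_cofinite G2"
    unfolding G2_def by (rule points_rank_line_cofinite)
  have "\<not> E \<subseteq> vec.span P"
    using vec.dim_le_card[of E P] Suc.prems(2,4) by auto
  then obtain d where d: "d \<in> E" "d \<notin> vec.span P"
    by blast
  obtain y1 where y1: "\<And>p. p \<in> P \<Longrightarrow> dot p y1 = 0" "dot d y1 \<noteq> 0"
    using span_separate[OF Suc.prems(2) d(2)] by blast
  have "P \<subseteq> hyp E y1"
    using Suc.prems(3) y1(1) by (auto simp: hyp_def)
  then have "y1 \<in> G1"
    unfolding G1_def using d(1) y1(2) Suc.prems(2,5) by blast
  moreover have "\<exists>y. y \<in> G2"
  proof (cases "Q = {}")
    case True
    have "points_rank (vec.span (insert (cnjv 0) (W \<union> {}))) m2"
      by (rule points_rank_mono[OF Suc.prems(8)]) (intro vec.span_mono, use True in auto)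
    moreover have "finite {}" "card {} \<le> c"
      by simp_all
    ultimately show ?thesis
      unfolding G2_def by blast
  next
    case False
    then obtain q where q: "q \<in> Q"
      by blast
    have "insert (cnjv (cnjv q)) (W \<union> (Q - {q})) = W \<union> Q"
      using q by auto
    then have "points_rank (vec.span (insert (cnjv (cnjv q)) (W \<union> (Q - {q})))) m2"
      using Suc.prems(8) by (simp only:)
    moreover have "card (Q - {q}) \<le> c" "finite (Q - {q})"
      using q Suc.prems(6,7) by simp_all
    ultimately show ?thesis
      unfolding G2_def by blast
  qed
  ultimately obtain y where y: "y \<in> G1 \<inter> G2"
    using line_cofinite_ex[OF lc1 lc2] by blast
  then obtain d' P' where d': "d' \<in> E" "dot d' y \<noteq> 0" and P': "finite P'" "P' \<subseteq> hyp E y"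
    "card P' \<le> card P" "rank_ge U (vec.span P') m1"
    unfolding G1_def by blast
  obtain Q' where Q': "finite Q'" "card Q' \<le> c" "points_rank (vec.span (insert (cnjv y) W \<union> Q')) m2"
    using y unfolding G2_def by auto
  show ?case
  proof (rule Suc.IH[OF subspace_hyp[OF E, of y] P'(1,2) _ P'(4) Q'])
    show "card P' + c \<le> vec.dim (hyp E y)"
      using dim_hyp[OF E d'] P'(3) Suc.prems(4) by simp
    show "dot z (cnjv w) = 0" if "w \<in> insert (cnjv y) W" "z \<in> hyp E y" for w z
      using that Suc.prems(9) by (auto simp: hyp_def)
  qed
qed

lemma rank_orthogonal_sum:
  assumes E': "rank_ge U E' m1" and W': "points_rank (vec.span W') m2"
    and orth: "\<And>w z. w \<in> W' \<Longrightarrow> z \<in> E' \<Longrightarrow> dot z (cnjv w) = 0"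
  shows "rank_ge U UNIV (m1 + m2)"
proof -
  obtain p where p: "p ` {..<m1} \<subseteq> E'" "indep (\<lambda>i u. u (p i)) {..<m1} U"
    using rank_ge_imp_indep_points[OF U.subspace E'] by blast
  obtain q where q: "q ` {..<m2} \<subseteq> vec.span W'" "indep (\<lambda>i u. u (q i)) {..<m2} U"
    using W' unfolding points_rank_def by blast
  define B where "B = (\<lambda>z w. A z w * dot z (cnjv w))"
  have B_gram: "B z w = (\<Sum>\<mu><N. F \<mu> z * cnj (F \<mu> w))" for z w
    unfolding B_def by (rule gram)
  have B_k: "B z w = k (cnjv w) z" for z w
    by (simp add: B_def k_def a_def)
  have B0: "B (p i) (q j) = 0" if "i < m1" "j < m2" for i j
  proof -
    have "q j \<in> vec.span W'"
      using q(1) that by blast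
    then have "dot (p i) (cnjv (q j)) = 0"
    proof (induction rule: vec.span_induct_alt)
      case base
      show ?case
        by (simp add: dot_def)
    next
      case (step c x z)
      have "cnjv (c *s x + z) = cnj c *s cnjv x + cnjv z"
        by (simp add: vec_eq_iff)
      then show ?case
        using step orth[OF step.hyps, of "p i"] p(1) that by (auto simp: dot_simps)
    qed
    then show ?thesis
      by (simp add: B_def)
  qed
  have indep_q0: "c j = 0"
    if k0: "\<And>y. (\<Sum>j<m. c j * k y (s j)) = 0" and ind: "indep (\<lambda>i u. u (s i)) {..<m} U" and j: "j < m"
    for c s m j
  proof -
    have ev: "(\<lambda>f. \<Sum>j<m. c j * f (s j)) \<in> evals"
      by (rule sum_in_evals)
    have "(\<Sum>j<m. c j * u (s j)) = 0" if "u \<in> U" for u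
      using evals_zero_on_span[OF ev, of "range k" u] that k0 unfolding U_def by blast
    then show ?thesis
      using indepD[OF ind] j by blast
  qed
  let ?e = "case_sum (\<lambda>i u. u (p i)) (\<lambda>i u. u (q i)) :: nat + nat \<Rightarrow> (complex ^ 'n \<Rightarrow> complex) \<Rightarrow> complex"
  have "indep ?e ({..<m1} <+> {..<m2}) U"
  proof (rule indepI)
    fix c x
    assume c: "\<And>u. u \<in> U \<Longrightarrow> (\<Sum>x\<in>{..<m1} <+> {..<m2}. c x * ?e x u) = 0" and x: "x \<in> {..<m1} <+> {..<m2}"
    \<comment> \<open>The Gram map sends a point \<open>z\<close> to the vector of all
      \<open>F \<mu> z\<close>. A relation gives two image vectors \<open>v\<close> and
      \<open>v'\<close> that are orthogonal to each other, while their sum is orthogonal to every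
      image; both are therefore zero, and each half of the relation is trivial.\<close>
    define v where "v = (\<lambda>\<mu>. \<Sum>i<m1. c (Inl i) * F \<mu> (p i))"
    define v' where "v' = (\<lambda>\<mu>. \<Sum>i<m2. c (Inr i) * F \<mu> (q i))"
    have left: "(\<Sum>i<m1. c (Inl i) * B (p i) w) = (\<Sum>\<mu><N. v \<mu> * cnj (F \<mu> w))" for w
      unfolding B_gram v_def sum_distrib_left sum_distrib_right
      by (subst sum.swap) (simp add: mult_ac)
    have right: "(\<Sum>i<m2. c (Inr i) * B (q i) w) = (\<Sum>\<mu><N. v' \<mu> * cnj (F \<mu> w))" for w
      unfolding B_gram v'_def sum_distrib_left sum_distrib_right
      by (subst sum.swap) (simp add: mult_ac)
    have sum0: "(\<Sum>\<mu><N. (v \<mu> + v' \<mu>) * cnj (F \<mu> w)) = 0" for w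
      using c[OF k_in_U[of "cnjv w"]]
      by (simp add: sum.Plus B_k[symmetric] left right distrib_right sum.distrib)
    have vv: "(\<Sum>\<mu><N. (v \<mu> + v' \<mu>) * cnj (v \<mu>)) = 0"
    proof -
      have "(\<Sum>\<mu><N. (v \<mu> + v' \<mu>) * cnj (v \<mu>)) =
          (\<Sum>\<mu><N. \<Sum>i<m1. cnj (c (Inl i)) * ((v \<mu> + v' \<mu>) * cnj (F \<mu> (p i))))"
        by (subst (2) v_def) (simp add: sum_distrib_left mult_ac)
      also have "\<dots> = (\<Sum>i<m1. cnj (c (Inl i)) * (\<Sum>\<mu><N. (v \<mu> + v' \<mu>) * cnj (F \<mu> (p i))))"
        by (subst sum.swap) (simp add: sum_distrib_left)
      finally show ?thesis
        by (simp add: sum0)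
    qed
    have vv': "(\<Sum>\<mu><N. (v \<mu> + v' \<mu>) * cnj (v' \<mu>)) = 0"
    proof -
      have "(\<Sum>\<mu><N. (v \<mu> + v' \<mu>) * cnj (v' \<mu>)) =
          (\<Sum>\<mu><N. \<Sum>i<m2. cnj (c (Inr i)) * ((v \<mu> + v' \<mu>) * cnj (F \<mu> (q i))))"
        by (subst (2) v'_def) (simp add: sum_distrib_left mult_ac)
      also have "\<dots> = (\<Sum>i<m2. cnj (c (Inr i)) * (\<Sum>\<mu><N. (v \<mu> + v' \<mu>) * cnj (F \<mu> (q i))))"
        by (subst sum.swap) (simp add: sum_distrib_left)
      finally show ?thesis
        by (simp add: sum0)
    qed
    have cross: "(\<Sum>\<mu><N. v \<mu> * cnj (v' \<mu>)) = 0"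
    proof -
      have "(\<Sum>\<mu><N. v \<mu> * cnj (v' \<mu>)) = (\<Sum>\<mu><N. \<Sum>j<m2. cnj (c (Inr j)) * (v \<mu> * cnj (F \<mu> (q j))))"
        by (simp add: v'_def sum_distrib_left mult_ac)
      also have "\<dots> = (\<Sum>j<m2. cnj (c (Inr j)) * (\<Sum>\<mu><N. v \<mu> * cnj (F \<mu> (q j))))"
        by (subst sum.swap) (simp add: sum_distrib_left)
      also have "\<dots> = 0"
        by (simp add: left[symmetric] B0)
      finally show ?thesis .
    qed
    have cross': "(\<Sum>\<mu><N. v' \<mu> * cnj (v \<mu>)) = 0"
      using arg_cong[OF cross, of cnj] by (simp add: mult.commute)
    have norm0: "f \<mu> = 0" if "(\<Sum>\<mu><N. f \<mu> * cnj (f \<mu>)) = 0" "\<mu> < N" for f :: "nat \<Rightarrow> complex" and \<mu>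
    proof -
      have "complex_of_real (\<Sum>\<mu><N. (cmod (f \<mu>))\<^sup>2) = 0"
        using that(1) by (simp add: complex_norm_square del: of_real_power)
      then have "(\<Sum>\<mu><N. (cmod (f \<mu>))\<^sup>2) = 0"
        using of_real_eq_0_iff by blast
      then show ?thesis
        using that(2) by (subst (asm) sum_nonneg_eq_0_iff) auto
    qed
    have "(\<Sum>\<mu><N. v \<mu> * cnj (v \<mu>)) = 0" "(\<Sum>\<mu><N. v' \<mu> * cnj (v' \<mu>)) = 0"
      using vv vv' cross cross' by (simp_all add: distrib_right sum.distrib)
    then have v0: "v \<mu> = 0" "v' \<mu> = 0" if "\<mu> < N" for \<mu>
      using norm0[of v \<mu>] norm0[of v' \<mu>] that by blast+
    have k0: "(\<Sum>i<m1. c (Inl i) * k y (p i)) = 0" "(\<Sum>i<m2. c (Inr i) * k y (q i)) = 0" for y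
      using left[of "cnjv y"] right[of "cnjv y"] v0 by (simp_all add: B_k)
    have "c (Inl i) = 0" if "i < m1" for i
      by (rule indep_q0[OF k0(1) p(2) that])
    moreover have "c (Inr i) = 0" if "i < m2" for i
      by (rule indep_q0[OF k0(2) q(2) that])
    ultimately show "c x = 0"
      using x by auto
  qed
  then have "indep (\<lambda>x u. u (case_sum p q x)) ({..<m1} <+> {..<m2}) U"
    using indep_cong[of "{..<m1} <+> {..<m2}" U ?e "\<lambda>x u. u (case_sum p q x)"] by (auto split: sum.splits)
  then have "rank_ge U UNIV (card ({..<m1} <+> {..<m2}))"
    by (intro rank_ge_of_indep_points[OF U.subspace]) auto
  then show ?thesis
    by (simp add: card_Plus)
qed

lemma rank_sum_le:
  assumes E: "vec.subspace E" and G: "vec.subspace G" and dims: "vec.dim E + vec.dim G \<le> CARD('n)"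
  shows "U.rk E + U.rk G \<le> U.rk UNIV"
proof -
  obtain P where P: "P \<subseteq> E" "vec.independent P" "E \<subseteq> vec.span P" "card P = vec.dim E"
    using vec.basis_exists[of E] by metis
  obtain Q where Q: "Q \<subseteq> G" "vec.independent Q" "G \<subseteq> vec.span Q" "card Q = vec.dim G"
    using vec.basis_exists[of G] by metis
  have fin: "finite P" "finite Q"
    using P(2) Q(2) by (auto intro: vec.finiteI_independent)
  have "rank_ge U (vec.span P) (U.rk E)"
    using rank_ge_mono[of U E "U.rk E" U "vec.span P" "U.rk E"] P(3) by (simp add: U.rank_ge_iff)
  moreover have "points_rank (vec.span ({} \<union> Q)) (U.rk G)"
  proof -
    have "rank_ge U G (U.rk G)"
      by (simp add: U.rank_ge_iff)
    then obtain q :: "nat \<Rightarrow> complex ^ 'n" where "q ` {..<U.rk G} \<subseteq> G" "indep (\<lambda>i u. u (q i)) {..<U.rk G} U"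
      by (rule rank_ge_imp_indep_points[OF U.subspace])
    then show ?thesis
      unfolding points_rank_def using Q(3) by (intro exI[of _ q]) auto
  qed
  moreover have "card P + card Q \<le> vec.dim (UNIV :: (complex ^ 'n) set)"
    unfolding vec_dim_card using P(4) Q(4) dims by simp
  ultimately obtain E' W' where "rank_ge U E' (U.rk E)" "points_rank (vec.span W') (U.rk G)"
    "\<forall>w\<in>W'. \<forall>z\<in>E'. dot z (cnjv w) = 0"
    using orthogonal_pair[of UNIV P "card Q" "U.rk E" Q "{}" "U.rk G"] fin vec.subspace_UNIV by auto
  then have "rank_ge U UNIV (U.rk E + U.rk G)"
    by (intro rank_orthogonal_sum) auto
  then show ?thesis
    by (simp add: U.rank_ge_iff)
qed

end

subsection \<open>Arithmetic\<close>

lemma two_times_choose_two: "2 * (m choose 2) = m * (m - 1)"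
  by (cases m) (simp_all add: choose_two)

text \<open>The sum is at least (n - 1) t - (t - 2)(t - 3) / 2, the subtracted term collecting the
  deficits t - j - 1. So n is at most t + (t - 2)(t - 3) / 2, which for t \<ge> 3 does not exceed t
  (t - 1) / 2; with t \<le> \<kappa> this contradicts the lower bound on n.\<close>

lemma min_sum_bound:
  fixes n t \<kappa> :: nat
  assumes "(\<Sum>j=2..n. min t (Suc j)) \<le> n * (t - 1)" "3 \<le> t" "\<kappa> choose 2 < n"
  shows "\<kappa> < t"
proof (rule ccontr)
  assume "\<not> \<kappa> < t"
  then have t: "t \<le> \<kappa>"
    by simp
  have A: "(\<Sum>j=2..Suc m. min t (Suc j)) + (\<Sum>j=2..Suc m. t - Suc j) = m * t" for m
    by (induction m) (auto simp: min_def)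
  have D: "2 * (\<Sum>j=2..Suc m. t - Suc j) + (t - m - 2) * (t - m - 3) \<le> (t - 2) * (t - 3)" for m
  proof (induction m)
    case (Suc m)
    have "2 * (t - Suc (Suc (Suc m))) + (t - Suc m - 2) * (t - Suc m - 3) \<le> (t - m - 2) * (t - m - 3)"
    proof (cases "t - m - 3")
      case 0
      then show ?thesis by simp
    next
      case (Suc x)
      then have "t = m + x + 4"
        by simp
      then show ?thesis
        by (simp add: algebra_simps)
    qed
    then show ?case
      using Suc.IH by simp
  qed simp
  obtain m where m: "n = Suc m"
    using assms(3) by (cases n) auto
  obtain s where s: "t = s + 3"
    using assms(2) by (metis add.commute le_Suc_ex)
  have "m * t \<le> n * (t - 1) + (\<Sum>j=2..Suc m. t - Suc j)"
    using A[of m] assms(1) by (simp add: m)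
  moreover have "2 * (\<Sum>j=2..Suc m. t - Suc j) \<le> (t - 2) * (t - 3)"
    using D[of m] by simp
  ultimately have "2 * (m * t) \<le> 2 * (n * (t - 1)) + (t - 2) * (t - 3)"
    by linarith
  then have "2 * n \<le> t * (t - 1)"
    by (simp add: m s algebra_simps)
  also have "\<dots> \<le> \<kappa> * (\<kappa> - 1)"
    using t by (intro mult_le_mono) auto
  also have "\<dots> = 2 * (\<kappa> choose 2)"
    by (rule two_times_choose_two[symmetric])
  finally show False
    using assms(3) by simp
qed

text \<open>For \<open>2 \<kappa> \<le> n\<close> the bound comes from the split \<open>\<kappa> + (n - \<kappa>)\<close>; only
  \<open>n = 3, 4, 5, 7\<close> remain.\<close>

lemma rank_bound_arith:
  fixes r :: "nat \<Rightarrow> nat" and n t \<kappa> :: nat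
  assumes n: "3 \<le> n" "\<kappa> choose 2 < n" "n \<le> (\<kappa> + 1) choose 2" and t: "\<kappa> < t"
    and r1: "1 \<le> r 1"
    and drop: "\<And>j. 2 \<le> j \<Longrightarrow> j \<le> n \<Longrightarrow> r (j - 1) + min t (Suc j) \<le> r j \<or>
      r (j - 1) + Suc (if j = n then 0 else min (r (Suc j) - r j) j) \<le> r j"
    and split: "\<And>a b. 1 \<le> a \<Longrightarrow> 1 \<le> b \<Longrightarrow> a + b = n \<Longrightarrow> r a + r b \<le> r n"
  shows "n * \<kappa> \<le> r n + (\<kappa> choose 2) + 1"
proof -
  have c2: "2 * (\<kappa> choose 2) = \<kappa> * (\<kappa> - 1)"
    by (rule two_times_choose_two)
  have \<kappa>2: "2 \<le> \<kappa>"
  proof (rule ccontr)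
    assume "\<not> 2 \<le> \<kappa>"
    then consider "\<kappa> = 0" | "\<kappa> = 1"
      by linarith
    then have "(\<kappa> + 1) choose 2 \<le> 1"
      by cases (simp_all add: choose_two)
    with n(1,3) show False
      by linarith
  qed
  \<comment> \<open>Here \<open>n - i\<close> is the dimension, so the induction descends the flag.
    The top drop is at least 1; below it, an unsaturated drop exceeds the previous one, capped by
    the dimension, by 1, and a saturated one is at least \<open>min t (Suc j)\<close>.\<close>
  have low: "r (n - i - 1) + min (Suc i) (min (n - i + 1) (\<kappa> + 1)) \<le> r (n - i)" if "i + 2 \<le> n" for i
    using that
  proof (induction i)
    case 0
    then show ?case
      using drop[of n] t by (auto simp: min_def split: if_splits)
  next
    case (Suc i)
    define j where "j = n - Suc i"
    have j: "2 \<le> j" "j < n" "Suc j = n - i" "n - i - 1 = j" "n - Suc i - 1 = j - 1" "n - Suc i = j"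
      using Suc.prems by (auto simp: j_def)
    have "r j + min (Suc i) (min (j + 2) (\<kappa> + 1)) \<le> r (Suc j)"
      using Suc.IH Suc.prems j(4) j(3)[symmetric] by simp
    then have "min (Suc i) (min (j + 2) (\<kappa> + 1)) \<le> r (Suc j) - r j"
      by linarith
    then have "min (Suc (Suc i)) (min (j + 1) (\<kappa> + 1)) \<le> Suc (min (r (Suc j) - r j) j)"
      by linarith
    moreover have "min (Suc (Suc i)) (min (j + 1) (\<kappa> + 1)) \<le> min t (Suc j)"
      using t by linarith
    moreover have "r (j - 1) + min t (Suc j) \<le> r j \<or> r (j - 1) + Suc (min (r (Suc j) - r j) j) \<le> r j"
      using drop[of j] j(1,2) by simp
    ultimately have "r (j - 1) + min (Suc (Suc i)) (min (j + 1) (\<kappa> + 1)) \<le> r j"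
      by linarith
    then show ?case
      unfolding j(5,6) .
  qed
  have g: "r (j - 1) + min (n - j + 1) (min (j + 1) (\<kappa> + 1)) \<le> r j" if "2 \<le> j" "j \<le> n" for j
    using low[of "n - j"] that by simp
  show ?thesis
  proof (cases "2 * \<kappa> \<le> n")
    case True
    define m where "m = n - 2 * \<kappa>"
    have m: "n = 2 * \<kappa> + m"
      using True by (simp add: m_def)
    \<comment> \<open>Up to \<kappa> the drop in dimension j is at least j + 1, so r is at least 1 +
      3 + 4 + ... . This is a triangular number minus 2, doubled here to avoid division; hence the
      4.\<close>
    have up: "(i + 2) * (i + 3) \<le> 2 * r (Suc i) + 4" if "Suc i \<le> \<kappa>" for i
      using that
    proof (induction i)
      case 0
      then show ?case
        using r1 by simp
    next
      case (Suc i)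
      have "r (Suc i) + (i + 3) \<le> r (Suc (Suc i))"
        using g[of "Suc (Suc i)"] Suc.prems m by (simp add: min_def split: if_splits)
      then have h: "2 * r (Suc i) + 4 + 2 * (i + 3) \<le> 2 * r (Suc (Suc i)) + 4"
        by simp
      have "(i + 2) * (i + 3) + 2 * (i + 3) \<le> 2 * r (Suc i) + 4 + 2 * (i + 3)"
        using Suc by (intro add_right_mono) simp
      then have "(i + 2) * (i + 3) + 2 * (i + 3) \<le> 2 * r (Suc (Suc i)) + 4"
        using h by (rule order.trans)
      moreover have "(Suc i + 2) * (Suc i + 3) = (i + 2) * (i + 3) + 2 * (i + 3)"
        by (simp add: algebra_simps)
      ultimately show ?case
        by (simp only:)
    qed
    \<comment> \<open>From \<kappa> to n - \<kappa> the other two terms of the minimum are at least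
      \<kappa> + 1, so every drop is.\<close>
    have flat: "r \<kappa> + i * (\<kappa> + 1) \<le> r (\<kappa> + i)" if "i \<le> m" for i
      using that
    proof (induction i)
      case (Suc i)
      have "min (n - (\<kappa> + Suc i) + 1) (min (\<kappa> + Suc i + 1) (\<kappa> + 1)) = \<kappa> + 1"
        using Suc.prems m by linarith
      then have "r (\<kappa> + i) + (\<kappa> + 1) \<le> r (\<kappa> + Suc i)"
        using g[of "\<kappa> + Suc i"] Suc.prems \<kappa>2 m by simp
      then show ?case
        using Suc by simp
    qed simp
    obtain s where s: "\<kappa> = Suc s"
      using \<kappa>2 by (cases \<kappa>) auto
    have "(\<kappa> + 1) * (\<kappa> + 2) \<le> 2 * r \<kappa> + 4"
      using up[of s] by (simp add: s algebra_simps)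
    moreover have "r \<kappa> + m * (\<kappa> + 1) \<le> r (\<kappa> + m)"
      by (rule flat) simp
    moreover have "r \<kappa> + r (\<kappa> + m) \<le> r n"
      using split[of \<kappa> "\<kappa> + m"] \<kappa>2 m by simp
    ultimately have "(\<kappa> + 1) * (\<kappa> + 2) + m * (\<kappa> + 1) \<le> r n + 4"
      by linarith
    \<comment> \<open>The second use of the lower bound on n; it supplies exactly what the sum of
      the two ranks lacks.\<close>
    moreover have "(\<kappa> choose 2) + 1 \<le> 2 * \<kappa> + m"
      using n(2) m by simp
    moreover have "\<kappa> * \<kappa> = 2 * (\<kappa> choose 2) + \<kappa>"
      unfolding c2 by (simp add: s)
    moreover have "n * \<kappa> = 2 * (\<kappa> * \<kappa>) + m * \<kappa>"
      by (simp add: m algebra_simps)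
    moreover have "(\<kappa> + 1) * (\<kappa> + 2) = \<kappa> * \<kappa> + 3 * \<kappa> + 2" "m * (\<kappa> + 1) = m * \<kappa> + m"
      by (simp_all add: algebra_simps)
    ultimately show ?thesis
      by linarith
  next
    case False
    have "\<kappa> \<le> 4"
    proof (rule ccontr)
      assume "\<not> \<kappa> \<le> 4"
      then have "\<kappa> * 4 \<le> \<kappa> * (\<kappa> - 1)"
        by (intro mult_le_mono) auto
      then show False
        using c2 n(2) False by linarith
    qed
    then consider "\<kappa> = 2" | "\<kappa> = 3" | "\<kappa> = 4"
      using \<kappa>2 by linarith
    then show ?thesis
    proof cases
      case 1
      then have n3: "n = 3"
        using n by (simp add: choose_two)
      show ?thesis
        using g[of 2] split[of 1 2] r1 by (simp add: 1 n3 choose_two)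
    next
      case 2
      then have "n = 4 \<or> n = 5"
        using n False by (auto simp: choose_two)
      then show ?thesis
      proof
        assume n4: "n = 4"
        show ?thesis
          using g[of 2] split[of 2 2] r1 by (simp add: 2 n4 choose_two)
      next
        assume n5: "n = 5"
        show ?thesis
          using g[of 2] g[of 3] split[of 2 3] r1 by (simp add: 2 n5 choose_two)
      qed
    next
      case 3
      then have n7: "n = 7"
        using n False by (auto simp: choose_two)
      have g234: "r 1 + 3 \<le> r 2" "r 2 + 4 \<le> r 3" "r 3 + 4 \<le> r 4"
        using g[of 2] g[of 3] g[of 4] by (simp_all add: 3 n7)
      have r34: "r 3 + r 4 \<le> r 7"
        using split[of 3 4] by (simp add: n7)
      have t5: "5 \<le> t"
        using t 3 by simp
      \<comment> \<open>The drops give only 8 + 12 = 20. A drop of 5 at dimension 4 would suffice;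
        if it is smaller, the saturated alternative is excluded there and, successively, at 5 and 6,
        so the drops above are at most 3, 2 and 1. Then r 7 \<le> r 4 + 6, against r 3 \<ge>
        8.\<close>
      have "21 \<le> r 7"
      proof (cases "r 3 + 5 \<le> r 4")
        case True
        then show ?thesis
          using g234 r34 r1 by linarith
      next
        case False
        have 5: "r 5 \<le> r 4 + 3"
          using drop[of 4] False t5 by (auto simp: n7 min_def split: if_splits)
        have 6: "r 6 \<le> r 5 + 2"
          using drop[of 5] 5 t5 by (auto simp: n7 min_def split: if_splits)
        have "r 7 \<le> r 6 + 1"
          using drop[of 6] 6 t5 by (auto simp: n7 min_def split: if_splits)
        then show ?thesis
          using 5 6 r34 g234 r1 by linarith
      qed
      then show ?thesis
        by (simp add: 3 n7 choose_two)
    qed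
  qed
qed

subsection \<open>The rank bound for kernels\<close>

context sos_kernel
begin

lemma t_lower_bound:
  assumes "\<kappa> choose 2 < CARD('n)"
  shows "\<kappa> < t"
proof -
  obtain E :: "nat \<Rightarrow> (complex ^ 'n) set" and Y where En: "E CARD('n) = UNIV"
    and sub: "\<And>j. 1 \<le> j \<Longrightarrow> j \<le> CARD('n) \<Longrightarrow> vec.subspace (E j) \<and> vec.dim (E j) = j"
    and flag: "\<And>j. 2 \<le> j \<Longrightarrow> j \<le> CARD('n) \<Longrightarrow>
       good (E j) (min t (Suc j)) \<and> step (E j) (Y j) \<and> E (j - 1) = hyp (E j) (Y j)"
    using flag_ex by blast
  obtain T' where T': "finite T'" "card T' \<le> CARD('n) * (t - 1)"
    and mult: "\<And>x i. x \<in> X \<Longrightarrow> (\<lambda>z. z $ i * x z) \<in> cfun.span T'"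
    using shift_span_X by blast
  let ?Z = "cfun.span T'"
  have "rank_ge ?Z (E (Suc m)) (\<Sum>j=2..Suc m. min t (Suc j))" if "Suc m \<le> CARD('n)" for m
    using that
  proof (induction m)
    case 0
    show ?case
      by simp
  next
    case (Suc m)
    define j where "j = Suc (Suc m)"
    have j: "2 \<le> j" "j \<le> CARD('n)" "j - 1 = Suc m"
      using Suc.prems by (auto simp: j_def)
    have fl: "good (E j) (min t (Suc j))" "step (E j) (Y j)" "E (Suc m) = hyp (E j) (Y j)"
      using flag[OF j(1,2)] j(3) by auto
    have subE: "vec.subspace (E j)"
      using sub[of j] j by simp
    obtain d where d: "d \<in> E j" "dot d (Y j) \<noteq> 0"
      using fl(2) unfolding step_def by blast
    obtain x :: "nat \<Rightarrow> _" where x: "x ` {..<min t (Suc j)} \<subseteq> X" "indep x {..<min t (Suc j)} (E j)"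
      using good_rank[OF fl(1)] unfolding rank_ge_def by blast
    have "rank_ge ?Z (E j) ((\<Sum>j=2..Suc m. min t (Suc j)) + card {..<min t (Suc j)})"
    proof (rule rank_ge_add_multiples[OF subE d _ _ _ x(2)])
      show "rank_ge ?Z (hyp (E j) (Y j)) (\<Sum>j=2..Suc m. min t (Suc j))"
        using Suc fl(3) by simp
      show "x ` {..<min t (Suc j)} \<subseteq> mpoly_fun"
        using x(1) X_poly by blast
      show "on_set ?Z (E j) (\<lambda>z. dot z (Y j) * x i z)" if "i \<in> {..<min t (Suc j)}" for i
      proof -
        have "x i \<in> X"
          using x(1) that by blast
        then have "(\<lambda>z. \<Sum>l\<in>UNIV. Y j $ l * (z $ l * x i z)) \<in> ?Z"
          by (intro subspace_lincomb[OF cfun.subspace_span] mult)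
        then show ?thesis
          unfolding on_set_def by (rule rev_bexI) (simp add: dot_def sum_distrib_left mult_ac)
      qed
    qed simp
    then show ?case
      by (simp add: j_def)
  qed
  from this[of "CARD('n) - 1"] have "rank_ge ?Z UNIV (\<Sum>j=2..CARD('n). min t (Suc j))"
    by (simp add: En)
  then have "(\<Sum>j=2..CARD('n). min t (Suc j)) \<le> card T'"
    by (rule bounded_rank.bound[OF bounded_rank_span[OF T'(1)]])
  then show ?thesis
    using min_sum_bound[OF _ three_le_t assms] T'(2) by simp
qed

text \<open>Some \<open>k y2\<close> is nonzero at a point \<open>z\<close> of the plane, so the
  line through \<open>z\<close> has positive rank, and the chosen line has maximal rank among all
  lines of the plane. The point exists since evaluation at \<open>p 0\<close> is nonzero on
  \<open>X\<close> and nonvanishing polynomials have a common nonzero.\<close>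

lemma rank_line_positive:
  assumes E: "vec.subspace E" "step E y" and dim: "vec.dim E = 2" and good: "good E m"
  shows "1 \<le> U.rk (hyp E y)"
proof -
  obtain p where p: "p ` {..<m} \<subseteq> E" "indep (\<lambda>i x. x (p i)) {..<m} X" "3 \<le> m"
    using good unfolding good_def by blast
  have "\<exists>y. a y (p 0) \<noteq> 0"
  proof (rule ccontr)
    assume no: "\<not> (\<exists>y. a y (p 0) \<noteq> 0)"
    have "x (p 0) = 0" if "x \<in> X" for x
      using evals_zero_on_span[OF eval_in_evals[of "p 0"], of "range a" x] that no unfolding X_def by blast
    then have "(\<Sum>i<m. (if i = 0 then 1 else 0) * x (p i)) = 0" if "x \<in> X" for x
      using that by (intro sum.neutral) auto
    from indepD[OF p(2) this, of 0] p(3) show False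
      by simp
  qed
  then obtain y1 where y1: "a y1 (p 0) \<noteq> 0"
    by blast
  obtain d where d: "d \<in> E" "dot d y \<noteq> 0"
    using E(2) unfolding step_def by blast
  have "finite {e. a (y1 + e *s (y - y1)) (p 0) = 0}"
    by (rule poly_fun_finite_zeros[OF mpoly_fun_line[OF a_poly_param, of y1 "y - y1" "p 0"], of 0])
      (use y1 in simp)
  moreover have "finite {e. dot d (y1 + e *s (y - y1)) = 0}"
  proof (rule poly_fun_finite_zeros)
    show "poly_fun (\<lambda>e. dot d (y1 + e *s (y - y1)))"
      unfolding dot_simps by (intro poly_fun_intros poly_fun_const poly_fun_id)
    show "dot d (y1 + 1 *s (y - y1)) \<noteq> 0"
      using d(2) by simp
  qed
  ultimately obtain e where e: "a (y1 + e *s (y - y1)) (p 0) \<noteq> 0" "dot d (y1 + e *s (y - y1)) \<noteq> 0"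
    using cofinite_ex[OF cofinite_conj, of "\<lambda>e. a (y1 + e *s (y - y1)) (p 0) \<noteq> 0"
        "\<lambda>e. dot d (y1 + e *s (y - y1)) \<noteq> 0"] by auto
  define y2 where "y2 = y1 + e *s (y - y1)"
  have "p 0 \<in> E"
    using p by auto
  then obtain z where z: "z \<in> E" "a y2 z \<noteq> 0" "dot z y2 \<noteq> 0"
    using mpoly_fun_common_nonzero[OF E(1) a_poly mpoly_fun_dot _ d(1)] e unfolding y2_def by blast
  then have kz: "k y2 z \<noteq> 0"
    by (simp add: k_def)
  have "vec.dim E \<le> 1" if "E \<subseteq> vec.span {z}"
    using vec.dim_le_card[OF that] by simp
  then obtain d' where d': "d' \<in> E" "d' \<notin> vec.span {z}"
    using dim by force
  obtain y3 where y3: "dot z y3 = 0" "dot d' y3 \<noteq> 0"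
    using span_separate[OF _ d'(2)] by auto
  have "indep (\<lambda>_::nat. k y2) {..<1} (hyp E y3)"
  proof (rule indepI)
    fix c and i :: nat assume c: "\<And>s. s \<in> hyp E y3 \<Longrightarrow> (\<Sum>i\<in>{..<1::nat}. c i * k y2 s) = 0" and i: "i \<in> {..<1}"
    have "z \<in> hyp E y3"
      using z(1) y3(1) by (simp add: hyp_def)
    from c[OF this] kz i show "c i = 0"
      by simp
  qed
  then have "rank_ge U (hyp E y3) 1"
    using k_in_U by (intro rank_geI[of "{..<1::nat}" _ "\<lambda>_. k y2"]) auto
  then have "1 \<le> U.rk (hyp E y3)"
    by (simp add: U.rank_ge_iff)
  also have "\<dots> \<le> U.rk (hyp E y)"
    using E(2) d'(1) y3(2) unfolding step_def by blast
  finally show ?thesis .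
qed

theorem kernel_rank_bound:
  assumes n: "3 \<le> CARD('n)" "\<kappa> choose 2 < CARD('n)" "CARD('n) \<le> (\<kappa> + 1) choose 2"
  shows "CARD('n) * \<kappa> \<le> U.rk UNIV + (\<kappa> choose 2) + 1"
proof -
  let ?n = "CARD('n)"
  obtain E :: "nat \<Rightarrow> (complex ^ 'n) set" and Y where En: "E ?n = UNIV"
    and sub: "\<And>j. 1 \<le> j \<Longrightarrow> j \<le> ?n \<Longrightarrow> vec.subspace (E j) \<and> vec.dim (E j) = j"
    and flag: "\<And>j. 2 \<le> j \<Longrightarrow> j \<le> ?n \<Longrightarrow>
       good (E j) (min t (Suc j)) \<and> step (E j) (Y j) \<and> E (j - 1) = hyp (E j) (Y j)"
    using flag_ex by blast
  define r where "r = (\<lambda>j. U.rk (E j))"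
  have "?n * \<kappa> \<le> r ?n + (\<kappa> choose 2) + 1"
  proof (rule rank_bound_arith[OF n t_lower_bound[OF n(2)]])
    have "E 1 = hyp (E 2) (Y 2)"
      using flag[of 2] n(1) by simp
    then show "1 \<le> r 1"
      using rank_line_positive[of "E 2" "Y 2"] flag[of 2] sub[of 2] n(1) by (auto simp: r_def)
    show "r b + r c \<le> r ?n" if "1 \<le> b" "1 \<le> c" "b + c = ?n" for b c
      using rank_sum_le[of "E b" "E c"] sub[of b] sub[of c] that by (simp add: r_def En)
    show "r (j - 1) + min t (Suc j) \<le> r j \<or>
      r (j - 1) + Suc (if j = ?n then 0 else min (r (Suc j) - r j) j) \<le> r j" if j: "2 \<le> j" "j \<le> ?n" for j
    proof (cases "saturated (E j)")
      case True
      then show ?thesis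
        using drop_saturated[of "E j" "Y j" "min t (Suc j)"] flag[OF j] sub[of j] j by (simp add: r_def)
    next
      case False
      have "rank_ge (mult_part (E j)) (E j) (if j = ?n then 0 else min (r (Suc j) - r j) j)"
      proof (cases "j = ?n")
        case False
        then have "E j = hyp (E (Suc j)) (Y (Suc j))" "step (E (Suc j)) (Y (Suc j))"
          using flag[of "Suc j"] j by auto
        then show ?thesis
          using rank_mult_part[of "E (Suc j)" "Y (Suc j)"] sub[of "Suc j"] sub[of j] j False
          by (simp add: r_def)
      qed simp
      then show ?thesis
        using drop_unsaturated[of "E j" "Y j"] flag[OF j] sub[of j] j False by (simp add: r_def)
    qed
  qed
  then show ?thesis
    by (simp add: r_def En)
qed

end

subsection \<open>Polarization of polynomials in \<open>z\<close> and \<open>cnj z\<close>\<close>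

text \<open>Polynomial in the first argument and conjugate polynomial in the second, recorded only
  on the curves that polarization needs: the conjugate parameter cancels the conjugation, and real
  parameters lie on the diagonal.\<close>

definition sesqui_poly :: "(complex ^ 'n \<Rightarrow> complex ^ 'n \<Rightarrow> complex) \<Rightarrow> bool" where
  "sesqui_poly H \<longleftrightarrow> (\<forall>a b. poly_fun (\<lambda>e. H (a + e *s b) (a + cnj e *s b)))"

lemma sesqui_poly_left: "f \<in> mpoly_fun \<Longrightarrow> sesqui_poly (\<lambda>z w. f z)"
  unfolding sesqui_poly_def by (simp add: mpoly_fun_line)

lemma sesqui_poly_right:
  fixes f :: "complex ^ 'n \<Rightarrow> complex"
  assumes "f \<in> mpoly_fun"
  shows "sesqui_poly (\<lambda>z w. cnj (f w))"
  unfolding sesqui_poly_def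
proof (intro allI)
  fix a b :: "complex ^ 'n"
  have "a + cnj e *s b = cnjv (cnjv a + e *s cnjv b)" for e
    by (simp add: vec_eq_iff)
  then show "poly_fun (\<lambda>e. cnj (f (a + cnj e *s b)))"
    using mpoly_fun_line[OF mpoly_fun_cnj[OF assms], of "cnjv a" "cnjv b"] by simp
qed

lemma sesqui_poly_const: "sesqui_poly (\<lambda>z w. c)"
  by (rule sesqui_poly_left) (rule mpoly_fun.const)

lemma sesqui_poly_mult:
  fixes G H :: "complex ^ 'n \<Rightarrow> complex ^ 'n \<Rightarrow> complex"
  assumes "sesqui_poly G" "sesqui_poly H"
  shows "sesqui_poly (\<lambda>z w. G z w * H z w)"
  unfolding sesqui_poly_def
proof (intro allI)
  fix a b :: "complex ^ 'n"
  show "poly_fun (\<lambda>e. G (a + e *s b) (a + cnj e *s b) * H (a + e *s b) (a + cnj e *s b))"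
    by (rule poly_fun_mult) (use assms in \<open>simp_all add: sesqui_poly_def\<close>)
qed

lemma sesqui_poly_diff:
  fixes G H :: "complex ^ 'n \<Rightarrow> complex ^ 'n \<Rightarrow> complex"
  assumes "sesqui_poly G" "sesqui_poly H"
  shows "sesqui_poly (\<lambda>z w. G z w - H z w)"
  unfolding sesqui_poly_def
proof (intro allI)
  fix a b :: "complex ^ 'n"
  show "poly_fun (\<lambda>e. G (a + e *s b) (a + cnj e *s b) - H (a + e *s b) (a + cnj e *s b))"
    by (rule poly_fun_diff) (use assms in \<open>simp_all add: sesqui_poly_def\<close>)
qed

lemma sesqui_poly_sum:
  fixes H :: "'i \<Rightarrow> complex ^ 'n \<Rightarrow> complex ^ 'n \<Rightarrow> complex"
  assumes "\<And>i. i \<in> I \<Longrightarrow> sesqui_poly (H i)"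
  shows "sesqui_poly (\<lambda>z w. \<Sum>i\<in>I. H i z w)"
  unfolding sesqui_poly_def
proof (intro allI)
  fix a b :: "complex ^ 'n"
  show "poly_fun (\<lambda>e. \<Sum>i\<in>I. H i (a + e *s b) (a + cnj e *s b))"
    by (rule poly_fun_sum) (use assms in \<open>simp add: sesqui_poly_def\<close>)
qed

lemma polarization:
  fixes G H :: "complex ^ 'n \<Rightarrow> complex ^ 'n \<Rightarrow> complex"
  assumes "sesqui_poly G" "sesqui_poly H" and diag: "\<And>z. G z z = H z z"
  shows "G z w = H z w"
proof (rule ccontr)
  assume neq: "G z w \<noteq> H z w"
  \<comment> \<open>Chosen so that parameter \<i> on the curve gives the pair \<open>z\<close>,
    \<open>w\<close>. The difference is a polynomial in the parameter that vanishes at all real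
    values, hence also at \<i>.\<close>
  define a b where "a = (1 / 2) *s (z + w)" and "b = (1 / (2 * \<i>)) *s (z - w)"
  have zw: "a + \<i> *s b = z" "a + cnj \<i> *s b = w"
    by (simp_all add: a_def b_def vec_eq_iff field_simps)
  let ?p = "\<lambda>e. G (a + e *s b) (a + cnj e *s b) - H (a + e *s b) (a + cnj e *s b)"
  have "poly_fun ?p"
    using sesqui_poly_diff[OF assms(1,2)] unfolding sesqui_poly_def by blast
  moreover have "?p \<i> \<noteq> 0"
    unfolding zw using neq by simp
  ultimately have "finite {e. ?p e = 0}"
    by (rule poly_fun_finite_zeros)
  moreover have "range complex_of_real \<subseteq> {e. ?p e = 0}"
    using diag by auto
  ultimately have "finite (range complex_of_real)"
    by (rule rev_finite_subset)
  then show False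
    using infinite_UNIV_char_0[where 'a=real] by (auto dest!: finite_imageD simp: inj_on_def)
qed

definition pol_eval :: "'n::finite bi_poly \<Rightarrow> complex ^ 'n \<Rightarrow> complex ^ 'n \<Rightarrow> complex" where
  "pol_eval A z w = (\<Sum>(\<alpha>, \<beta>)\<in>Poly_Mapping.keys A.
     Poly_Mapping.lookup A (\<alpha>, \<beta>) * mindex_power z \<alpha> * cnj (mindex_power w \<beta>))"

lemma pol_eval_diag: "pol_eval A z z = bi_eval A z"
  by (simp add: pol_eval_def bi_eval_def)

lemma mpoly_fun_mindex_power: "(\<lambda>z. mindex_power z \<alpha>) \<in> mpoly_fun"
  unfolding mindex_power_def by (intro mpoly_fun_prod mpoly_fun_power mpoly_fun.coord)

lemma mpoly_fun_hol_eval: "hol_eval f \<in> mpoly_fun"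
proof -
  have "(\<lambda>z. hol_eval f z) \<in> mpoly_fun"
    unfolding hol_eval_def by (intro mpoly_fun_sum mpoly_fun.mult mpoly_fun.const mpoly_fun_mindex_power)
  then show ?thesis
    by simp
qed

lemma mpoly_fun_pol_eval: "(\<lambda>z. pol_eval A z w) \<in> mpoly_fun"
  unfolding pol_eval_def case_prod_unfold
  by (intro mpoly_fun_sum mpoly_fun.mult mpoly_fun.const mpoly_fun_mindex_power)

lemma sesqui_poly_pol_eval: "sesqui_poly (pol_eval A)"
proof -
  have "sesqui_poly (\<lambda>z w. pol_eval A z w)"
    unfolding pol_eval_def case_prod_unfold
    by (intro sesqui_poly_sum sesqui_poly_mult sesqui_poly_const sesqui_poly_left sesqui_poly_right
        mpoly_fun_mindex_power)
  then show ?thesis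
    by simp
qed

lemma sesqui_poly_dot: "sesqui_poly (\<lambda>z w. dot z (cnjv w))"
  unfolding dot_def cnjv_nth
  by (intro sesqui_poly_sum sesqui_poly_mult sesqui_poly_left sesqui_poly_right mpoly_fun.coord)

lemma sesqui_poly_squares: "sesqui_poly (\<lambda>z w. \<Sum>\<mu><m. hol_eval (f \<mu>) z * cnj (hol_eval (f \<mu>) w))"
  by (intro sesqui_poly_sum sesqui_poly_mult sesqui_poly_left sesqui_poly_right mpoly_fun_hol_eval)

lemma dot_cnjv_self: "dot z (cnjv z) = complex_of_real ((norm z)\<^sup>2)"
proof -
  have "(norm z)\<^sup>2 = (\<Sum>j\<in>UNIV. (cmod (z $ j))\<^sup>2)"
    by (simp add: norm_vec_def L2_set_def sum_nonneg)
  then show ?thesis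
    by (simp add: dot_def complex_norm_square del: of_real_power)
qed

lemma pol_eval_mult_norm_sq: "pol_eval (A * norm_sq) z w = pol_eval A z w * dot z (cnjv w)"
proof (rule polarization[where H = "\<lambda>z w. pol_eval A z w * dot z (cnjv w)"])
  show "sesqui_poly (\<lambda>z w. pol_eval A z w * dot z (cnjv w))"
    by (rule sesqui_poly_mult[OF sesqui_poly_pol_eval sesqui_poly_dot])
  show "pol_eval (A * norm_sq) z z = pol_eval A z z * dot z (cnjv z)" for z
    by (simp only: pol_eval_diag bi_eval_mult bi_eval_norm_sq dot_cnjv_self)
qed (rule sesqui_poly_pol_eval)

lemma pol_eval_hermitian:
  assumes "hermitian A"
  shows "pol_eval A w z = cnj (pol_eval A z w)"
proof -
  have l: "Poly_Mapping.lookup A (snd k, fst k) = cnj (Poly_Mapping.lookup A k)" for k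
  proof -
    have "Poly_Mapping.lookup A (snd k, fst k) = cnj (Poly_Mapping.lookup A (fst k, snd k))"
      using assms unfolding hermitian_def by blast
    then show ?thesis
      by (simp only: prod.collapse)
  qed
  then have "(snd k, fst k) \<in> Poly_Mapping.keys A" if "k \<in> Poly_Mapping.keys A" for k
    using that by (simp add: in_keys_iff)
  then show ?thesis
    unfolding pol_eval_def cnj_sum case_prod_unfold
    by (intro sum.reindex_bij_witness[of _ "\<lambda>k. (snd k, fst k)" "\<lambda>k. (snd k, fst k)"])
      (auto simp: l mult_ac)
qed

section \<open>Column functions and the coefficient matrix\<close>

lemma pol_eval_columns:
  assumes "finite S" "finite T" "Poly_Mapping.keys A \<subseteq> S \<times> T"
  shows "pol_eval A z w = (\<Sum>\<beta>\<in>T. \<Sum>\<alpha>\<in>S. cnj (mindex_power w \<beta>) * Poly_Mapping.lookup A (\<alpha>, \<beta>) * mindex_power z \<alpha>)"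
proof -
  have "pol_eval A z w = (\<Sum>(\<alpha>, \<beta>)\<in>S \<times> T.
      Poly_Mapping.lookup A (\<alpha>, \<beta>) * mindex_power z \<alpha> * cnj (mindex_power w \<beta>))"
    unfolding pol_eval_def using assms
    by (intro sum.mono_neutral_left) (auto simp: in_keys_iff)
  also have "\<dots> = (\<Sum>\<alpha>\<in>S. \<Sum>\<beta>\<in>T.
      Poly_Mapping.lookup A (\<alpha>, \<beta>) * mindex_power z \<alpha> * cnj (mindex_power w \<beta>))"
    by (rule sum.cartesian_product[symmetric])
  also have "\<dots> = (\<Sum>\<beta>\<in>T. \<Sum>\<alpha>\<in>S.
      Poly_Mapping.lookup A (\<alpha>, \<beta>) * mindex_power z \<alpha> * cnj (mindex_power w \<beta>))"
    by (rule sum.swap)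
  finally show ?thesis
    by (simp add: mult_ac)
qed

lemma keys_subset_fst_snd: "Poly_Mapping.keys A \<subseteq> fst ` Poly_Mapping.keys A \<times> snd ` Poly_Mapping.keys A"
  by force

lemma monomial_combinations_subspace:
  assumes "cfun.subspace V"
  shows "cfun.subspace ((\<lambda>c z. \<Sum>\<alpha>\<in>S. c \<alpha> * mindex_power z \<alpha>) ` V)"
proof (rule cfun.subspaceI)
  let ?L = "\<lambda>c z. \<Sum>\<alpha>\<in>S. c \<alpha> * mindex_power z \<alpha>"
  show "0 \<in> ?L ` V"
    by (rule image_eqI[of _ _ 0]) (auto simp: cfun.subspace_0[OF assms] fun_eq_iff)
  show "x + y \<in> ?L ` V" if xy: "x \<in> ?L ` V" "y \<in> ?L ` V" for x y
  proof -
    obtain c d where "c \<in> V" "x = ?L c" "d \<in> V" "y = ?L d"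
      using xy by (elim imageE)
    then show ?thesis
      by (intro image_eqI[of _ _ "c + d"])
        (auto simp: cfun.subspace_add[OF assms] fun_eq_iff sum.distrib distrib_right)
  qed
  show "(\<lambda>i. e * x i) \<in> ?L ` V" if x: "x \<in> ?L ` V" for e x
  proof -
    obtain c where "c \<in> V" "x = ?L c"
      using x by (elim imageE)
    then show ?thesis
      by (intro image_eqI[of _ _ "\<lambda>i. e * c i"])
        (auto simp: cfun.subspace_scale[OF assms] fun_eq_iff sum_distrib_left mult.assoc)
  qed
qed

text \<open>The column functions are images, under passage from coefficients to polynomial
  functions, of combinations of matrix columns. A linear map cannot create independence, so the
  matrix rank is at least the rank of the functions.\<close>

lemma rank_le_herm_rank:
  assumes "rank_ge (cfun.span (range (\<lambda>w z. pol_eval A z w))) UNIV m"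
  shows "m \<le> herm_rank A"
proof -
  let ?S = "fst ` Poly_Mapping.keys A" and ?T = "snd ` Poly_Mapping.keys A"
  let ?c = "\<lambda>\<beta> \<alpha>. Poly_Mapping.lookup A (\<alpha>, \<beta>)"
  let ?V = "cfun.span (range ?c)" and ?L = "\<lambda>c z. \<Sum>\<alpha>\<in>?S. c \<alpha> * mindex_power z \<alpha>"
  have "(\<lambda>z. pol_eval A z w) \<in> ?L ` ?V" for w
  proof (rule image_eqI)
    show "(\<lambda>\<alpha>. \<Sum>\<beta>\<in>?T. cnj (mindex_power w \<beta>) * ?c \<beta> \<alpha>) \<in> ?V"
      by (intro subspace_lincomb[OF cfun.subspace_span] cfun.span_base) simp
    show "(\<lambda>z. pol_eval A z w) = ?L (\<lambda>\<alpha>. \<Sum>\<beta>\<in>?T. cnj (mindex_power w \<beta>) * ?c \<beta> \<alpha>)"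
      by (rule ext, subst pol_eval_columns[OF _ _ keys_subset_fst_snd])
        (simp_all add: sum_distrib_right sum.swap[of _ ?S ?T])
  qed
  then have "cfun.span (range (\<lambda>w z. pol_eval A z w)) \<subseteq> ?L ` ?V"
    by (intro cfun.span_minimal monomial_combinations_subspace cfun.subspace_span) auto
  then obtain u :: "nat \<Rightarrow> _" where u: "u ` {..<m} \<subseteq> ?L ` ?V" "indep u {..<m} UNIV"
    using assms unfolding rank_ge_def by blast
  have "\<forall>i\<in>{..<m}. \<exists>c. c \<in> ?V \<and> u i = ?L c"
    using u(1) by blast
  from bchoice[OF this] obtain d where "\<forall>i\<in>{..<m}. d i \<in> ?V \<and> u i = ?L (d i)"
    by (elim exE)
  then have d: "d i \<in> ?V" "u i = ?L (d i)" if "i < m" for i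
    using that by simp_all
  have ind: "indep d {..<m} UNIV"
  proof (rule indepI)
    fix e i assume e: "\<And>\<alpha>. \<alpha> \<in> UNIV \<Longrightarrow> (\<Sum>i<m. e i * d i \<alpha>) = 0" and i: "i \<in> {..<m}"
    have "(\<Sum>i<m. e i * u i z) = 0" for z
    proof -
      have "(\<Sum>i<m. e i * u i z) = (\<Sum>i<m. \<Sum>\<alpha>\<in>?S. e i * d i \<alpha> * mindex_power z \<alpha>)"
        by (intro sum.cong refl) (simp add: d(2) sum_distrib_left mult.assoc)
      also have "\<dots> = (\<Sum>\<alpha>\<in>?S. (\<Sum>i<m. e i * d i \<alpha>) * mindex_power z \<alpha>)"
        by (subst sum.swap) (simp add: sum_distrib_right)
      finally show ?thesis
        using e by simp
    qed
    then show "e i = 0"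
      using indepD[OF u(2) _ i, of e] by simp
  qed
  obtain B where B: "B \<subseteq> range ?c" "range ?c \<subseteq> cfun.span B" "card B = cfun.dim (range ?c)"
    using cfun.basis_exists[of "range ?c"] by metis
  \<comment> \<open>Only finitely many columns are nonzero. This makes the basis \<open>B\<close>
    finite, without which \<open>card B\<close> would be 0 and bound nothing.\<close>
  have "?c \<beta> \<in> insert 0 (?c ` ?T)" for \<beta>
  proof (cases "\<beta> \<in> ?T")
    case False
    then have "(\<alpha>, \<beta>) \<notin> Poly_Mapping.keys A" for \<alpha>
      by force
    then have "?c \<beta> = 0"
      by (auto simp: fun_eq_iff in_keys_iff)
    then show ?thesis
      by simp
  qed simp
  then have "finite B"
    using finite_subset[of B "insert 0 (?c ` ?T)"] B(1) by fastforce
  moreover have "?V \<subseteq> cfun.span B"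
    using B(2) by (rule cfun.span_minimal) (rule cfun.subspace_span)
  ultimately have "card {..<m} \<le> card B"
    using d(1) by (intro card_le_of_indep[OF ind]) auto
  then show ?thesis
    by (simp add: B(3) herm_rank_def)
qed

section \<open>From positive semidefinite kernels back to sums of squares\<close>

lemma hol_eval_sum_single:
  assumes "finite S"
  shows "hol_eval (\<Sum>\<alpha>\<in>S. Poly_Mapping.single \<alpha> (c \<alpha>)) z = (\<Sum>\<alpha>\<in>S. c \<alpha> * mindex_power z \<alpha>)"
proof -
  let ?f = "\<Sum>\<alpha>\<in>S. Poly_Mapping.single \<alpha> (c \<alpha>)"
  have l: "Poly_Mapping.lookup ?f \<alpha> = (if \<alpha> \<in> S then c \<alpha> else 0)" for \<alpha>
    using assms by (simp add: lookup_sum lookup_single when_def sum.delta)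
  have "hol_eval ?f z = (\<Sum>\<alpha>\<in>S. Poly_Mapping.lookup ?f \<alpha> * mindex_power z \<alpha>)"
    unfolding hol_eval_def using assms
    by (intro sum.mono_neutral_left) (auto simp: in_keys_iff l split: if_splits)
  then show ?thesis
    by (simp add: l)
qed

lemma pol_eval_col_in_span:
  "(\<lambda>z. pol_eval A z w) \<in> cfun.span ((\<lambda>\<alpha> z. mindex_power z \<alpha>) ` fst ` Poly_Mapping.keys A)"
  unfolding pol_eval_def case_prod_unfold
proof -
  have "(\<lambda>z. \<Sum>k\<in>Poly_Mapping.keys A. (Poly_Mapping.lookup A (fst k, snd k) * cnj (mindex_power w (snd k))) *
      mindex_power z (fst k)) \<in> cfun.span ((\<lambda>\<alpha> z. mindex_power z \<alpha>) ` fst ` Poly_Mapping.keys A)"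
    by (intro subspace_lincomb[OF cfun.subspace_span] cfun.span_base) auto
  then show "(\<lambda>z. \<Sum>k\<in>Poly_Mapping.keys A. Poly_Mapping.lookup A (fst k, snd k) * mindex_power z (fst k) *
      cnj (mindex_power w (snd k))) \<in> cfun.span ((\<lambda>\<alpha> z. mindex_power z \<alpha>) ` fst ` Poly_Mapping.keys A)"
    by (simp add: mult_ac)
qed

text \<open>\<open>psd_imp_gram\<close> keeps the factors in the span of the monomials occurring in
  \<open>A\<close>, so they are values of holomorphic polynomials and not just arbitrary
  functions.\<close>

lemma psd_imp_SOS:
  assumes "hermitian A" "psd (pol_eval A)"
  shows "A \<in> SOS"
proof -
  let ?S = "fst ` Poly_Mapping.keys A"
  let ?T = "(\<lambda>\<alpha> z. mindex_power z \<alpha>) ` ?S"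
  have "finite ?T"
    by simp
  from psd_imp_gram[OF pol_eval_hermitian[OF assms(1)] assms(2) this pol_eval_col_in_span]
  obtain m :: nat and f where f: "\<And>\<mu>. \<mu> < m \<Longrightarrow> f \<mu> \<in> cfun.span ?T"
    and A: "\<And>z w. pol_eval A z w = (\<Sum>\<mu><m. f \<mu> z * cnj (f \<mu> w))"
    by blast
  let ?L = "\<lambda>c z. \<Sum>\<alpha>\<in>?S. c \<alpha> * mindex_power z \<alpha>"
  have "(\<lambda>z. mindex_power z \<alpha>) \<in> range ?L" if "\<alpha> \<in> ?S" for \<alpha>
    using that
    by (intro image_eqI[of _ _ "\<lambda>\<alpha>'. if \<alpha>' = \<alpha> then 1 else 0"])
      (simp_all add: if_distrib[of "\<lambda>x. x * _"] cong: if_cong)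
  then have "cfun.span ?T \<subseteq> range ?L"
    by (intro cfun.span_minimal monomial_combinations_subspace cfun.subspace_UNIV) auto
  then have "\<exists>g. \<forall>z. f \<mu> z = hol_eval g z" if "\<mu> < m" for \<mu>
  proof -
    have "f \<mu> \<in> cfun.span ?T"
      using that by (rule f)
    then obtain c where "f \<mu> = ?L c"
      using \<open>cfun.span ?T \<subseteq> range ?L\<close> by blast
    then show ?thesis
      by (intro exI[of _ "\<Sum>\<alpha>\<in>?S. Poly_Mapping.single \<alpha> (c \<alpha>)"]) (simp add: hol_eval_sum_single)
  qed
  then obtain g where g: "\<And>\<mu> z. \<mu> < m \<Longrightarrow> f \<mu> z = hol_eval (g \<mu>) z"
    by metis
  have "bi_eval A z = complex_of_real (\<Sum>\<mu><m. (cmod (hol_eval (g \<mu>) z))\<^sup>2)" for z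
    unfolding pol_eval_diag[symmetric] A by (simp add: g complex_norm_square del: of_real_power)
  then show ?thesis
    unfolding SOS_def by blast
qed

theorem theorem1p4:
  fixes A :: "'n::finite bi_poly" and \<kappa> :: nat
  assumes "CARD('n) \<ge> 3"
    and "\<kappa> choose 2 < CARD('n)" and "CARD('n) \<le> (\<kappa> + 1) choose 2"
    and "hermitian A"
    and "A \<notin> SOS"
    and "A * norm_sq \<in> SOS"
  shows "int (herm_rank (A * norm_sq)) \<ge> int CARD('n) * int \<kappa> - int (\<kappa> choose 2) - 1"
proof -
  obtain m :: nat and f where f: "\<And>z. bi_eval (A * norm_sq) z = complex_of_real (\<Sum>\<mu><m. (cmod (hol_eval (f \<mu>) z))\<^sup>2)"
    using assms(6) unfolding SOS_def by blast
  have f_diag: "pol_eval (A * norm_sq) z z = (\<Sum>\<mu><m. hol_eval (f \<mu>) z * cnj (hol_eval (f \<mu>) z))" for z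
    unfolding pol_eval_diag f by (simp add: complex_norm_square del: of_real_power)
  have pos: "0 \<le> Re (bi_eval A z)" if "z \<noteq> 0" for z
  proof -
    have "Re (bi_eval A z) * (norm z)\<^sup>2 = (\<Sum>\<mu><m. (cmod (hol_eval (f \<mu>) z))\<^sup>2)"
      using arg_cong[OF f[of z], of Re] unfolding bi_eval_mult bi_eval_norm_sq
      by (simp del: of_real_power of_real_sum)
    then have "0 \<le> Re (bi_eval A z) * (norm z)\<^sup>2"
      by (simp add: sum_nonneg)
    then show ?thesis
      using that by (simp add: zero_le_mult_iff)
  qed
  have cont: "continuous_on UNIV (bi_eval A)"
    unfolding bi_eval_def mindex_power_def case_prod_unfold by (intro continuous_intros)
  interpret sos_kernel "pol_eval A" "(\<lambda>\<alpha> z. mindex_power z \<alpha>) ` fst ` Poly_Mapping.keys A" m "\<lambda>\<mu>. hol_eval (f \<mu>)"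
  proof unfold_locales
    show "pol_eval A w z = cnj (pol_eval A z w)" for w z
      by (rule pol_eval_hermitian[OF assms(4)])
    show "\<not> psd (pol_eval A)"
      using psd_imp_SOS assms(4,5) by blast
    show "0 \<le> Re (pol_eval A z z)" for z
    proof -
      \<comment> \<open>Division by the squared norm says nothing at the origin. But the set of
        negative values is open and contained in a single point, hence empty.\<close>
      let ?N = "{z. Re (bi_eval A z) < 0}"
      have "open ?N"
        by (intro open_Collect_less continuous_intros cont)
      moreover have "?N \<subseteq> {0}"
        using pos by (auto simp: not_le[symmetric])
      then have "finite ?N"
        by (rule finite_subset) simp
      ultimately have "?N = {}"
        using finite_imp_not_open by blast
      then show ?thesis
        unfolding pol_eval_diag by (auto simp: not_le[symmetric])
    qed
    show "pol_eval A z w * dot z (cnjv w) = (\<Sum>\<mu><m. hol_eval (f \<mu>) z * cnj (hol_eval (f \<mu>) w))" for z w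
      unfolding pol_eval_mult_norm_sq[symmetric]
      by (rule polarization[where H = "\<lambda>z w. \<Sum>\<mu><m. hol_eval (f \<mu>) z * cnj (hol_eval (f \<mu>) w)"])
        (rule sesqui_poly_pol_eval sesqui_poly_squares f_diag)+
  qed (auto simp: mpoly_fun_pol_eval pol_eval_col_in_span)
  have "k y = (\<lambda>z. pol_eval (A * norm_sq) z (cnjv y))" for y
    by (simp add: k_def a_def pol_eval_mult_norm_sq fun_eq_iff)
  then have "U \<subseteq> cfun.span (range (\<lambda>w z. pol_eval (A * norm_sq) z w))"
    unfolding U_def by (intro cfun.span_mono) auto
  then have "rank_ge (cfun.span (range (\<lambda>w z. pol_eval (A * norm_sq) z w))) UNIV (U.rk UNIV)"
    using rank_ge_mono[of U UNIV "U.rk UNIV"] by (simp add: U.rank_ge_iff)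
  then have "U.rk UNIV \<le> herm_rank (A * norm_sq)"
    by (rule rank_le_herm_rank)
  then have "CARD('n) * \<kappa> \<le> herm_rank (A * norm_sq) + (\<kappa> choose 2) + 1"
    using kernel_rank_bound[OF assms(1-3)] by linarith
  then have "int (CARD('n) * \<kappa>) \<le> int (herm_rank (A * norm_sq) + (\<kappa> choose 2) + 1)"
    by (simp only: of_nat_le_iff)
  then show ?thesis
    by simp
qed

end
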